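(* Let $K$ be an algebraically closed field of arbitrary characteristic, let $n\ge 3$, and let $C\subset\mathbb{P}^n_K$ be a smooth rational curve of degree $e$. The natural map $$\phi: H^0(\mathcal{I}_{C/\mathbb{P}^n}(d))\longrightarrow H^0(N_{C/\mathbb{P}^n}^*(d))=\mathrm{Hom}(N_{C/\mathbb{P}^n},\mathcal{O}_{\mathbb{P}^1}(ed))$$ is surjective in each of the following cases: (1) $C=R_e$ is a rational normal curve of degree $e\le n$ and $d\ge 3$; (2) $C$ is a general rational curve of degree $e=n+1$, and $d,n\ge 5$.
   Context: $\mathcal{I}_{C/\mathbb{P}^n}$ is the ideal sheaf of $C$ and $N_{C/\mathbb{P}^n}^*=\mathcal{I}_{C/\mathbb{P}^n}/\mathcal{I}_{C/\mathbb{P}^n}^2$ is the conormal bundle; $C$ is identified with $\mathbb{P}^1$, so $\mathcal{O}_{\mathbb{P}^n}(d)|_C=\mathcal{O}_{\mathbb{P}^1}(ed)$. The map $\phi$ is the map on global sections induced by the quotient $\mathcal{I}_{C/\mathbb{P}^n}\otimes\mathcal{O}_{\mathbb{P}^n}(d)\to N_{C/\mathbb{P}^n}^*\otimes\mathcal{O}_{\mathbb{P}^n}(d)$ with kernel $\mathcal{I}_{C/\mathbb{P}^n}^2\otimes\mathcal{O}_{\mathbb{P}^n}(d)$. For $1\le e\le n$, a rational normal curve $R_e\subset\mathbb{P}^n$ of degree $e$ is a curve projectively equivalent to the image of $[s:t]\mapsto[s^e:s^{e-1}t:\cdots:st^{e-1}:t^e:0:\cdots:0]$. A general rational curve of degree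 $n+1$ is the image of a general morphism $\mathbb{P}^1\to\mathbb{P}^n$ given by $n+1$ forms of degree $n+1$. *)

theory Defs
  imports
    "HOL-Library.Poly_Mapping"
    "HOL-Library.FuncSet"
    "HOL-Computational_Algebra.Polynomial"
    "Jordan_Normal_Form.Matrix"
begin

text \<open>
  Everything is done in the language of classical varieties over an algebraically closed field
  (closed points, sections as functions). A point of projective n-space is given by its homogeneous
  coordinates, i.e. a nonzero vector of length \<open>n + 1\<close>; a subset of projective space is the
  set of all coordinate vectors of its points, hence a subset of \<open>pcone n\<close> stable under scaling.
\<close>

section \<open>Polynomials and the Zariski topology\<close>

definition mp_eval ::
    "(('v \<Rightarrow>\<^sub>0 nat) \<Rightarrow>\<^sub>0 'a::comm_ring_1) \<Rightarrow> ('v \<Rightarrow> 'a) \<Rightarrow> 'a" where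
  "mp_eval F x = (\<Sum>m\<in>Poly_Mapping.keys F. Poly_Mapping.lookup F m *
      (\<Prod>i\<in>Poly_Mapping.keys m. x i ^ Poly_Mapping.lookup m i))"

definition mp_in :: "'v set \<Rightarrow> (('v \<Rightarrow>\<^sub>0 nat) \<Rightarrow>\<^sub>0 'a::comm_ring_1) \<Rightarrow> bool" where
  "mp_in I F \<longleftrightarrow> (\<forall>m\<in>Poly_Mapping.keys F. Poly_Mapping.keys m \<subseteq> I)"

definition form :: "nat \<Rightarrow> nat \<Rightarrow> ((nat \<Rightarrow>\<^sub>0 nat) \<Rightarrow>\<^sub>0 'a::comm_ring_1) \<Rightarrow> bool" where
  "form n k F \<longleftrightarrow> mp_in {..n} F \<and>
     (\<forall>m\<in>Poly_Mapping.keys F. (\<Sum>i\<in>Poly_Mapping.keys m. Poly_Mapping.lookup m i) = k)"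

abbreviation ev :: "((nat \<Rightarrow>\<^sub>0 nat) \<Rightarrow>\<^sub>0 'a::comm_ring_1) \<Rightarrow> 'a vec \<Rightarrow> 'a" where
  "ev F x \<equiv> mp_eval F (\<lambda>i. x $ i)"

definition pcone :: "nat \<Rightarrow> 'a::field vec set" where
  "pcone n = carrier_vec (n + 1) - {0\<^sub>v (n + 1)}"

definition zopen :: "nat \<Rightarrow> 'a::field vec set \<Rightarrow> bool" where
  "zopen n U \<longleftrightarrow> (\<exists>S. (\<forall>F\<in>S. \<exists>k. form n k F) \<and> U = {x \<in> pcone n. \<exists>F\<in>S. ev F x \<noteq> 0})"

section \<open>The twisted ideal sheaf, its square and the twisted conormal sheaf\<close>

text \<open>
  \<open>twist n d U\<close> are the sections over \<open>U\<close> of the line bundle \<open>O(d)\<close>, \<open>ideal_twist n C d U\<close> those of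
  the subsheaf \<open>I(d)\<close> of sections vanishing on \<open>C\<close> (the ideal sheaf of the reduced subscheme
  \<open>C\<close>), and \<open>ideal_sq n C d U\<close> those of \<open>I^2(d)\<close>, the subsheaf of \<open>O(d)\<close> locally
  generated by products of sections of \<open>I = I(0)\<close> and \<open>I(d)\<close>.
\<close>

definition twist :: "nat \<Rightarrow> nat \<Rightarrow> 'a::field vec set \<Rightarrow> ('a vec \<Rightarrow> 'a) set" where
  "twist n d U = {s \<in> extensional U. \<forall>x\<in>U. \<exists>W F G g.
      zopen n W \<and> x \<in> W \<and> W \<subseteq> U \<and> form n (g + d) F \<and> form n g G \<and>
      (\<forall>y\<in>W. ev G y \<noteq> 0 \<and> s y = ev F y / ev G y)}"

definition ideal_twist ::
    "nat \<Rightarrow> 'a::field vec set \<Rightarrow> nat \<Rightarrow> 'a vec set \<Rightarrow> ('a vec \<Rightarrow> 'a) set" where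
  "ideal_twist n C d U = {s \<in> twist n d U. \<forall>x\<in>U \<inter> C. s x = 0}"

definition ideal_sq ::
    "nat \<Rightarrow> 'a::field vec set \<Rightarrow> nat \<Rightarrow> 'a vec set \<Rightarrow> ('a vec \<Rightarrow> 'a) set" where
  "ideal_sq n C d U = {s \<in> extensional U. \<forall>x\<in>U. \<exists>W (k::nat) a b.
      zopen n W \<and> x \<in> W \<and> W \<subseteq> U \<and>
      (\<forall>i<k. a i \<in> ideal_twist n C 0 W \<and> b i \<in> ideal_twist n C d W) \<and>
      (\<forall>y\<in>W. s y = (\<Sum>i<k. a i y * b i y))}"

text \<open>
  The class of \<open>s \<in> ideal_twist n C d U\<close> in the stalk at \<open>x \<in> U\<close> of the quotient sheaf
  \<open>I(d) / I^2(d)\<close>, as an equivalence class of local sections of \<open>I(d)\<close>.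
\<close>

definition conormal_germ ::
    "nat \<Rightarrow> 'a::field vec set \<Rightarrow> nat \<Rightarrow> 'a vec \<Rightarrow> 'a vec set \<Rightarrow> ('a vec \<Rightarrow> 'a)
      \<Rightarrow> ('a vec set \<times> ('a vec \<Rightarrow> 'a)) set" where
  "conormal_germ n C d x U s = {(V, t). zopen n V \<and> x \<in> V \<and> t \<in> ideal_twist n C d V \<and>
      (\<exists>W. zopen n W \<and> x \<in> W \<and> W \<subseteq> U \<inter> V \<and> (\<lambda>y\<in>W. s y - t y) \<in> ideal_sq n C d W)}"

definition H0_ideal :: "nat \<Rightarrow> 'a::field vec set \<Rightarrow> nat \<Rightarrow> ('a vec \<Rightarrow> 'a) set" where
  "H0_ideal n C d = ideal_twist n C d (pcone n)"

text \<open>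
  Global sections of the quotient sheaf, i.e. of the sheafification of
  \<open>U \<mapsto> I(d)(U) / I^2(d)(U)\<close>: families of germs that are locally induced by a section of \<open>I(d)\<close>.
\<close>

definition H0_conormal ::
    "nat \<Rightarrow> 'a::field vec set \<Rightarrow> nat
      \<Rightarrow> ('a vec \<Rightarrow> ('a vec set \<times> ('a vec \<Rightarrow> 'a)) set) set" where
  "H0_conormal n C d = {\<sigma> \<in> extensional (pcone n). \<forall>x\<in>pcone n. \<exists>U s.
      zopen n U \<and> x \<in> U \<and> s \<in> ideal_twist n C d U \<and> (\<forall>y\<in>U. \<sigma> y = conormal_germ n C d y U s)}"

definition conormal_map ::
    "nat \<Rightarrow> 'a::field vec set \<Rightarrow> nat \<Rightarrow> ('a vec \<Rightarrow> 'a)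
      \<Rightarrow> 'a vec \<Rightarrow> ('a vec set \<times> ('a vec \<Rightarrow> 'a)) set" where
  "conormal_map n C d s = (\<lambda>x\<in>pcone n. conormal_germ n C d x (pcone n) s)"

definition conormal_map_surj :: "nat \<Rightarrow> 'a::field vec set \<Rightarrow> nat \<Rightarrow> bool" where
  "conormal_map_surj n C d \<longleftrightarrow> conormal_map n C d ` H0_ideal n C d = H0_conormal n C d"

section \<open>Rational curves\<close>

text \<open>
  An \<open>(n + 1)\<close>-tuple of binary forms of degree \<open>e\<close> is given by its matrix of coefficients \<open>A\<close>: its
  value at \<open>(s, t)\<close> is \<open>A *\<^sub>v veronese e s t\<close>, and \<open>A *\<^sub>v dveronese e s t u w\<close> is its (formal)
  derivative at \<open>(s, t)\<close> in the direction \<open>(u, w)\<close>.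
\<close>

definition veronese :: "nat \<Rightarrow> 'a::field \<Rightarrow> 'a \<Rightarrow> 'a vec" where
  "veronese e s t = vec (e + 1) (\<lambda>j. s ^ (e - j) * t ^ j)"

definition dveronese :: "nat \<Rightarrow> 'a::field \<Rightarrow> 'a \<Rightarrow> 'a \<Rightarrow> 'a \<Rightarrow> 'a vec" where
  "dveronese e s t u w = vec (e + 1) (\<lambda>j.
      of_nat (e - j) * s ^ (e - j - 1) * t ^ j * u + of_nat j * s ^ (e - j) * t ^ (j - 1) * w)"

definition P1_morphism :: "nat \<Rightarrow> nat \<Rightarrow> 'a::field mat \<Rightarrow> bool" where
  "P1_morphism n e A \<longleftrightarrow> A \<in> carrier_mat (n + 1) (e + 1) \<and>
     (\<forall>s t. (s, t) \<noteq> (0, 0) \<longrightarrow> A *\<^sub>v veronese e s t \<noteq> 0\<^sub>v (n + 1))"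

definition P1_image :: "nat \<Rightarrow> 'a::field mat \<Rightarrow> 'a vec set" where
  "P1_image e A = {c \<cdot>\<^sub>v (A *\<^sub>v veronese e s t) | c s t. c \<noteq> 0 \<and> (s, t) \<noteq> (0, 0)}"

text \<open>
  A closed embedding of the projective line: injective on points and on tangent vectors. The
  differential at \<open>[s : t]\<close> kills no tangent vector iff the value and the derivative in any direction
  \<open>(u, w)\<close> not proportional to \<open>(s, t)\<close> are linearly independent. (Asking instead that the two
  partial derivatives be independent would be wrong if the characteristic divides \<open>e\<close>: by
  Euler's relation they are then always dependent.)
\<close>

definition P1_embedding :: "nat \<Rightarrow> nat \<Rightarrow> 'a::field mat \<Rightarrow> bool" where
  "P1_embedding n e A \<longleftrightarrow> P1_morphism n e A \<and>
     (\<forall>s t s' t' c. (s, t) \<noteq> (0, 0) \<longrightarrow> (s', t') \<noteq> (0, 0) \<longrightarrow>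
        A *\<^sub>v veronese e s' t' = c \<cdot>\<^sub>v (A *\<^sub>v veronese e s t) \<longrightarrow> s * t' = t * s') \<and>
     (\<forall>s t u w c. s * w \<noteq> t * u \<longrightarrow>
        A *\<^sub>v dveronese e s t u w \<noteq> c \<cdot>\<^sub>v (A *\<^sub>v veronese e s t))"

definition smooth_rational_curve :: "nat \<Rightarrow> nat \<Rightarrow> 'a::field vec set \<Rightarrow> bool" where
  "smooth_rational_curve n e C \<longleftrightarrow> (\<exists>A. P1_embedding n e A \<and> C = P1_image e A)"

definition rational_normal_curve :: "nat \<Rightarrow> nat \<Rightarrow> 'a::field vec set \<Rightarrow> bool" where
  "rational_normal_curve n e C \<longleftrightarrow> 1 \<le> e \<and> e \<le> n \<and>
     (\<exists>M \<in> carrier_mat (n + 1) (n + 1). invertible_mat M \<and>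
        C = (\<lambda>x. M *\<^sub>v x) `
              P1_image e (mat (n + 1) (e + 1) (\<lambda>(i, j). if i = j then 1 else 0)))"

text \<open>
  A property holds for a general morphism given by \<open>n + 1\<close> forms of degree \<open>e\<close> if it holds on a
  nonempty Zariski open subset of the (irreducible) space of coefficient matrices of such morphisms.
\<close>

definition general_P1_morphism :: "nat \<Rightarrow> nat \<Rightarrow> ('a::field mat \<Rightarrow> bool) \<Rightarrow> bool" where
  "general_P1_morphism n e Q \<longleftrightarrow>
     (\<exists>S U. (\<forall>P\<in>S. mp_in ({..n} \<times> {..e}) P) \<and>
        U = {A. P1_morphism n e A \<and> (\<exists>P\<in>S. mp_eval P (\<lambda>ij. A $$ ij) \<noteq> 0)} \<and>
        U \<noteq> {} \<and> (\<forall>A\<in>U. Q A))"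

end

theory Submission
  imports Defs "Jordan_Normal_Form.Determinant" "HOL-Library.Function_Algebras"
begin

text \<open>
  Let \<open>\<phi> = (\<phi> 0, \<dots>, \<phi> n)\<close> be the parametrization of \<open>C\<close>, dehomogenized to polynomials of degree at most \<open>e\<close>
  in one variable \<open>t\<close>. The proof replaces the conormal sheaf by gradients along \<open>C\<close>. If a section of
  \<open>I(d)\<close> is given locally by a quotient \<open>F / G\<close> of forms, the restrictions to \<open>C\<close> of the quotients
  \<open>\<partial>F/\<partial>x i / G\<close> depend on its class modulo the square of \<open>I\<close> only, because by the product rule the elements of the
  square have gradient zero (\<open>jet_mult\<close>, \<open>jet_unique\<close>). For a global section of the conormal sheaf they
  therefore glue to binary forms \<open>g i\<close> of degree \<open>e (d - 1)\<close> (\<open>glue_binary_forms\<close>), which satisfy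
  \<open>\<Sum> g i * \<phi> i = 0\<close> by Euler's relation and \<open>\<Sum> g i * \<phi> i' = 0\<close> by the chain rule. All derivatives are
  formal, so that the characteristic is arbitrary.

  Conversely the gradient determines the class. When all binary forms of degree \<open>e d\<close> are restrictions
  of forms of degree \<open>d\<close>, the inverse of the parametrization is a quotient of forms and extends
  to a rational retraction of projective space onto \<open>C\<close>. The Taylor expansion of a form at the retracted point
  shows that a form vanishing along \<open>C\<close> together with its gradient lies locally in the square of the
  ideal (\<open>flat_in_square\<close>). The same forms separate points and tangent directions of the projective line, so
  that the parametrization is an embedding (\<open>P1_embedding_if_restr_surj\<close>), and they show that \<open>C\<close> is closed
  (\<open>separating_form\<close>). Surjectivity of the conormal map thus becomes a statement of linear algebra
  (\<open>conormal_map_surj_if_exact\<close>): every vector \<open>g\<close> of binary forms with the two relations is the gradient along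
  \<open>C\<close> of a form of degree \<open>d\<close> that vanishes on \<open>C\<close>.

  For a monomial curve this statement splits into weights. In each weight the vectors \<open>g\<close> correspond to linear relations
  between the points \<open>(1, a i)\<close>, where \<open>a i\<close> are the exponents, and the quadrics \<open>x p * x q - x r * x s\<close> with
  \<open>a p + a q = a r + a s\<close>, multiplied by monomials, realize the relation between these four points. For the
  rational normal curve these relations span when \<open>d \<ge> 3\<close> (\<open>rational_normal.exact\<close>), and the statement is
  invariant under projectivities (\<open>coordinate_change\<close>). The same argument works for the curve with exponents
  \<open>0, 1, 2, 4, \<dots>, n + 1\<close>, a projection of the rational normal curve of degree \<open>n + 1\<close>
  (\<open>projected_rational_normal.exact\<close>): two quadrics bridge the gap at the missing exponent.

  Finally the linear algebra statement says that a complex of maps between fixed finite-dimensional spaces,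
  depending polynomially on the coefficients of the parametrization, is exact. Exactness is an open condition
  (\<open>exactness_is_open\<close>), given by the nonvanishing of a determinant, and so it passes from the projected
  monomial curve to the general curve of degree \<open>n + 1\<close>.
\<close>

section \<open>Evaluation and differentiation of multivariate polynomials\<close>

type_synonym ('v, 'a) mp = "('v \<Rightarrow>\<^sub>0 nat) \<Rightarrow>\<^sub>0 'a"

abbreviation keys :: "('b \<Rightarrow>\<^sub>0 'c::zero) \<Rightarrow> 'b set" where "keys \<equiv> Poly_Mapping.keys"

abbreviation lookup :: "('b \<Rightarrow>\<^sub>0 'c::zero) \<Rightarrow> 'b \<Rightarrow> 'c" where "lookup \<equiv> Poly_Mapping.lookup"

abbreviation single :: "'b \<Rightarrow> 'c \<Rightarrow> 'b \<Rightarrow>\<^sub>0 'c::zero" where "single \<equiv> Poly_Mapping.single"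

definition mono_val :: "('v \<Rightarrow> 'b::comm_monoid_mult) \<Rightarrow> ('v \<Rightarrow>\<^sub>0 nat) \<Rightarrow> 'b" where
  "mono_val X m = (\<Prod>i\<in>keys m. X i ^ lookup m i)"

text \<open>
  Evaluation along a homomorphism \<open>h\<close> on coefficients: \<open>mp_eval\<close> is the case of the identity, restriction to
  a parametrized curve the case of values in univariate polynomials, and substitution of polynomials for
  the variables the case of values in multivariate polynomials.
\<close>

definition geval :: "('a::comm_ring_1 \<Rightarrow> 'b::comm_ring_1) \<Rightarrow> ('v \<Rightarrow> 'b) \<Rightarrow> ('v, 'a) mp \<Rightarrow> 'b" where
  "geval h X F = (\<Sum>m\<in>keys F. h (lookup F m) * mono_val X m)"

abbreviation Const :: "'a::comm_ring_1 \<Rightarrow> ('v, 'a) mp" where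
  "Const c \<equiv> single 0 c"

abbreviation Var :: "'v \<Rightarrow> ('v, 'a::comm_ring_1) mp" where
  "Var i \<equiv> single (single i (Suc 0)) 1"

lemma mp_eval_geval: "mp_eval F x = geval (\<lambda>c. c) x F"
  by (simp add: mp_eval_def geval_def mono_val_def)

lemma mono_val_superset:
  assumes "finite A" "keys m \<subseteq> A"
  shows "mono_val X m = (\<Prod>i\<in>A. X i ^ lookup m i)"
  unfolding mono_val_def using assms
  by (intro prod.mono_neutral_left) (auto simp: in_keys_iff)

lemma mono_val_add: "mono_val X (m + m') = mono_val X m * mono_val X m'"
proof -
  let ?A = "keys m \<union> keys m'"
  have "mono_val X (m + m') = (\<Prod>i\<in>?A. X i ^ lookup (m + m') i)"
    using Poly_Mapping.keys_add[of m m'] by (intro mono_val_superset) auto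
  also have "\<dots> = (\<Prod>i\<in>?A. X i ^ lookup m i) * (\<Prod>i\<in>?A. X i ^ lookup m' i)"
    by (simp add: lookup_add power_add prod.distrib)
  also have "\<dots> = mono_val X m * mono_val X m'"
    by (simp add: mono_val_superset[of ?A m] mono_val_superset[of ?A m'])
  finally show ?thesis .
qed

lemma mono_val_0 [simp]: "mono_val X 0 = 1"
  by (simp add: mono_val_def)

lemma mono_val_single: "mono_val X (single i k) = X i ^ k"
  by (cases "k = 0") (simp_all add: mono_val_def)

lemma mp_sum_monomials: "(\<Sum>m\<in>keys F. single m (lookup F m)) = F"
proof (rule poly_mapping_eqI)
  fix k
  show "lookup (\<Sum>m\<in>keys F. single m (lookup F m)) k
      = lookup F k"
    by (cases "k \<in> keys F")
       (auto simp: lookup_sum lookup_single when_def in_keys_iff sum.delta)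
qed

lemma comm_ring_hom_id: "comm_ring_hom (\<lambda>c::'a::comm_ring_1. c)"
  by unfold_locales auto

lemma comm_ring_hom_pCons: "comm_ring_hom (\<lambda>c::'a::comm_ring_1. [:c:])"
  by unfold_locales (auto simp: pCons_one)

lemma comm_ring_hom_Const: "comm_ring_hom (Const :: 'a::comm_ring_1 \<Rightarrow> ('v, 'a) mp)"
  by unfold_locales (auto simp: single_add mult_single)

context
  fixes h :: "'a::comm_ring_1 \<Rightarrow> 'b::comm_ring_1"
  assumes h: "comm_ring_hom h"
begin

interpretation comm_ring_hom h by (rule h)

lemma geval_superset:
  assumes "finite A" "keys F \<subseteq> A"
  shows "geval h X F = (\<Sum>m\<in>A. h (lookup F m) * mono_val X m)"
  unfolding geval_def using assms
  by (intro sum.mono_neutral_left) (auto simp: in_keys_iff)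

lemma geval_single: "geval h X (single m a) = h a * mono_val X m"
  by (cases "a = 0") (simp_all add: geval_def)

lemma geval_0: "geval h X 0 = 0"
  by (simp add: geval_def)

lemma geval_Const: "geval h X (Const c) = h c"
  by (simp add: geval_single)

lemma geval_1: "geval h X 1 = 1"
  using geval_Const[of X 1] by (simp add: hom_one)

lemma geval_Var: "geval h X (Var i) = X i"
  by (simp add: geval_single mono_val_single)

lemma geval_add: "geval h X (F + G) = geval h X F + geval h X G"
proof -
  let ?A = "keys F \<union> keys G"
  have "geval h X (F + G) = (\<Sum>m\<in>?A. h (lookup (F + G) m) * mono_val X m)"
    using Poly_Mapping.keys_add[of F G] by (intro geval_superset) auto
  also have "\<dots> = (\<Sum>m\<in>?A. h (lookup F m) * mono_val X m)
      + (\<Sum>m\<in>?A. h (lookup G m) * mono_val X m)"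
    by (simp add: lookup_add hom_add algebra_simps sum.distrib)
  also have "\<dots> = geval h X F + geval h X G"
    by (simp add: geval_superset[of ?A F] geval_superset[of ?A G])
  finally show ?thesis .
qed

lemma geval_sum: "geval h X (\<Sum>i\<in>A. F i) = (\<Sum>i\<in>A. geval h X (F i))"
  by (induction A rule: infinite_finite_induct) (simp_all add: geval_0 geval_add)

lemma geval_mult: "geval h X (F * G) = geval h X F * geval h X G"
proof -
  have "F * G = (\<Sum>m\<in>keys F. single m (lookup F m))
     * (\<Sum>m\<in>keys G. single m (lookup G m))"
    by (simp add: mp_sum_monomials)
  also have "geval h X \<dots> = geval h X F * geval h X G"
    unfolding sum_product geval_sum mult_single geval_single mono_val_add hom_mult
    by (simp add: geval_def sum_product algebra_simps)
  finally show ?thesis .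
qed

lemma geval_uminus: "geval h X (- F) = - geval h X F"
proof -
  have "geval h X F + geval h X (- F) = 0"
    using geval_add[of X F "- F"] by (simp add: geval_0)
  thus ?thesis by (simp add: eq_neg_iff_add_eq_0 add.commute)
qed

lemma geval_diff: "geval h X (F - G) = geval h X F - geval h X G"
  using geval_add[of X F "- G"] by (simp add: geval_uminus)

lemma geval_power: "geval h X (F ^ k) = geval h X F ^ k"
  by (induction k) (simp_all add: geval_1 geval_mult)

lemma geval_prod: "geval h X (\<Prod>i\<in>A. F i) = (\<Prod>i\<in>A. geval h X (F i))"
  by (induction A rule: infinite_finite_induct) (simp_all add: geval_1 geval_mult)

lemmas geval_simps = geval_0 geval_1 geval_Const geval_Var geval_add geval_mult geval_uminus
  geval_diff geval_power geval_sum geval_prod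

end

lemmas mp_eval_simps = geval_simps[OF comm_ring_hom_id, folded mp_eval_geval]

lemma mp_in_add: "mp_in I F \<Longrightarrow> mp_in I G \<Longrightarrow> mp_in I (F + G)"
  using Poly_Mapping.keys_add[of F G] unfolding mp_in_def by blast

text \<open>
  Since polynomials are generated as a ring by constants and variables, identities between evaluations and
  derivatives only have to be checked for compatibility with the ring operations.
\<close>

lemma mp_induct [consumes 1, case_names Const Var add mult]:
  fixes F :: "('v, 'a::comm_ring_1) mp"
  assumes "mp_in I F"
  assumes C: "\<And>c. P (Const c)" and V: "\<And>i. i \<in> I \<Longrightarrow> P (Var i)"
    and A: "\<And>F G. mp_in I F \<Longrightarrow> mp_in I G \<Longrightarrow> P F \<Longrightarrow> P G \<Longrightarrow> P (F + G)"
    and M: "\<And>F G. mp_in I F \<Longrightarrow> mp_in I G \<Longrightarrow> P F \<Longrightarrow> P G \<Longrightarrow> P (F * G)"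
  shows "P F"
proof -
  have inC: "mp_in I (Const c :: ('v, 'a) mp)" for c by (simp add: mp_in_def)
  have inS: "mp_in I (single m c :: ('v, 'a) mp)" if "keys m \<subseteq> I" for m c
    using that by (simp add: mp_in_def)
  have P1: "P (single (single i k) 1)" if "i \<in> I" for i k
  proof (induction k)
    case 0
    show ?case using C[of 1] by simp
  next
    case (Suc k)
    have "single (single i (Suc k)) (1::'a) =
        Var i * single (single i k) 1"
      by (simp add: mult_single single_add[symmetric])
    moreover have "P (Var i * single (single i k) 1)"
      using that by (intro M V Suc inS) (auto split: if_splits)
    ultimately show ?case by (simp only:)
  qed
  have P2: "keys m \<subseteq> I \<Longrightarrow> P (single m 1)" for m
  proof (induction m rule: update_induct)
    case const
    show ?case using C[of 1] by simp
  next
    case (update m i k)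
    have e: "Poly_Mapping.update i k m = single i k + m"
      using update(1) by (intro poly_mapping_eqI) (auto simp: lookup_update lookup_add lookup_single in_keys_iff when_def)
    have I: "i \<in> I" "keys m \<subseteq> I" using update by (auto simp: keys_update split: if_splits)
    have "single (Poly_Mapping.update i k m) (1::'a) =
       single (single i k) 1 * single m 1"
      by (simp add: e mult_single)
    thus ?case using M[OF _ _ P1[OF I(1), of k] update(3)[OF I(2)]] I
      by (simp add: inS)
  qed
  have P3: "P (single m c)" if "keys m \<subseteq> I" for m c
  proof -
    have "single m c = Const c * single m 1" by (simp add: mult_single)
    thus ?thesis using M[OF inC inS[OF that] C P2[OF that]] by simp
  qed
  have "S \<subseteq> keys F \<Longrightarrow> P (\<Sum>m\<in>S. single m (lookup F m)) \<and>
      mp_in I (\<Sum>m\<in>S. single m (lookup F m))"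
    if "finite S" for S using that
  proof (induction S)
    case empty
    show ?case using C[of 0] inC[of 0] by simp
  next
    case (insert m S)
    have k: "keys m \<subseteq> I" using insert(4) assms(1) by (auto simp: mp_in_def)
    have IH: "P (\<Sum>m\<in>S. single m (lookup F m))"
      "mp_in I (\<Sum>m\<in>S. single m (lookup F m))"
      using insert by auto
    have "mp_in I (single m (lookup F m)
        + (\<Sum>m\<in>S. single m (lookup F m)))"
      by (intro mp_in_add inS[OF k] IH(2))
    thus ?case using insert(1,2) A[OF inS[OF k] IH(2) P3[OF k] IH(1)] by simp
  qed
  from this[of "keys F"] show ?thesis by (simp add: mp_sum_monomials)
qed

lemma mp_in_UNIV: "mp_in UNIV F"
  by (simp add: mp_in_def)

lemma mp_in_Const: "mp_in I (Const c)"
  by (simp add: mp_in_def)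

lemma mp_in_Var: "i \<in> I \<Longrightarrow> mp_in I (Var i)"
  by (simp add: mp_in_def)

lemma mp_in_mult: "mp_in I F \<Longrightarrow> mp_in I G \<Longrightarrow> mp_in I (F * G)"
  unfolding mp_in_def
proof
  fix m assume a: "\<forall>m\<in>keys F. keys m \<subseteq> I"
    "\<forall>m\<in>keys G. keys m \<subseteq> I" "m \<in> keys (F * G)"
  then obtain p q where "m = p + q" "p \<in> keys F" "q \<in> keys G"
    using Poly_Mapping.keys_mult[of F G] by auto
  thus "keys m \<subseteq> I" using a Poly_Mapping.keys_add[of p q] by blast
qed

lemma geval_cong:
  assumes "mp_in I F" "\<And>i. i \<in> I \<Longrightarrow> X i = Y i"
  shows "geval h X F = geval h Y F"
  unfolding geval_def mono_val_def using assms
  by (intro sum.cong refl arg_cong2[where f = "(*)"] prod.cong) (auto simp: mp_in_def subset_eq)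

text \<open>
  The formal partial derivative. If the variable does not occur in \<open>m\<close>, the truncated exponent is harmless since
  its coefficient is zero.
\<close>

definition pd :: "'v \<Rightarrow> ('v, 'a::comm_ring_1) mp \<Rightarrow> ('v, 'a) mp" where
  "pd i F = (\<Sum>m\<in>keys F.
     single (m - single i (Suc 0)) (of_nat (lookup m i) * lookup F m))"

lemma pd_superset:
  assumes "finite A" "keys F \<subseteq> A"
  shows "pd i F = (\<Sum>m\<in>A.
     single (m - single i (Suc 0)) (of_nat (lookup m i) * lookup F m))"
  unfolding pd_def using assms by (intro sum.mono_neutral_left) (auto simp: in_keys_iff)

lemma pd_single: "pd i (single m a) =
    single (m - single i (Suc 0)) (of_nat (lookup m i) * a)"
  by (cases "a = 0") (simp_all add: pd_def)

lemma pd_0 [simp]: "pd i 0 = 0"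
  by (simp add: pd_def)

lemma pd_Const [simp]: "pd i (Const c) = 0"
  by (simp add: pd_single)

lemma pd_Var: "pd i (Var j) = (if i = j then 1 else 0)"
  by (auto simp: pd_single lookup_single when_def)

lemma pd_add: "pd i (F + G) = pd i F + pd i G"
proof -
  let ?A = "keys F \<union> keys G"
  have "pd i (F + G) = (\<Sum>m\<in>?A. single (m - single i (Suc 0))
      (of_nat (lookup m i) * lookup (F + G) m))"
    using Poly_Mapping.keys_add[of F G] by (intro pd_superset) auto
  also have "\<dots> = pd i F + pd i G"
    by (simp add: pd_superset[of ?A F] pd_superset[of ?A G] lookup_add algebra_simps sum.distrib single_add)
  finally show ?thesis .
qed

lemma pd_sum: "pd i (\<Sum>j\<in>A. F j) = (\<Sum>j\<in>A. pd i (F j))"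
  by (induction A rule: infinite_finite_induct) (simp_all add: pd_add)

lemma pd_mult_single:
  fixes a b :: "'a::comm_ring_1" and m m' :: "'v \<Rightarrow>\<^sub>0 nat"
  shows "pd i (single m a * single m' b) =
    pd i (single m a) * single m' b +
    single m a * pd i (single m' b)"
proof -
  let ?e = "single i (Suc 0)"
  have 1: "single (m - ?e + m') (of_nat (lookup m i) * a * b) =
     single (m + m' - ?e) (of_nat (lookup m i) * a * b)"
    for m m' :: "'v \<Rightarrow>\<^sub>0 nat" and a b :: 'a
  proof (cases "lookup m i = 0")
    case False
    have "m - single i (Suc 0) + m' = m + m' - single i (Suc 0)"
      using False by (intro poly_mapping_eqI) (auto simp: lookup_add lookup_minus lookup_single when_def)
    thus ?thesis by simp
  qed simp
  have 2: "single (m + (m' - ?e)) (a * (of_nat (lookup m' i) * b)) =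
     single (m + m' - ?e) (of_nat (lookup m' i) * a * b)"
  proof (cases "lookup m' i = 0")
    case False
    have "m + (m' - ?e) = m + m' - ?e"
      using False by (intro poly_mapping_eqI) (auto simp: lookup_add lookup_minus lookup_single when_def)
    thus ?thesis by (simp add: ac_simps)
  qed simp
  show ?thesis
    unfolding mult_single pd_single 2 lookup_add 1
    by (simp add: single_add[symmetric] algebra_simps)
qed

lemma pd_mult: "pd i (F * G) = pd i F * G + F * pd i G"
proof -
  let ?s = "\<lambda>F m. single m (lookup F m)"
  have "pd i ((\<Sum>m\<in>keys F. ?s F m) * (\<Sum>m\<in>keys G. ?s G m)) =
    pd i (\<Sum>m\<in>keys F. ?s F m) * (\<Sum>m\<in>keys G. ?s G m) +
    (\<Sum>m\<in>keys F. ?s F m) * pd i (\<Sum>m\<in>keys G. ?s G m)"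
    unfolding sum_product pd_sum pd_mult_single by (simp add: sum.distrib)
  thus ?thesis by (simp add: mp_sum_monomials)
qed

lemma pd_uminus: "pd i (- F) = - pd i F"
proof -
  have "pd i F + pd i (- F) = 0" using pd_add[of i F "- F"] by simp
  thus ?thesis by (simp add: eq_neg_iff_add_eq_0 add.commute)
qed

lemma pd_diff: "pd i (F - G) = pd i F - pd i G"
  using pd_add[of i F "- G"] by (simp add: pd_uminus)

lemma pd_Const_mult: "pd i (Const c * F) = Const c * pd i F"
  by (simp add: pd_mult)

lemma keys_pd: "m \<in> keys (pd i F) \<Longrightarrow>
    \<exists>m'\<in>keys F. m = m' - single i (Suc 0) \<and> lookup m' i > 0"
proof (rule ccontr)
  assume m: "m \<in> keys (pd i F)"
    and n: "\<not> (\<exists>m'\<in>keys F. m = m' - single i (Suc 0) \<and> lookup m' i > 0)"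
  have "lookup (pd i F) m = 0"
    unfolding pd_def lookup_sum
  proof (rule sum.neutral, rule ballI)
    fix m' assume "m' \<in> keys F"
    hence "m \<noteq> m' - single i (Suc 0) \<or> lookup m' i = 0" using n by blast
    thus "lookup (single (m' - single i (Suc 0))
        (of_nat (lookup m' i) * lookup F m')) m = 0"
      by (metis lookup_single_not_eq mult_zero_left of_nat_0 single_zero lookup_zero)
  qed
  thus False using m by (simp add: in_keys_iff)
qed

lemma keys_minus_subset: "keys (m - m') \<subseteq> keys (m :: 'v \<Rightarrow>\<^sub>0 nat)"
  by (auto simp: in_keys_iff lookup_minus)

lemma mp_in_pd: "mp_in I F \<Longrightarrow> mp_in I (pd i F)"
  unfolding mp_in_def
proof
  fix m assume F: "\<forall>m\<in>keys F. keys m \<subseteq> I" "m \<in> keys (pd i F)"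
  then obtain m' where "m' \<in> keys F" "m = m' - single i (Suc 0)"
    using keys_pd[OF F(2)] by blast
  thus "keys m \<subseteq> I" using F(1) keys_minus_subset[of m'] by blast
qed

text \<open>
  Along a curve on which \<open>F\<close> vanishes the left-hand side is zero, which is the second of the linear relations
  satisfied by gradients.
\<close>

lemma pderiv_geval:
  assumes "mp_in I F" "finite I"
  shows "pderiv (geval (\<lambda>c. [:c:]) \<phi> F) = (\<Sum>i\<in>I. geval (\<lambda>c. [:c:]) \<phi> (pd i F) * pderiv (\<phi> i))"
  using assms(1)
proof (induction F rule: mp_induct)
  case (Const c)
  show ?case by (simp add: geval_simps[OF comm_ring_hom_pCons] pderiv_pCons)
next
  case (Var j)
  have "(\<Sum>i\<in>I. geval (\<lambda>c. [:c:]) \<phi> (pd i (Var j)) * pderiv (\<phi> i)) =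
      (\<Sum>i\<in>I. if i = j then pderiv (\<phi> i) else 0)"
    by (intro sum.cong) (auto simp: pd_Var geval_simps[OF comm_ring_hom_pCons])
  thus ?case using Var assms(2) by (simp add: geval_simps[OF comm_ring_hom_pCons])
next
  case (add F G)
  thus ?case by (simp add: geval_simps[OF comm_ring_hom_pCons] pd_add pderiv_add algebra_simps sum.distrib)
next
  case (mult F G)
  thus ?case
    by (simp add: geval_simps[OF comm_ring_hom_pCons] pd_mult pderiv_mult algebra_simps sum.distrib sum_distrib_left)
qed

section \<open>Forms\<close>

definition mdeg :: "('v \<Rightarrow>\<^sub>0 nat) \<Rightarrow> nat" where
  "mdeg m = (\<Sum>i\<in>keys m. lookup m i)"

lemma form_alt: "form n k F \<longleftrightarrow> mp_in {..n} F \<and> (\<forall>m\<in>keys F. mdeg m = k)"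
  by (simp add: form_def mdeg_def)

lemma mdeg_superset: "finite A \<Longrightarrow> keys m \<subseteq> A \<Longrightarrow> mdeg m = (\<Sum>i\<in>A. lookup m i)"
  unfolding mdeg_def by (intro sum.mono_neutral_left) (auto simp: in_keys_iff)

lemma mdeg_add: "mdeg (m + m') = mdeg m + mdeg m'"
proof -
  let ?A = "keys m \<union> keys m'"
  have "mdeg (m + m') = (\<Sum>i\<in>?A. lookup (m + m') i)"
    using Poly_Mapping.keys_add[of m m'] by (intro mdeg_superset) auto
  also have "\<dots> = mdeg m + mdeg m'"
    by (simp add: mdeg_superset[of ?A m] mdeg_superset[of ?A m'] lookup_add sum.distrib)
  finally show ?thesis .
qed

lemma mdeg_single [simp]: "mdeg (single i k) = k"
  by (cases "k = 0") (simp_all add: mdeg_def)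

lemma mdeg_0 [simp]: "mdeg 0 = 0"
  by (simp add: mdeg_def)

lemma form_0: "form n k 0"
  by (simp add: form_def mp_in_def)

lemma form_Const: "form n 0 (Const c)"
  by (simp add: form_def mp_in_def)

lemma form_1: "form n 0 1"
  using form_Const[of n 1] by simp

lemma form_Var: "i \<le> n \<Longrightarrow> form n 1 (Var i)"
  by (simp add: form_alt mp_in_def)

lemma form_add: "form n k F \<Longrightarrow> form n k G \<Longrightarrow> form n k (F + G)"
  unfolding form_alt
proof (intro conjI ballI)
  assume a: "mp_in {..n} F \<and> (\<forall>m\<in>keys F. mdeg m = k)"
    "mp_in {..n} G \<and> (\<forall>m\<in>keys G. mdeg m = k)"
  show "mp_in {..n} (F + G)" using a by (simp add: mp_in_add)
  fix m assume "m \<in> keys (F + G)"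
  hence "m \<in> keys F \<or> m \<in> keys G" using Poly_Mapping.keys_add[of F G] by blast
  thus "mdeg m = k" using a by auto
qed

lemma form_mult: "form n k F \<Longrightarrow> form n l G \<Longrightarrow> form n (k + l) (F * G)"
  unfolding form_alt
proof (intro conjI ballI)
  assume a: "mp_in {..n} F \<and> (\<forall>m\<in>keys F. mdeg m = k)"
    "mp_in {..n} G \<and> (\<forall>m\<in>keys G. mdeg m = l)"
  show "mp_in {..n} (F * G)" using a by (simp add: mp_in_mult)
  fix m assume "m \<in> keys (F * G)"
  then obtain p q where "m = p + q" "p \<in> keys F" "q \<in> keys G"
    using Poly_Mapping.keys_mult[of F G] by blast
  thus "mdeg m = k + l" using a by (simp add: mdeg_add)
qed

lemma form_smult: "form n k F \<Longrightarrow> form n k (Const c * F)"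
  using form_mult[OF form_Const[of n c], of k F] by simp

lemma form_uminus: "form n k F \<Longrightarrow> form n k (- F)"
  unfolding form_def mp_in_def by (simp add: in_keys_iff)

lemma form_diff: "form n k F \<Longrightarrow> form n k G \<Longrightarrow> form n k (F - G)"
  using form_add[OF _ form_uminus, of n k F G] by simp

lemma form_sum: "(\<And>i. i \<in> A \<Longrightarrow> form n k (F i)) \<Longrightarrow> form n k (\<Sum>i\<in>A. F i)"
  by (induction A rule: infinite_finite_induct) (simp_all add: form_0 form_add)

lemma form_power: "form n k F \<Longrightarrow> form n (k * l) (F ^ l)"
  by (induction l) (simp_all add: form_1 form_mult)

lemma form_prod: "(\<And>i. i \<in> A \<Longrightarrow> form n (k i) (F i)) \<Longrightarrow> form n (\<Sum>i\<in>A. k i) (\<Prod>i\<in>A. F i)"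
  by (induction A rule: infinite_finite_induct) (simp_all add: form_1 form_mult)

lemma form_mp_in: "form n k F \<Longrightarrow> mp_in {..n} F"
  by (simp add: form_def)

text \<open>
  For \<open>k = 0\<close> the derivative is zero, which is a form of every degree.
\<close>

lemma form_pd: "form n k F \<Longrightarrow> form n (k - 1) (pd i F)"
  unfolding form_alt
proof (intro conjI ballI)
  assume F: "mp_in {..n} F \<and> (\<forall>m\<in>keys F. mdeg m = k)"
  show "mp_in {..n} (pd i F)" using F by (simp add: mp_in_pd)
  fix m assume "m \<in> keys (pd i F)"
  then obtain m' where m': "m' \<in> keys F" "m = m' - single i (Suc 0)"
    "lookup m' i > 0" using keys_pd[of m i F] by blast
  have "m' = m + single i (Suc 0)"
    unfolding m'(2) using m'(3) by (intro poly_mapping_eqI) (auto simp: lookup_add lookup_minus lookup_single when_def)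
  hence "mdeg m' = mdeg m + 1" by (simp add: mdeg_add)
  thus "mdeg m = k - 1" using F m'(1) by auto
qed

text \<open>
  Euler's relation holds monomial by monomial, hence in every characteristic.
\<close>

lemma geval_euler:
  assumes h: "comm_ring_hom h" and F: "form n k F"
  shows "(\<Sum>i\<le>n. X i * geval h X (pd i F)) = of_nat k * geval h X F"
proof -
  interpret comm_ring_hom h by (rule h)
  have hn: "h (of_nat j) = of_nat j" for j
    by (induction j) (simp_all add: hom_zero hom_one hom_add)
  have 1: "X i * geval h X (pd i (single m a)) =
      of_nat (lookup m i) * (h a * mono_val X m)" for i m a
  proof (cases "lookup m i = 0")
    case False
    have "m = (m - single i (Suc 0)) + single i (Suc 0)"
      using False by (intro poly_mapping_eqI) (auto simp: lookup_add lookup_minus lookup_single when_def)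
    hence "mono_val X m = mono_val X (m - single i (Suc 0)) * X i"
      using mono_val_add[of X "m - single i (Suc 0)" "single i (Suc 0)"]
      by (simp add: mono_val_single)
    thus ?thesis by (simp add: pd_single geval_single[OF h] hom_mult hn ac_simps)
  qed (simp add: pd_single geval_0[OF h])
  have "(\<Sum>i\<le>n. X i * geval h X (pd i F)) =
    (\<Sum>i\<le>n. \<Sum>m\<in>keys F. X i *
        geval h X (pd i (single m (lookup F m))))"
    by (subst mp_sum_monomials[of F, symmetric]) (simp add: pd_sum geval_sum[OF h] sum_distrib_left)
  also have "\<dots> = (\<Sum>m\<in>keys F. \<Sum>i\<le>n. of_nat (lookup m i) *
      (h (lookup F m) * mono_val X m))"
    by (subst sum.swap) (simp only: 1)
  also have "\<dots> = (\<Sum>m\<in>keys F. of_nat k * (h (lookup F m) * mono_val X m))"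
  proof (intro sum.cong refl)
    fix m assume "m \<in> keys F"
    hence "keys m \<subseteq> {..n}" "mdeg m = k" using F by (auto simp: form_alt mp_in_def)
    hence "(\<Sum>i\<le>n. lookup m i) = k" using mdeg_superset[of "{..n}" m] by simp
    thus "(\<Sum>i\<le>n. of_nat (lookup m i) * (h (lookup F m) * mono_val X m)) =
        of_nat k * (h (lookup F m) * mono_val X m)"
      by (simp add: sum_distrib_right[symmetric] of_nat_sum[symmetric])
  qed
  also have "\<dots> = of_nat k * geval h X F" by (simp add: geval_def sum_distrib_left)
  finally show ?thesis .
qed

lemma form_scale:
  assumes "form n k F" shows "mp_eval F (\<lambda>i. c * x i) = c ^ k * mp_eval F x"
proof -
  have "mono_val (\<lambda>i. c * x i) m = c ^ mdeg m * mono_val x m" for m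
    by (simp add: mono_val_def mdeg_def power_mult_distrib prod.distrib power_sum)
  thus ?thesis using assms
    by (auto simp: mp_eval_geval geval_def form_alt sum_distrib_left ac_simps intro!: sum.cong)
qed

lemma geval_geval:
  assumes "comm_ring_hom h"
  shows "geval h X (geval Const Y F) = geval h (\<lambda>i. geval h X (Y i)) F"
  using mp_in_UNIV[of F]
  by (induction F rule: mp_induct)
     (simp_all add: geval_simps[OF comm_ring_hom_Const] geval_simps[OF assms])

lemma poly_geval: "poly (geval (\<lambda>c. [:c:]) \<phi> F) t = mp_eval F (\<lambda>i. poly (\<phi> i) t)"
  using mp_in_UNIV[of F]
  by (induction F rule: mp_induct)
     (simp_all add: geval_simps[OF comm_ring_hom_pCons] mp_eval_simps)

lemma pd_subst:
  assumes "mp_in I F" "finite I"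
  shows "pd j (geval Const Y F) = (\<Sum>i\<in>I. geval Const Y (pd i F) * pd j (Y i))"
  using assms(1)
proof (induction F rule: mp_induct)
  case (Const c)
  show ?case by (simp add: geval_simps[OF comm_ring_hom_Const])
next
  case (Var l)
  have "(\<Sum>i\<in>I. geval Const Y (pd i (Var l)) * pd j (Y i)) =
      (\<Sum>i\<in>I. if i = l then pd j (Y i) else 0)"
    by (intro sum.cong) (auto simp: pd_Var geval_simps[OF comm_ring_hom_Const])
  thus ?case using Var assms(2) by (simp add: geval_simps[OF comm_ring_hom_Const])
next
  case (add F G)
  thus ?case by (simp add: geval_simps[OF comm_ring_hom_Const] pd_add algebra_simps sum.distrib)
next
  case (mult F G)
  thus ?case
    by (simp add: geval_simps[OF comm_ring_hom_Const] pd_mult algebra_simps sum.distrib sum_distrib_left)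
qed

lemma form_subst:
  assumes F: "form n k F" and Y: "\<And>i. i \<le> n \<Longrightarrow> form N l (Y i)"
  shows "form N (k * l) (geval Const Y F)"
proof -
  have *: "form N (k * l) (Const (lookup F m) * mono_val Y m)" if "m \<in> keys F" for m
  proof (rule form_smult)
    have m: "keys m \<subseteq> {..n}" "mdeg m = k" using F that by (auto simp: form_alt mp_in_def)
    have "form N (\<Sum>i\<in>keys m. l * lookup m i) (mono_val Y m)"
      unfolding mono_val_def
    proof (rule form_prod)
      fix i assume "i \<in> keys m"
      hence "i \<le> n" using m(1) by auto
      thus "form N (l * lookup m i) (Y i ^ lookup m i)"
        by (rule form_power[OF Y])
    qed
    moreover have "(\<Sum>i\<in>keys m. l * lookup m i) = k * l"
      using m(2) by (simp add: mdeg_def sum_distrib_left[symmetric])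
    ultimately show "form N (k * l) (mono_val Y m)" by simp
  qed
  show ?thesis unfolding geval_def by (rule form_sum) (rule *)
qed

section \<open>Binary forms\<close>

text \<open>
  A binary form of degree \<open>D\<close> is given by its dehomogenization \<open>q\<close>, a polynomial of degree at most
  \<open>D\<close>; this is its value at \<open>(s, t)\<close>.
\<close>

definition heval :: "nat \<Rightarrow> 'a::comm_ring_1 poly \<Rightarrow> 'a \<Rightarrow> 'a \<Rightarrow> 'a" where
  "heval D q s t = (\<Sum>i\<le>D. coeff q i * s ^ (D - i) * t ^ i)"

lemma poly_eq_sum: "degree (q :: 'a::comm_ring_1 poly) \<le> D \<Longrightarrow> poly q t = (\<Sum>i\<le>D. coeff q i * t ^ i)"
  unfolding poly_altdef by (rule sum.mono_neutral_left) (auto simp: coeff_eq_0)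

lemma heval_1_left: "degree q \<le> D \<Longrightarrow> heval D q 1 t = poly q t"
  by (simp add: heval_def poly_eq_sum)

lemma heval_nonzero:
  fixes s :: "'a::field"
  assumes "degree q \<le> D" "s \<noteq> 0"
  shows "heval D q s t = s ^ D * poly q (t / s)"
proof -
  have "s ^ D * (coeff q i * (t / s) ^ i) = coeff q i * s ^ (D - i) * t ^ i" if "i \<le> D" for i
  proof -
    have "s ^ D = s ^ (D - i) * s ^ i" using that by (simp add: power_add[symmetric])
    thus ?thesis using assms(2) by (simp add: power_divide)
  qed
  hence "s ^ D * (\<Sum>i\<le>D. coeff q i * (t / s) ^ i) = (\<Sum>i\<le>D. coeff q i * s ^ (D - i) * t ^ i)"
    unfolding sum_distrib_left by (intro sum.cong refl) simp
  thus ?thesis using assms(1) by (simp add: heval_def poly_eq_sum[of q D])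
qed

lemma heval_0_left: "heval D q 0 t = coeff q D * t ^ D"
proof -
  have "heval D q 0 t = (\<Sum>i\<le>D. if i = D then coeff q D * t ^ D else 0)"
    unfolding heval_def by (intro sum.cong) (auto simp: power_0_left)
  thus ?thesis by simp
qed

lemma heval_0 [simp]: "heval D 0 s t = 0"
  by (simp add: heval_def)

lemma heval_add: "heval D (p + q) s t = heval D p s t + heval D q s t"
  by (simp add: heval_def algebra_simps sum.distrib)

lemma heval_smult: "heval D (Polynomial.smult c q) s t = c * heval D q s t"
  by (simp add: heval_def algebra_simps sum_distrib_left)

lemma heval_sum: "heval D (\<Sum>i\<in>A. q i) s t = (\<Sum>i\<in>A. heval D (q i) s t)"
  by (induction A rule: infinite_finite_induct) (simp_all add: heval_add)

lemma heval_monom: "j \<le> D \<Longrightarrow> heval D (monom c j) s t = c * s ^ (D - j) * t ^ j"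
  unfolding heval_def by (subst sum.mono_neutral_right[of _ "{j}"]) auto

lemma heval_scale: "heval D q (c * s) (c * t) = c ^ D * heval D q s t"
proof -
  have "(c * s) ^ (D - i) * (c * t) ^ i = c ^ D * (s ^ (D - i) * t ^ i)" if "i \<le> D" for i
    using that by (simp add: power_mult_distrib power_add[symmetric] mult.assoc[symmetric] mult.left_commute)
       (metis (no_types, lifting) le_add_diff_inverse mult.assoc mult.commute power_add)
  thus ?thesis unfolding heval_def sum_distrib_left
    by (intro sum.cong refl) (simp add: mult.assoc mult.left_commute)
qed

lemma heval_mult:
  fixes s :: "'a::field"
  assumes "degree p \<le> D" "degree q \<le> E"
  shows "heval (D + E) (p * q) s t = heval D p s t * heval E q s t"
proof (cases "s = 0")
  case False
  have "degree (p * q) \<le> D + E" using degree_mult_le[of p q] assms by linarith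
  thus ?thesis using False assms by (simp add: heval_nonzero power_add)
next
  case True
  have "coeff (p * q) (D + E) = coeff p D * coeff q E"
  proof (cases "degree p = D \<and> degree q = E")
    case True
    thus ?thesis using coeff_mult_degree_sum[of p q] by simp
  next
    case False
    hence "degree p < D \<or> degree q < E" using assms by linarith
    moreover have "degree (p * q) \<le> degree p + degree q" by (rule degree_mult_le)
    ultimately have "degree (p * q) < D + E" using assms by linarith
    thus ?thesis using \<open>degree p < D \<or> degree q < E\<close> by (auto simp: coeff_eq_0)
  qed
  thus ?thesis using True by (simp add: heval_0_left power_add)
qed

lemma heval_power:
  fixes s :: "'a::field"
  assumes "degree q \<le> D"
  shows "degree (q ^ k) \<le> D * k \<and> heval (D * k) (q ^ k) s t = heval D q s t ^ k"
proof (induction k)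
  case 0
  show ?case using heval_monom[of 0 0 1 s t] by (simp add: one_poly_eq_simps)
next
  case (Suc k)
  have "degree (q * q ^ k) \<le> D + D * k" using degree_mult_le[of q "q ^ k"] Suc assms by linarith
  thus ?case using heval_mult[OF assms, of "q ^ k" "D * k" s t] Suc by simp
qed

lemma heval_prod:
  fixes s :: "'a::field"
  assumes "\<And>i. i \<in> A \<Longrightarrow> degree (q i) \<le> D i"
  shows "degree (\<Prod>i\<in>A. q i) \<le> (\<Sum>i\<in>A. D i) \<and>
     heval (\<Sum>i\<in>A. D i) (\<Prod>i\<in>A. q i) s t = (\<Prod>i\<in>A. heval (D i) (q i) s t)"
  using assms
proof (induction A rule: infinite_finite_induct)
  case (infinite A)
  thus ?case using heval_monom[of 0 0 1 s t] by (simp add: one_poly_eq_simps)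
next
  case empty
  show ?case using heval_monom[of 0 0 1 s t] by (simp add: one_poly_eq_simps)
next
  case (insert x F)
  have IH: "degree (prod q F) \<le> sum D F" "heval (sum D F) (prod q F) s t = (\<Prod>i\<in>F. heval (D i) (q i) s t)"
    and x: "degree (q x) \<le> D x" using insert by auto
  have "degree (q x * prod q F) \<le> D x + sum D F"
    using degree_mult_le[of "q x" "prod q F"] IH(1) x by linarith
  thus ?case using insert(1,2) heval_mult[OF x IH(1), of s t] IH(2) by simp
qed

text \<open>
  Otherwise one plus the product of all linear factors would be a polynomial without roots.
\<close>

lemma infinite_UNIV_alg_closed: "infinite (UNIV :: 'a::alg_closed_field set)"
proof
  assume fin: "finite (UNIV :: 'a set)"
  define p :: "'a poly" where "p = 1 + (\<Prod>a\<in>UNIV. [:-a, 1:])"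
  have "degree (\<Prod>a\<in>(UNIV::'a set). [:-a, 1:]) = card (UNIV :: 'a set)"
    using fin by (subst degree_prod_eq_sum_degree) auto
  moreover have "card (UNIV :: 'a set) > 0" using fin by (simp add: card_gt_0_iff)
  ultimately have "degree p > 0" unfolding p_def by (subst degree_add_eq_right) auto
  then obtain x where "poly p x = 0" using alg_closed_imp_poly_has_root by blast
  moreover have "poly (\<Prod>a\<in>(UNIV::'a set). [:-a, 1:]) x = 0"
    using fin by (auto simp: poly_prod prod_zero_iff)
  ultimately show False by (simp add: p_def)
qed

lemma poly_all_0_imp_0: "(\<And>t. poly p t = 0) \<Longrightarrow> p = (0 :: 'a::alg_closed_field poly)"
  using poly_roots_finite[of p] infinite_UNIV_alg_closed[where 'a = 'a] by auto

section \<open>Parametrized rational curves\<close>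

abbreviation pullback :: "(nat \<Rightarrow> 'a::comm_ring_1 poly) \<Rightarrow> (nat, 'a) mp \<Rightarrow> 'a poly" where
  "pullback \<phi> \<equiv> geval (\<lambda>c. [:c:]) \<phi>"

abbreviation pt :: "nat \<Rightarrow> (nat \<Rightarrow> 'a::comm_ring_1 poly) \<Rightarrow> 'a \<Rightarrow> 'a \<Rightarrow> nat \<Rightarrow> 'a" where
  "pt e \<phi> s t \<equiv> \<lambda>i. heval e (\<phi> i) s t"

lemmas pullback_simps = geval_simps[OF comm_ring_hom_pCons]

text \<open>
  The coordinates restrict to binary forms of degree \<open>e\<close>, hence a monomial of degree \<open>k\<close> to a product of \<open>k\<close> of
  them.
\<close>

lemma pullback_form:
  fixes \<phi> :: "nat \<Rightarrow> 'a::field poly"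
  assumes F: "form n k F" and \<phi>: "\<And>i. i \<le> n \<Longrightarrow> degree (\<phi> i) \<le> e"
  shows "degree (pullback \<phi> F) \<le> e * k"
    and "heval (e * k) (pullback \<phi> F) s t = mp_eval F (pt e \<phi> s t)"
proof -
  have *: "degree (mono_val \<phi> m) \<le> e * k \<and> heval (e * k) (mono_val \<phi> m) s t = mono_val (pt e \<phi> s t) m"
    if "m \<in> keys F" for m
  proof -
    have m: "keys m \<subseteq> {..n}" "mdeg m = k" using F that by (auto simp: form_alt mp_in_def)
    have 1: "degree (\<phi> i ^ lookup m i) \<le> e * lookup m i \<and>
        heval (e * lookup m i) (\<phi> i ^ lookup m i) s t
          = heval e (\<phi> i) s t ^ lookup m i"
      if "i \<in> keys m" for i
      using that m(1) by (intro heval_power \<phi>) auto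
    have "(\<Sum>i\<in>keys m. e * lookup m i) = e * k"
      using m(2) by (simp add: mdeg_def sum_distrib_left[symmetric])
    thus ?thesis
      using heval_prod[of "keys m" "\<lambda>i. \<phi> i ^ lookup m i"
          "\<lambda>i. e * lookup m i" s t] 1
      by (simp add: mono_val_def)
  qed
  show "degree (pullback \<phi> F) \<le> e * k"
    unfolding geval_def using * by (intro degree_sum_le) (auto intro: order_trans[OF degree_smult_le])
  show "heval (e * k) (pullback \<phi> F) s t = mp_eval F (pt e \<phi> s t)"
    using * by (simp add: geval_def mp_eval_geval heval_sum heval_smult)
qed

lemma pullback_eq_0_iff:
  fixes \<phi> :: "nat \<Rightarrow> 'a::alg_closed_field poly"
  assumes F: "form n k F" and \<phi>: "\<And>i. i \<le> n \<Longrightarrow> degree (\<phi> i) \<le> e"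
  shows "pullback \<phi> F = 0 \<longleftrightarrow> (\<forall>s t. mp_eval F (pt e \<phi> s t) = 0)"
proof
  assume "pullback \<phi> F = 0"
  thus "\<forall>s t. mp_eval F (pt e \<phi> s t) = 0"
    by (auto simp: pullback_form(2)[OF F \<phi>, symmetric])
next
  assume *: "\<forall>s t. mp_eval F (pt e \<phi> s t) = 0"
  show "pullback \<phi> F = 0"
  proof (rule poly_all_0_imp_0)
    fix t
    show "poly (pullback \<phi> F) t = 0"
      using * by (simp add: heval_1_left[OF pullback_form(1)[OF F \<phi>], symmetric] pullback_form(2)[OF F \<phi>])
  qed
qed

text \<open>
  The cone over the parametrized curve without its vertex. The coordinates are homogenized to degree \<open>e\<close>, so that
  \<open>s = 0\<close> gives the point at infinity.
\<close>

definition curve_cone :: "nat \<Rightarrow> nat \<Rightarrow> (nat \<Rightarrow> 'a::field poly) \<Rightarrow> 'a vec set" where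
  "curve_cone n e \<phi> = {x \<in> carrier_vec (n + 1). \<exists>c s t. c \<noteq> 0 \<and> (s, t) \<noteq> (0, 0) \<and> (\<forall>i\<le>n. x $ i = c * pt e \<phi> s t i)}"

text \<open>
  Surjectivity of the restriction of \<open>O(d)\<close> on global sections, in the affine coordinate of the projective line.
\<close>

definition restr_surj :: "nat \<Rightarrow> nat \<Rightarrow> nat \<Rightarrow> (nat \<Rightarrow> 'a::field poly) \<Rightarrow> bool" where
  "restr_surj n e d \<phi> \<longleftrightarrow> (\<forall>f. degree f \<le> e * d \<longrightarrow> (\<exists>F. form n d F \<and> pullback \<phi> F = f))"

text \<open>
  The vectors \<open>g\<close> satisfying the two relations are the global sections of the conormal bundle twisted by \<open>d\<close>, seen
  inside the restricted cotangent bundle: the first relation is Euler's, and the second says that \<open>g\<close> kills the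
  tangent vectors of the curve.
\<close>

definition conormal_exact :: "nat \<Rightarrow> nat \<Rightarrow> nat \<Rightarrow> (nat \<Rightarrow> 'a::field poly) \<Rightarrow> bool" where
  "conormal_exact n e d \<phi> \<longleftrightarrow> (\<forall>g. (\<forall>i\<le>n. degree (g i) \<le> e * (d - 1)) \<longrightarrow>
     (\<Sum>i\<le>n. g i * \<phi> i) = 0 \<longrightarrow> (\<Sum>i\<le>n. g i * pderiv (\<phi> i)) = 0 \<longrightarrow>
     (\<exists>F. form n d F \<and> pullback \<phi> F = 0 \<and> (\<forall>i\<le>n. pullback \<phi> (pd i F) = g i)))"

locale parametrized_curve =
  fixes n e d :: nat and \<phi> :: "nat \<Rightarrow> 'a::alg_closed_field poly"
  assumes e_pos: "e \<ge> 1" and d_pos: "d \<ge> 1"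
    and deg_\<phi>: "\<And>i. i \<le> n \<Longrightarrow> degree (\<phi> i) \<le> e"
    and restr: "restr_surj n e d \<phi>"
begin

abbreviation P :: "'a \<Rightarrow> 'a \<Rightarrow> nat \<Rightarrow> 'a" where "P \<equiv> pt e \<phi>"

lemma form_with_restriction:
  assumes "degree f \<le> e * d"
  obtains F where "form n d F" "\<And>s t. mp_eval F (P s t) = heval (e * d) f s t"
proof -
  obtain F where F: "form n d F" "pullback \<phi> F = f" using restr assms by (auto simp: restr_surj_def)
  show ?thesis
  proof (rule that[OF F(1)])
    show "mp_eval F (P s t) = heval (e * d) f s t" for s t
      using pullback_form(2)[OF F(1), of \<phi> e s t] deg_\<phi> by (simp add: F(2))
  qed
qed

lemma monomial_form:
  assumes "j \<le> e * d"
  obtains F where "form n d F" "\<And>s t. mp_eval F (P s t) = s ^ (e * d - j) * t ^ j"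
proof -
  have "degree (monom (1::'a) j) \<le> e * d" using assms degree_monom_le[of "1::'a" j] by linarith
  then obtain F where "form n d F" "\<And>s t. mp_eval F (P s t) = heval (e * d) (monom 1 j) s t"
    using form_with_restriction by blast
  thus ?thesis using assms by (intro that[of F]) (simp_all add: heval_monom)
qed

text \<open>
  At a common zero of the coordinates every form of degree \<open>d\<close> would vanish, but the restrictions
  \<open>s^(e d)\<close> and \<open>t^(e d)\<close> have no common zero.
\<close>

lemma pt_nonzero:
  assumes "(s, t) \<noteq> (0, 0)"
  obtains i where "i \<le> n" "P s t i \<noteq> 0"
proof -
  have "\<exists>i\<le>n. P s t i \<noteq> 0"
  proof (rule ccontr)
    assume "\<not> (\<exists>i\<le>n. P s t i \<noteq> 0)"
    hence z: "\<And>i. i \<in> {..n} \<Longrightarrow> P s t i = 0 * P s t i" by auto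
    have 0: "mp_eval F (P s t) = 0" if "form n d F" for F
    proof -
      have "mp_eval F (P s t) = mp_eval F (\<lambda>i. 0 * P s t i)"
        unfolding mp_eval_geval by (rule geval_cong[OF form_mp_in[OF that] z])
      thus ?thesis using form_scale[OF that, of 0 "P s t"] d_pos by (simp add: zero_power)
    qed
    obtain F where F: "form n d F" "\<And>s t. mp_eval F (P s t) = s ^ (e * d - 0) * t ^ 0"
      using monomial_form[of 0] by auto
    obtain G where G: "form n d G" "\<And>s t. mp_eval G (P s t) = s ^ (e * d - e * d) * t ^ (e * d)"
      using monomial_form[of "e * d"] by auto
    have "s ^ (e * d) = 0" "t ^ (e * d) = 0" using 0[OF F(1)] 0[OF G(1)] F(2)[of s t] G(2)[of s t] by auto
    thus False using assms by auto
  qed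
  thus ?thesis using that by blast
qed

text \<open>
  Two forms \<open>Q\<close>, \<open>R\<close> whose restrictions to the curve have ratio \<open>s : t\<close> invert the parametrization;
  composed with it they give the forms below, a rational retraction of projective space onto the curve.
\<close>

definition retr :: "(nat, 'a) mp \<Rightarrow> (nat, 'a) mp \<Rightarrow> nat \<Rightarrow> (nat, 'a) mp" where
  "retr Q R i = (\<Sum>j\<le>e. Const (coeff (\<phi> i) j) * (Q ^ (e - j) * R ^ j))"

lemma retr_form:
  assumes "form n k Q" "form n k R"
  shows "form n (k * e) (retr Q R i)"
  unfolding retr_def
proof (rule form_sum)
  fix j assume "j \<in> {..e}"
  hence "k * e = k * (e - j) + k * j" by (simp add: distrib_left[symmetric])
  thus "form n (k * e) (Const (coeff (\<phi> i) j) * (Q ^ (e - j) * R ^ j))"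
    using form_smult[OF form_mult[OF form_power[OF assms(1)] form_power[OF assms(2)]]] by simp
qed

lemma retr_eval: "mp_eval (retr Q R i) x = P (mp_eval Q x) (mp_eval R x) i"
  by (simp add: retr_def heval_def mp_eval_simps mult.assoc)

text \<open>
  On the curve \<open>s : t\<close> is the ratio of \<open>s^(e d)\<close> and \<open>s^(e d - 1) t\<close>, and for \<open>s = 0\<close> it is the ratio of
  \<open>s t^(e d - 1)\<close> and \<open>t^(e d)\<close>; all these monomials are restrictions of forms.
\<close>

lemma inverse_forms:
  assumes "(s0, t0) \<noteq> (0, 0)"
  obtains Q R \<theta> where "form n d Q" "form n d R" "\<And>s t. mp_eval Q (P s t) = s * \<theta> s t"
    "\<And>s t. mp_eval R (P s t) = t * \<theta> s t" "\<theta> s0 t0 \<noteq> 0"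
proof -
  have ed: "e * d \<ge> 1" using e_pos d_pos by simp
  show ?thesis
  proof (cases "s0 = 0")
    case False
    obtain Q where Q: "form n d Q" "\<And>s t. mp_eval Q (P s t) = s ^ (e * d - 0) * t ^ 0"
      using monomial_form[of 0] by auto
    obtain R where R: "form n d R" "\<And>s t. mp_eval R (P s t) = s ^ (e * d - 1) * t ^ 1"
      using monomial_form[of 1] ed by auto
    have "s ^ (e * d) = s * s ^ (e * d - 1)" for s :: 'a using ed by (simp add: power_eq_if)
    thus ?thesis using that[of Q R "\<lambda>s t. s ^ (e * d - 1)"] Q R False by (simp add: mult.commute)
  next
    case True
    obtain Q where Q: "form n d Q" "\<And>s t. mp_eval Q (P s t) = s ^ (e * d - (e * d - 1)) * t ^ (e * d - 1)"
      using monomial_form[of "e * d - 1"] by auto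
    obtain R where R: "form n d R" "\<And>s t. mp_eval R (P s t) = s ^ (e * d - e * d) * t ^ (e * d)"
      using monomial_form[of "e * d"] by auto
    have "t ^ (e * d) = t * t ^ (e * d - 1)" "e * d - (e * d - 1) = 1" for t :: 'a
      using ed by (simp_all add: power_eq_if)
    thus ?thesis using that[of Q R "\<lambda>s t. t ^ (e * d - 1)"] Q R True assms by simp
  qed
qed

end

section \<open>Zariski open sets and regular functions\<close>

lemma zopen_basic: "form n k H \<Longrightarrow> zopen n {x \<in> pcone n. ev H x \<noteq> 0}"
  unfolding zopen_def by (intro exI[of _ "{H}"]) auto

lemma zopen_pcone: "zopen n (pcone n)"
  using zopen_basic[OF form_1, of n] by (simp add: mp_eval_simps)

lemma zopen_subset: "zopen n U \<Longrightarrow> U \<subseteq> pcone n"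
  unfolding zopen_def by auto

lemma zopen_Int:
  assumes "zopen n U" "zopen n V" shows "zopen n (U \<inter> V)"
proof -
  obtain S T where S: "\<forall>F\<in>S. \<exists>k. form n k F" "U = {x \<in> pcone n. \<exists>F\<in>S. ev F x \<noteq> 0}"
    and T: "\<forall>F\<in>T. \<exists>k. form n k F" "V = {x \<in> pcone n. \<exists>F\<in>T. ev F x \<noteq> 0}"
    using assms unfolding zopen_def by blast
  have "\<forall>F\<in>(\<lambda>(F, G). F * G) ` (S \<times> T). \<exists>k. form n k F"
    using S(1) T(1) form_mult by fast
  moreover have "U \<inter> V = {x \<in> pcone n. \<exists>F\<in>(\<lambda>(F, G). F * G) ` (S \<times> T). ev F x \<noteq> 0}"
    unfolding S(2) T(2) by (auto simp: mp_eval_simps)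
  ultimately show ?thesis unfolding zopen_def by blast
qed

lemma pcone_iff: "x \<in> pcone n \<longleftrightarrow> x \<in> carrier_vec (n + 1) \<and> (\<exists>i\<le>n. x $ i \<noteq> 0)"
proof -
  have "x = 0\<^sub>v (n + 1) \<longleftrightarrow> (\<forall>i\<le>n. x $ i = 0)" if "x \<in> carrier_vec (n + 1)"
    using that by (auto simp: vec_eq_iff less_Suc_eq_le)
  thus ?thesis by (auto simp: pcone_def)
qed

text \<open>
  Multiplying by a coordinate makes the nonvanishing locus avoid the origin, so that it can be
  described inside the whole affine space.
\<close>

lemma zopen_nbhd:
  assumes "zopen n W" "x \<in> W"
  obtains k H where "form n k H" "ev H x \<noteq> 0" "\<And>z. z \<in> carrier_vec (n + 1) \<Longrightarrow> ev H z \<noteq> 0 \<Longrightarrow> z \<in> W"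
proof -
  obtain S where S: "\<forall>F\<in>S. \<exists>k. form n k F" "W = {x \<in> pcone n. \<exists>F\<in>S. ev F x \<noteq> 0}"
    using assms unfolding zopen_def by blast
  obtain F k where F: "F \<in> S" "form n k F" "ev F x \<noteq> 0" using assms S by auto
  obtain i where i: "i \<le> n" "x $ i \<noteq> 0" using assms S by (auto simp: pcone_iff)
  show ?thesis
  proof (rule that[of "1 + k" "Var i * F"])
    show "form n (1 + k) (Var i * F)" using form_mult[OF form_Var[OF i(1)] F(2)] by simp
    show "ev (Var i * F) x \<noteq> 0" using F i by (simp add: mp_eval_simps)
    fix z :: "'a vec" assume "z \<in> carrier_vec (n + 1)" "ev (Var i * F) z \<noteq> 0"
    thus "z \<in> W" unfolding S(2) using F(1) i(1) by (auto simp: pcone_iff mp_eval_simps)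
  qed
qed

text \<open>
  Sections given on all of \<open>W\<close> by a single quotient. They form a graded ring with explicit operations, so that
  neighbourhoods need not be shrunk as for general sections.
\<close>

definition regf :: "nat \<Rightarrow> nat \<Rightarrow> 'a::field vec set \<Rightarrow> ('a vec \<Rightarrow> 'a) \<Rightarrow> bool" where
  "regf n d W r \<longleftrightarrow> (\<exists>g F G. form n (g + d) F \<and> form n g G \<and> (\<forall>y\<in>W. ev G y \<noteq> 0 \<and> r y = ev F y / ev G y))"

lemma regfI:
  assumes "form n (g + d) F" "form n g G" "\<And>y. y \<in> W \<Longrightarrow> ev G y \<noteq> 0 \<and> r y = ev F y / ev G y"
  shows "regf n d W r"
  using assms unfolding regf_def by blast

lemma regf_const: "regf n 0 W (\<lambda>y. c)"
  by (rule regfI[of n 0 0 "Const c" 1]) (auto simp: form_Const form_1 mp_eval_simps)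

lemma regf_add:
  assumes "regf n d W r" "regf n d W r'" shows "regf n d W (\<lambda>y. r y + r' y)"
proof -
  obtain g F G where 1: "form n (g + d) F" "form n g G" "\<forall>y\<in>W. ev G y \<noteq> 0 \<and> r y = ev F y / ev G y"
    using assms(1) unfolding regf_def by blast
  obtain g' F' G' where 2: "form n (g' + d) F'" "form n g' G'" "\<forall>y\<in>W. ev G' y \<noteq> 0 \<and> r' y = ev F' y / ev G' y"
    using assms(2) unfolding regf_def by blast
  have "form n (g + g' + d) (F * G' + F' * G)"
    using form_add[of n "g + g' + d" "F * G'" "F' * G"] form_mult[OF 1(1) 2(2)] form_mult[OF 2(1) 1(2)]
    by (simp add: ac_simps)
  thus ?thesis
    by (rule regfI[OF _ form_mult[OF 1(2) 2(2)]]) (use 1 2 in \<open>auto simp: mp_eval_simps field_simps\<close>)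
qed

lemma regf_mult:
  assumes "regf n d W r" "regf n d' W r'" shows "regf n (d + d') W (\<lambda>y. r y * r' y)"
proof -
  obtain g F G where 1: "form n (g + d) F" "form n g G" "\<forall>y\<in>W. ev G y \<noteq> 0 \<and> r y = ev F y / ev G y"
    using assms(1) unfolding regf_def by blast
  obtain g' F' G' where 2: "form n (g' + d') F'" "form n g' G'" "\<forall>y\<in>W. ev G' y \<noteq> 0 \<and> r' y = ev F' y / ev G' y"
    using assms(2) unfolding regf_def by blast
  have "form n (g + g' + (d + d')) (F * F')"
    using form_mult[OF 1(1) 2(1)] by (simp add: ac_simps)
  thus ?thesis
    by (rule regfI[OF _ form_mult[OF 1(2) 2(2)]]) (use 1 2 in \<open>auto simp: mp_eval_simps field_simps\<close>)
qed

lemma regf_twist: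
  assumes "regf n d W r" "zopen n W" shows "(\<lambda>y\<in>W. r y) \<in> twist n d W"
proof -
  obtain g F G where 1: "form n (g + d) F" "form n g G" "\<forall>y\<in>W. ev G y \<noteq> 0 \<and> r y = ev F y / ev G y"
    using assms(1) unfolding regf_def by blast
  show ?thesis unfolding twist_def
  proof (intro CollectI conjI ballI)
    fix x assume "x \<in> W"
    show "\<exists>W' F G g. zopen n W' \<and> x \<in> W' \<and> W' \<subseteq> W \<and> form n (g + d) F \<and> form n g G \<and>
        (\<forall>y\<in>W'. ev G y \<noteq> 0 \<and> restrict r W y = ev F y / ev G y)"
      using assms(2) \<open>x \<in> W\<close> 1 by (intro exI[of _ W] exI[of _ F] exI[of _ G] exI[of _ g]) auto
  qed auto
qed

lemma twist_restrict:
  assumes "s \<in> twist n d U" "zopen n W" "W \<subseteq> U"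
  shows "(\<lambda>y\<in>W. s y) \<in> twist n d W"
  unfolding twist_def
proof (intro CollectI conjI ballI)
  fix x assume x: "x \<in> W"
  hence "x \<in> U" using assms by auto
  then obtain W' F G g where *: "zopen n W'" "x \<in> W'" "W' \<subseteq> U" "form n (g + d) F" "form n g G"
    "\<forall>y\<in>W'. ev G y \<noteq> 0 \<and> s y = ev F y / ev G y"
    using assms(1) unfolding twist_def by blast
  show "\<exists>W' F G g. zopen n W' \<and> x \<in> W' \<and> W' \<subseteq> W \<and> form n (g + d) F \<and> form n g G \<and>
        (\<forall>y\<in>W'. ev G y \<noteq> 0 \<and> restrict s W y = ev F y / ev G y)"
    using assms(2) x *
    by (intro exI[of _ "W' \<inter> W"] exI[of _ F] exI[of _ G] exI[of _ g]) (auto intro: zopen_Int)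
qed auto

lemma twist_uminus:
  assumes "s \<in> twist n d U" shows "(\<lambda>y\<in>U. - s y) \<in> twist n d U"
  unfolding twist_def
proof (intro CollectI conjI ballI)
  fix x assume x: "x \<in> U"
  then obtain W' F G g where *: "zopen n W'" "x \<in> W'" "W' \<subseteq> U" "form n (g + d) F" "form n g G"
    "\<forall>y\<in>W'. ev G y \<noteq> 0 \<and> s y = ev F y / ev G y"
    using assms(1) unfolding twist_def by blast
  show "\<exists>W' F G g. zopen n W' \<and> x \<in> W' \<and> W' \<subseteq> U \<and> form n (g + d) F \<and> form n g G \<and>
        (\<forall>y\<in>W'. ev G y \<noteq> 0 \<and> (\<lambda>y\<in>U. - s y) y = ev F y / ev G y)"
    using * by (intro exI[of _ W'] exI[of _ "- F"] exI[of _ G] exI[of _ g])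
      (auto simp: form_uminus mp_eval_simps)
qed auto

lemma ideal_twist_restrict:
  "s \<in> ideal_twist n C d U \<Longrightarrow> zopen n W \<Longrightarrow> W \<subseteq> U \<Longrightarrow> (\<lambda>y\<in>W. s y) \<in> ideal_twist n C d W"
  unfolding ideal_twist_def using twist_restrict[of s n d U W] by auto

lemma ideal_twist_uminus: "s \<in> ideal_twist n C d U \<Longrightarrow> (\<lambda>y\<in>U. - s y) \<in> ideal_twist n C d U"
  unfolding ideal_twist_def using twist_uminus[of s n d U] by auto

lemma regf_ideal_twist:
  "regf n d W r \<Longrightarrow> zopen n W \<Longrightarrow> (\<And>y. y \<in> W \<Longrightarrow> y \<in> C \<Longrightarrow> r y = 0) \<Longrightarrow> (\<lambda>y\<in>W. r y) \<in> ideal_twist n C d W"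
  unfolding ideal_twist_def using regf_twist[of n d W r] by auto

section \<open>The square of the ideal sheaf\<close>

lemma ideal_sq_restrict:
  assumes "s \<in> ideal_sq n C d U" "zopen n W" "W \<subseteq> U"
  shows "(\<lambda>y\<in>W. s y) \<in> ideal_sq n C d W"
  unfolding ideal_sq_def
proof (intro CollectI conjI ballI)
  fix x assume x: "x \<in> W"
  hence "x \<in> U" using assms by auto
  then obtain W' k a b where *: "zopen n W'" "x \<in> W'" "W' \<subseteq> U"
    "\<forall>i<k. a i \<in> ideal_twist n C 0 W' \<and> b i \<in> ideal_twist n C d W'" "\<forall>y\<in>W'. s y = (\<Sum>i<(k::nat). a i y * b i y)"
    using assms(1) unfolding ideal_sq_def by blast
  show "\<exists>W' (k::nat) a b. zopen n W' \<and> x \<in> W' \<and> W' \<subseteq> W \<and>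
      (\<forall>i<k. a i \<in> ideal_twist n C 0 W' \<and> b i \<in> ideal_twist n C d W') \<and>
      (\<forall>y\<in>W'. restrict s W y = (\<Sum>i<k. a i y * b i y))"
    using assms(2) x *
    by (intro exI[of _ "W' \<inter> W"] exI[of _ k] exI[of _ "\<lambda>i. \<lambda>y\<in>W' \<inter> W. a i y"]
        exI[of _ "\<lambda>i. \<lambda>y\<in>W' \<inter> W. b i y"])
      (auto intro!: zopen_Int ideal_twist_restrict[of _ n C _ W'])
qed auto

lemma ideal_sq_uminus:
  assumes "s \<in> ideal_sq n C d U" shows "(\<lambda>y\<in>U. - s y) \<in> ideal_sq n C d U"
  unfolding ideal_sq_def
proof (intro CollectI conjI ballI)
  fix x assume x: "x \<in> U"
  then obtain W' k a b where *: "zopen n W'" "x \<in> W'" "W' \<subseteq> U"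
    "\<forall>i<k. a i \<in> ideal_twist n C 0 W' \<and> b i \<in> ideal_twist n C d W'" "\<forall>y\<in>W'. s y = (\<Sum>i<(k::nat). a i y * b i y)"
    using assms(1) unfolding ideal_sq_def by blast
  show "\<exists>W' (k::nat) a b. zopen n W' \<and> x \<in> W' \<and> W' \<subseteq> U \<and>
      (\<forall>i<k. a i \<in> ideal_twist n C 0 W' \<and> b i \<in> ideal_twist n C d W') \<and>
      (\<forall>y\<in>W'. (\<lambda>y\<in>U. - s y) y = (\<Sum>i<k. a i y * b i y))"
    using x *
    by (intro exI[of _ W'] exI[of _ k] exI[of _ "\<lambda>i. \<lambda>y\<in>W'. - a i y"] exI[of _ b])
      (auto intro!: ideal_twist_uminus simp: sum_negf)
qed auto

lemma ideal_sq_add: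
  assumes "s \<in> ideal_sq n C d U" "s' \<in> ideal_sq n C d U"
  shows "(\<lambda>y\<in>U. s y + s' y) \<in> ideal_sq n C d U"
  unfolding ideal_sq_def
proof (intro CollectI conjI ballI)
  fix x assume x: "x \<in> U"
  then obtain W k a b where *: "zopen n W" "x \<in> W" "W \<subseteq> U"
    "\<forall>i<k. a i \<in> ideal_twist n C 0 W \<and> b i \<in> ideal_twist n C d W" "\<forall>y\<in>W. s y = (\<Sum>i<(k::nat). a i y * b i y)"
    using assms(1) unfolding ideal_sq_def by blast
  obtain W' k' a' b' where **: "zopen n W'" "x \<in> W'" "W' \<subseteq> U"
    "\<forall>i<k'. a' i \<in> ideal_twist n C 0 W' \<and> b' i \<in> ideal_twist n C d W'"
    "\<forall>y\<in>W'. s' y = (\<Sum>i<(k'::nat). a' i y * b' i y)"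
    using assms(2) x unfolding ideal_sq_def by blast
  let ?V = "W \<inter> W'"
  define A where "A i = (\<lambda>y\<in>?V. if i < k then a i y else a' (i - k) y)" for i
  define B where "B i = (\<lambda>y\<in>?V. if i < k then b i y else b' (i - k) y)" for i
  have V: "zopen n ?V" using * ** by (intro zopen_Int)
  have "A i \<in> ideal_twist n C 0 ?V \<and> B i \<in> ideal_twist n C d ?V" if "i < k + k'" for i
  proof (cases "i < k")
    case True
    thus ?thesis unfolding A_def B_def using V * by (auto intro!: ideal_twist_restrict[of _ n C _ W])
  next
    case False
    hence "i - k < k'" using that by simp
    thus ?thesis unfolding A_def B_def using False V ** by (auto intro!: ideal_twist_restrict[of _ n C _ W'])
  qed
  moreover have "(\<lambda>y\<in>U. s y + s' y) y = (\<Sum>i<k + k'. A i y * B i y)" if "y \<in> ?V" for y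
  proof -
    have "(\<Sum>i<k + k'. A i y * B i y) = (\<Sum>i<k. A i y * B i y) + (\<Sum>i<k'. A (k + i) y * B (k + i) y)"
      by (induction k') (simp_all add: ac_simps)
    also have "\<dots> = (\<Sum>i<k. a i y * b i y) + (\<Sum>i<k'. a' i y * b' i y)"
      using that by (simp add: A_def B_def)
    finally show ?thesis using that * ** by auto
  qed
  ultimately show "\<exists>W' (k::nat) a b. zopen n W' \<and> x \<in> W' \<and> W' \<subseteq> U \<and>
      (\<forall>i<k. a i \<in> ideal_twist n C 0 W' \<and> b i \<in> ideal_twist n C d W') \<and>
      (\<forall>y\<in>W'. (\<lambda>y\<in>U. s y + s' y) y = (\<Sum>i<k. a i y * b i y))"
    using V * ** by (intro exI[of _ ?V] exI[of _ "k + k'"] exI[of _ A] exI[of _ B]) auto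
qed auto

lemma ideal_sq_0: "zopen n U \<Longrightarrow> (\<lambda>y\<in>U. 0) \<in> ideal_sq n C d U"
  unfolding ideal_sq_def
  by (auto intro!: exI[of _ U] exI[of _ "0::nat"])

text \<open>
  Away from \<open>C\<close> the constant \<open>1\<close> is a section of the ideal sheaf.
\<close>

lemma ideal_sq_off_curve:
  assumes "s \<in> twist n d U" "zopen n U" "U \<inter> C = {}"
  shows "s \<in> ideal_sq n C d U"
proof -
  have "(\<lambda>y\<in>U. 1) \<in> ideal_twist n C 0 U"
    using assms by (intro regf_ideal_twist regf_const) auto
  moreover have "s \<in> ideal_twist n C d U" using assms by (auto simp: ideal_twist_def)
  moreover have "s \<in> extensional U" using assms(1) by (simp add: twist_def)
  ultimately show ?thesis unfolding ideal_sq_def using assms(2)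
    by (intro CollectI conjI ballI exI[of _ U] exI[of _ "1::nat"] exI[of _ "\<lambda>_. \<lambda>y\<in>U. 1"] exI[of _ "\<lambda>_. s"]) auto
qed

lemma germ_eqI:
  assumes "zopen n W" "x \<in> W" "W \<subseteq> U \<inter> U'" "(\<lambda>y\<in>W. s y - s' y) \<in> ideal_sq n C d W"
  shows "conormal_germ n C d x U s = conormal_germ n C d x U' s'"
proof -
  have *: "conormal_germ n C d x U s \<subseteq> conormal_germ n C d x U' s'"
    if W: "zopen n W" "x \<in> W" "W \<subseteq> U \<inter> U'" "(\<lambda>y\<in>W. s y - s' y) \<in> ideal_sq n C d W" for U U' s s'
  proof (unfold conormal_germ_def, clarify)
    fix V t W' assume t: "zopen n V" "x \<in> V" "t \<in> ideal_twist n C d V" "zopen n W'" "x \<in> W'" "W' \<subseteq> U \<inter> V"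
      "(\<lambda>y\<in>W'. s y - t y) \<in> ideal_sq n C d W'"
    let ?V = "W \<inter> W'"
    have V: "zopen n ?V" using W t by (intro zopen_Int)
    have 1: "(\<lambda>y\<in>?V. (\<lambda>y\<in>W. s y - s' y) y) \<in> ideal_sq n C d ?V"
      by (rule ideal_sq_restrict[OF W(4) V]) auto
    have 2: "(\<lambda>y\<in>?V. (\<lambda>y\<in>W'. s y - t y) y) \<in> ideal_sq n C d ?V"
      by (rule ideal_sq_restrict[OF t(7) V]) auto
    have "(\<lambda>y\<in>?V. (\<lambda>y\<in>?V. (\<lambda>y\<in>W'. s y - t y) y) y
        + (\<lambda>y\<in>?V. - (\<lambda>y\<in>?V. (\<lambda>y\<in>W. s y - s' y) y) y) y) \<in> ideal_sq n C d ?V"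
      by (rule ideal_sq_add[OF 2 ideal_sq_uminus[OF 1]])
    moreover have "(\<lambda>y\<in>?V. (\<lambda>y\<in>?V. (\<lambda>y\<in>W'. s y - t y) y) y
        + (\<lambda>y\<in>?V. - (\<lambda>y\<in>?V. (\<lambda>y\<in>W. s y - s' y) y) y) y) = (\<lambda>y\<in>?V. s' y - t y)"
      by (auto simp: fun_eq_iff restrict_def)
    ultimately have sq: "(\<lambda>y\<in>?V. s' y - t y) \<in> ideal_sq n C d ?V" by (simp only:)
    show "\<exists>W. zopen n W \<and> x \<in> W \<and> W \<subseteq> U' \<inter> V \<and> (\<lambda>y\<in>W. s' y - t y) \<in> ideal_sq n C d W"
      using W t V by (intro exI[of _ ?V] conjI sq) auto
  qed
  have "(\<lambda>y\<in>W. - (\<lambda>y\<in>W. s y - s' y) y) \<in> ideal_sq n C d W"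
    by (rule ideal_sq_uminus[OF assms(4)])
  moreover have "(\<lambda>y\<in>W. - (\<lambda>y\<in>W. s y - s' y) y) = (\<lambda>y\<in>W. s' y - s y)"
    by (auto simp: fun_eq_iff restrict_def)
  ultimately have sq: "(\<lambda>y\<in>W. s' y - s y) \<in> ideal_sq n C d W" by (simp only:)
  show ?thesis
    using assms(1-3) *[OF assms] *[OF assms(1,2) _ sq, of U' U] by blast
qed

text \<open>
  A section belongs to its own germ, so equality of germs makes one section a representative of the other germ.
\<close>

lemma germ_eqD:
  assumes "conormal_germ n C d x U s = conormal_germ n C d x U' s'"
    "zopen n U'" "x \<in> U'" "s' \<in> ideal_twist n C d U'"
  obtains W where "zopen n W" "x \<in> W" "W \<subseteq> U \<inter> U'" "(\<lambda>y\<in>W. s y - s' y) \<in> ideal_sq n C d W"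
proof -
  have "(U', s') \<in> conormal_germ n C d x U' s'"
    unfolding conormal_germ_def using assms(2-4) ideal_sq_0[OF assms(2)] by auto
  hence "(U', s') \<in> conormal_germ n C d x U s" by (simp add: assms(1))
  thus ?thesis using that unfolding conormal_germ_def by auto
qed

section \<open>Taylor expansion modulo an ideal\<close>

lemma geval_in_subring:
  assumes h: "comm_ring_hom h" and F: "mp_in V F"
    and R: "\<And>a. h a \<in> R" "\<And>p q. p \<in> R \<Longrightarrow> q \<in> R \<Longrightarrow> p + q \<in> R" "\<And>p q. p \<in> R \<Longrightarrow> q \<in> R \<Longrightarrow> p * q \<in> R"
    and c: "\<And>i. i \<in> V \<Longrightarrow> c i \<in> R"
  shows "geval h c F \<in> R"
  using F by (induction F rule: mp_induct) (auto simp: geval_simps[OF h] intro: R c)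

text \<open>
  The remainder of the first-order expansion is a combination of products \<open>u i * \<rho> i\<close> of two
  elements of the ideal.
\<close>

lemma taylor_mod_ideal:
  fixes h :: "'a::comm_ring_1 \<Rightarrow> 'b::comm_ring_1"
  assumes h: "comm_ring_hom h" and V: "finite V" and F: "mp_in V F"
    and R: "\<And>a. h a \<in> R" "\<And>p q. p \<in> R \<Longrightarrow> q \<in> R \<Longrightarrow> p + q \<in> R" "\<And>p q. p \<in> R \<Longrightarrow> q \<in> R \<Longrightarrow> p * q \<in> R"
    and I: "I \<subseteq> R" "0 \<in> I" "\<And>p q. p \<in> I \<Longrightarrow> q \<in> I \<Longrightarrow> p + q \<in> I" "\<And>p q. p \<in> R \<Longrightarrow> q \<in> I \<Longrightarrow> p * q \<in> I"
    and c: "\<And>i. i \<in> V \<Longrightarrow> c i \<in> R" and u: "\<And>i. i \<in> V \<Longrightarrow> u i \<in> I"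
  shows "\<exists>\<rho>. (\<forall>i\<in>V. \<rho> i \<in> I) \<and>
    geval h (\<lambda>i. c i + u i) F = geval h c F + (\<Sum>i\<in>V. u i * (geval h c (pd i F) + \<rho> i))"
  using F
proof (induction F rule: mp_induct)
  case (Const a)
  show ?case using I(2) by (intro exI[of _ "\<lambda>_. 0"]) (simp add: geval_simps[OF h])
next
  case (Var j)
  have "(\<Sum>i\<in>V. u i * (geval h c (pd i (Var j)) + 0)) = (\<Sum>i\<in>V. if i = j then u i else 0)"
    by (intro sum.cong refl) (simp only: pd_Var, simp add: geval_simps[OF h])
  also have "\<dots> = u j" using V Var by simp
  finally show ?case using I(2)
    by (intro exI[of _ "\<lambda>_. 0"]) (simp add: geval_simps[OF h] del: One_nat_def)
next
  case (add F G)
  then obtain \<rho> \<sigma> where "\<forall>i\<in>V. \<rho> i \<in> I" "\<forall>i\<in>V. \<sigma> i \<in> I"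
    "geval h (\<lambda>i. c i + u i) F = geval h c F + (\<Sum>i\<in>V. u i * (geval h c (pd i F) + \<rho> i))"
    "geval h (\<lambda>i. c i + u i) G = geval h c G + (\<Sum>i\<in>V. u i * (geval h c (pd i G) + \<sigma> i))" by blast
  thus ?case using I(3)
    by (intro exI[of _ "\<lambda>i. \<rho> i + \<sigma> i"]) (simp add: geval_simps[OF h] pd_add sum.distrib algebra_simps)
next
  case (mult F G)
  then obtain \<rho> \<sigma> where r: "\<forall>i\<in>V. \<rho> i \<in> I" "\<forall>i\<in>V. \<sigma> i \<in> I"
    and F: "geval h (\<lambda>i. c i + u i) F = geval h c F + (\<Sum>i\<in>V. u i * (geval h c (pd i F) + \<rho> i))"
    and G: "geval h (\<lambda>i. c i + u i) G = geval h c G + (\<Sum>i\<in>V. u i * (geval h c (pd i G) + \<sigma> i))" by blast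
  let ?DG = "\<Sum>i\<in>V. u i * (geval h c (pd i G) + \<sigma> i)"
  have inR: "geval h c H \<in> R" if "mp_in V H" for H
    by (rule geval_in_subring[OF h that R c])
  have sumI: "(\<Sum>i\<in>V'. f i) \<in> I" if "\<And>i. i \<in> V' \<Longrightarrow> f i \<in> I" for f and V' :: "'c set"
    using that by (induction V' rule: infinite_finite_induct) (auto intro: I)
  have DG: "?DG \<in> I"
  proof (rule sumI)
    fix i assume "i \<in> V"
    hence "(geval h c (pd i G) + \<sigma> i) * u i \<in> I"
      using r(2) I(1) inR[OF mp_in_pd[OF mult(2)]] u by (intro I(4) R(2)) auto
    thus "u i * (geval h c (pd i G) + \<sigma> i) \<in> I" by (simp add: mult.commute)
  qed
  let ?\<tau> = "\<lambda>i. geval h c F * \<sigma> i + geval h c G * \<rho> i + (geval h c (pd i F) + \<rho> i) * ?DG"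
  have "\<forall>i\<in>V. ?\<tau> i \<in> I"
    using r I(1) inR[OF mp_in_pd[OF mult(1)]] inR[OF mult(1)] inR[OF mult(2)] DG
    by (intro ballI I(3) I(4) R(2)) auto
  moreover have "geval h (\<lambda>i. c i + u i) (F * G) =
     geval h c (F * G) + (\<Sum>i\<in>V. u i * (geval h c (pd i (F * G)) + ?\<tau> i))"
  proof -
    have "(\<Sum>i\<in>V. u i * (geval h c (pd i (F * G)) + ?\<tau> i)) =
      geval h c F * ?DG + geval h c G * (\<Sum>i\<in>V. u i * (geval h c (pd i F) + \<rho> i))
       + (\<Sum>i\<in>V. u i * (geval h c (pd i F) + \<rho> i)) * ?DG"
      unfolding sum_distrib_left[of "geval h c F"] sum_distrib_left[of "geval h c G"] sum_distrib_right[of _ _ ?DG]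
      unfolding sum.distrib[symmetric]
      by (intro sum.cong refl) (simp add: geval_simps[OF h] pd_mult algebra_simps)
    thus ?thesis by (simp add: geval_mult[OF h] F G algebra_simps)
  qed
  ultimately show ?case by (intro exI[of _ ?\<tau>] conjI)
qed

section \<open>The curve is closed, and flat sections lie in the square of its ideal\<close>

lemma sum_apply: "(\<Sum>i\<in>A. f i) y = (\<Sum>i\<in>A. f i y)"
  by (induction A rule: infinite_finite_induct) (simp_all add: zero_fun_def plus_fun_def)

lemma ev_curve_point:
  assumes "form n k F" "x \<in> carrier_vec (n + 1)" "\<And>i. i \<le> n \<Longrightarrow> x $ i = c * p i"
  shows "ev F x = c ^ k * mp_eval F p"
proof -
  have "ev F x = mp_eval F (\<lambda>i. c * p i)"
    unfolding mp_eval_geval using assms(3) by (intro geval_cong[OF form_mp_in[OF assms(1)]]) auto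
  thus ?thesis by (simp add: form_scale[OF assms(1)])
qed

context parametrized_curve
begin

abbreviation C :: "'a vec set" where "C \<equiv> curve_cone n e \<phi>"

lemma retr_pt:
  assumes "\<And>s t. mp_eval Q (P s t) = s * \<theta> s t" "\<And>s t. mp_eval R (P s t) = t * \<theta> s t"
  shows "mp_eval (retr Q R i) (P s t) = \<theta> s t ^ e * P s t i"
  using heval_scale[of e "\<phi> i" "\<theta> s t" s t] by (simp add: retr_eval assms mult.commute)

text \<open>
  The minors \<open>x i * z j - x j * z i\<close> formed with the coordinates \<open>z\<close> of the retraction vanish on the curve. If they
  vanish at \<open>x\<close> as well, then \<open>x\<close> is proportional to \<open>z\<close>, which is a point of the curve.
\<close>

lemma on_curve_if_retraction:
  assumes x: "x \<in> pcone n"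
    and Q: "form n k Q" "\<And>s t. mp_eval Q (P s t) = s * \<theta> s t"
    and R: "form n k R" "\<And>s t. mp_eval R (P s t) = t * \<theta> s t"
    and nz: "(ev Q x, ev R x) \<noteq> (0, 0)"
    and van: "\<And>k H. form n k H \<Longrightarrow> (\<And>s t. mp_eval H (P s t) = 0) \<Longrightarrow> ev H x = 0"
  shows "x \<in> C"
proof -
  let ?z = "P (ev Q x) (ev R x)"
  have cross: "x $ i * ?z j = x $ j * ?z i" if "i \<le> n" "j \<le> n" for i j
  proof -
    let ?H = "Var i * retr Q R j - Var j * retr Q R i"
    have "form n (1 + k * e) ?H"
      using that by (intro form_diff form_mult form_Var retr_form Q R)
    moreover have "mp_eval ?H (P s t) = 0" for s t
      using retr_pt[of Q \<theta> R] Q(2) R(2) by (simp add: mp_eval_simps del: One_nat_def)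
    ultimately have "ev ?H x = 0" by (rule van)
    thus ?thesis by (simp add: mp_eval_simps retr_eval del: One_nat_def)
  qed
  obtain j where j: "j \<le> n" "?z j \<noteq> 0" using pt_nonzero[OF nz] .
  obtain i where i: "i \<le> n" "x $ i \<noteq> 0" using x by (auto simp: pcone_iff)
  have "x $ j \<noteq> 0" using cross[OF i(1) j(1)] i j by auto
  moreover have "\<forall>i\<le>n. x $ i = (x $ j / ?z j) * ?z i"
    using cross[OF _ j(1)] j(2) by (simp add: field_simps)
  ultimately have "x $ j / ?z j \<noteq> 0 \<and> (ev Q x, ev R x) \<noteq> (0, 0) \<and> (\<forall>i\<le>n. x $ i = (x $ j / ?z j) * ?z i)"
    using nz j(2) by auto
  thus ?thesis using x unfolding curve_cone_def pcone_iff by blast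
qed

text \<open>
  If all forms vanishing on the curve vanish at \<open>x\<close>, then the forms \<open>Q j\<close> restricting to the monomials
  \<open>s^(e d - j) t^j\<close> do not all vanish at \<open>x\<close> because the \<open>d\<close>-th powers of the coordinates are
  combinations of them; the relations between them leave only \<open>Q 0\<close> and \<open>Q (e d)\<close>, and then the
  retraction fixes \<open>x\<close>.
\<close>

lemma separating_form:
  assumes x: "x \<in> pcone n" "x \<notin> C"
  obtains k H where "form n k H" "ev H x \<noteq> 0" "\<And>s t. mp_eval H (P s t) = 0"
proof (rule ccontr)
  assume "\<not> thesis"
  hence van: "ev H x = 0" if "form n k H" "\<And>s t. mp_eval H (P s t) = 0" for k H
    using that \<open>\<And>H k. \<lbrakk>form n k H; ev H x \<noteq> 0; \<And>s t. mp_eval H (P s t) = 0\<rbrakk> \<Longrightarrow> thesis\<close> by blast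
  have ed: "e * d \<ge> 1" using e_pos d_pos by simp
  have "\<forall>j. \<exists>Q. j \<le> e * d \<longrightarrow> form n d Q \<and> (\<forall>s t. mp_eval Q (P s t) = s ^ (e * d - j) * t ^ j)"
    using monomial_form by metis
  then obtain Q where Q: "\<And>j. j \<le> e * d \<Longrightarrow> form n d (Q j)"
    "\<And>j s t. j \<le> e * d \<Longrightarrow> mp_eval (Q j) (P s t) = s ^ (e * d - j) * t ^ j" by metis
  obtain i where i: "i \<le> n" "x $ i \<noteq> 0" using x by (auto simp: pcone_iff)
  have "\<exists>j\<le>e * d. ev (Q j) x \<noteq> 0"
  proof (rule ccontr)
    assume z: "\<not> (\<exists>j\<le>e * d. ev (Q j) x \<noteq> 0)"
    let ?H = "Var i ^ d - (\<Sum>j\<le>e * d. Const (coeff (\<phi> i ^ d) j) * Q j)"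
    have "form n d ?H"
      using form_power[OF form_Var[OF i(1)], of d] Q(1)
      by (intro form_diff form_sum form_smult) auto
    moreover have "mp_eval ?H (P s t) = 0" for s t
    proof -
      have "P s t i ^ d = heval (e * d) (\<phi> i ^ d) s t" using heval_power[OF deg_\<phi>[OF i(1)]] by simp
      thus ?thesis using Q(2) by (simp add: mp_eval_simps heval_def mult.assoc del: One_nat_def)
    qed
    ultimately have "ev ?H x = 0" by (rule van)
    thus False using z i by (simp add: mp_eval_simps del: One_nat_def)
  qed
  then obtain j where j: "j \<le> e * d" "ev (Q j) x \<noteq> 0" by blast
  have "ev (Q 0) x \<noteq> 0 \<or> ev (Q (e * d)) x \<noteq> 0"
  proof (rule ccontr)
    assume z: "\<not> (ev (Q 0) x \<noteq> 0 \<or> ev (Q (e * d)) x \<noteq> 0)"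
    let ?H = "Q j ^ (e * d) - Q 0 ^ (e * d - j) * Q (e * d) ^ j"
    have "d * (e * d - j) + d * j = d * (e * d)" using j(1) by (simp add: distrib_left[symmetric])
    hence "form n (d * (e * d)) (Q 0 ^ (e * d - j) * Q (e * d) ^ j)"
      using form_mult[OF form_power[OF Q(1)[of 0], of "e * d - j"] form_power[OF Q(1)[of "e * d"], of j]] by simp
    hence "form n (d * (e * d)) ?H" using form_power[OF Q(1)[OF j(1)]] by (rule form_diff[rotated])
    moreover have "mp_eval ?H (P s t) = 0" for s t
      using Q(2)[OF j(1)] Q(2)[of 0] Q(2)[of "e * d"]
      by (simp add: mp_eval_simps power_mult_distrib power_mult[symmetric] mult.commute)
    ultimately have "ev ?H x = 0" by (rule van)
    hence "ev (Q j) x ^ (e * d) = 0" using z j ed by (auto simp: mp_eval_simps zero_power power_0_left)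
    thus False using j(2) by simp
  qed
  hence "x \<in> C"
  proof
    assume a: "ev (Q 0) x \<noteq> 0"
    have p: "s ^ (e * d) = s * s ^ (e * d - 1)" for s :: 'a using ed by (simp add: power_eq_if)
    show ?thesis
      by (rule on_curve_if_retraction[of x d "Q 0" "\<lambda>s t. s ^ (e * d - 1)" "Q 1"])
         (use x a Q[of 0] Q[of 1] ed p van in auto)
  next
    assume a: "ev (Q (e * d)) x \<noteq> 0"
    have p: "t ^ (e * d) = t * t ^ (e * d - 1)" "e * d - (e * d - 1) = 1" for t :: 'a
      using ed by (simp_all add: power_eq_if)
    show ?thesis
      by (rule on_curve_if_retraction[of x d "Q (e * d - 1)" "\<lambda>s t. t ^ (e * d - 1)" "Q (e * d)"])
         (use x a Q[of "e * d"] Q[of "e * d - 1"] p van in auto)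
  qed
  thus False using x(2) by simp
qed

text \<open>
  The retraction splits a point \<open>y\<close> near the curve as \<open>c + u\<close> with \<open>c\<close> on the curve and all \<open>u i\<close> in the
  ideal. In the Taylor expansion of \<open>F\<close> at \<open>c\<close> the terms of order zero and one vanish, so that \<open>F\<close> is a
  combination of products of two elements of the ideal.
\<close>

lemma flat_in_square:
  assumes F: "form n (g + d) F" "pullback \<phi> F = 0" "\<And>i. i \<le> n \<Longrightarrow> pullback \<phi> (pd i F) = 0"
    and G: "form n g G" and U: "zopen n U" "x \<in> U" "x \<in> C" "\<And>y. y \<in> U \<Longrightarrow> ev G y \<noteq> 0"
  obtains W where "zopen n W" "x \<in> W" "W \<subseteq> U" "(\<lambda>y\<in>W. ev F y / ev G y) \<in> ideal_sq n C d W"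
proof -
  obtain c0 s0 t0 where x: "x \<in> carrier_vec (n + 1)" "c0 \<noteq> 0" "(s0, t0) \<noteq> (0, 0)"
    "\<And>i. i \<le> n \<Longrightarrow> x $ i = c0 * P s0 t0 i" using U(3) unfolding curve_cone_def by blast
  obtain i0 where i0: "i0 \<le> n" "P s0 t0 i0 \<noteq> 0" using pt_nonzero[OF x(3)] .
  obtain Q R \<theta> where Q: "form n d Q" "\<And>s t. mp_eval Q (P s t) = s * \<theta> s t"
    and R: "form n d R" "\<And>s t. mp_eval R (P s t) = t * \<theta> s t" and \<theta>: "\<theta> s0 t0 \<noteq> 0"
    using inverse_forms[OF x(3)] by metis
  let ?Z = "retr Q R"
  have Z: "form n (d * e) (?Z i)" for i by (rule retr_form[OF Q(1) R(1)])
  have Zc: "ev (?Z i) y = c ^ (d * e) * (\<theta> s t ^ e * P s t i)"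
    if "y \<in> carrier_vec (n + 1)" "\<And>i. i \<le> n \<Longrightarrow> y $ i = c * P s t i" for y c s t i
    using ev_curve_point[OF Z that, of i] retr_pt[of Q \<theta> R, OF Q(2) R(2)] by simp
  \<comment> \<open>On \<open>W\<close> both \<open>y\<close> and its retraction can be scaled to have coordinate \<open>1\<close> at position \<open>i0\<close>.\<close>
  define W where "W = U \<inter> {y \<in> pcone n. ev (Var i0 * ?Z i0) y \<noteq> 0}"
  have W: "zopen n W" "W \<subseteq> U" unfolding W_def
    using zopen_Int[OF U(1) zopen_basic[OF form_mult[OF form_Var[OF i0(1)] Z[of i0]]]] by auto
  have Wc: "y \<in> carrier_vec (n + 1)" "y $ i0 \<noteq> 0" "ev (?Z i0) y \<noteq> 0" if "y \<in> W" for y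
    using that unfolding W_def by (auto simp: mp_eval_simps pcone_iff simp del: One_nat_def)
  have xW: "x \<in> W"
    using U(2) zopen_subset[OF U(1)] x i0 \<theta> Zc[of x c0 s0 t0 i0] unfolding W_def
    by (auto simp: mp_eval_simps simp del: One_nat_def)
  define c where "c i y = ev (?Z i) y / ev (?Z i0) y" for i y
  define u where "u i y = y $ i / y $ i0 - c i y" for i y
  define Reg where "Reg = {r. regf n 0 W r}"
  define I where "I = {r \<in> Reg. \<forall>y\<in>W \<inter> C. r y = 0}"
  have cR: "c i \<in> Reg" for i
    unfolding Reg_def c_def using Wc(3) by (auto intro!: regfI[of n "d * e" 0 "?Z i" "?Z i0"] Z)
  have xR: "(\<lambda>y. y $ i / y $ i0) \<in> Reg" if "i \<le> n" for i
    unfolding Reg_def using Wc(2) that i0(1)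
    by (auto intro!: regfI[of n 1 0 "Var i" "Var i0"] form_Var simp: mp_eval_simps simp del: One_nat_def)
  have constR: "(\<lambda>y. a) \<in> Reg" for a unfolding Reg_def by (simp add: regf_const)
  have addR: "p + q \<in> Reg" if "p \<in> Reg" "q \<in> Reg" for p q
    using that regf_add unfolding Reg_def by (auto simp: plus_fun_def)
  have multR: "p * q \<in> Reg" if "p \<in> Reg" "q \<in> Reg" for p q
    using that regf_mult[of n 0 W p 0 q] unfolding Reg_def by (auto simp: times_fun_def)
  have uI: "u i \<in> I" if i: "i \<le> n" for i
  proof -
    have "u i = (\<lambda>y. y $ i / y $ i0) + (\<lambda>y. -1) * c i" by (auto simp: u_def)
    hence "u i \<in> Reg" using addR[OF xR[OF i] multR[OF constR cR]] by simp
    moreover have "u i y = 0" if y: "y \<in> W" "y \<in> C" for y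
    proof -
      obtain b s t where b: "b \<noteq> 0" "\<And>i. i \<le> n \<Longrightarrow> y $ i = b * P s t i"
        using y(2) unfolding curve_cone_def by blast
      have Z1: "ev (?Z i) y = b ^ (d * e) * (\<theta> s t ^ e * P s t i)" for i
        by (rule Zc[OF Wc(1)[OF y(1)]]) (rule b(2))
      have "P s t i0 \<noteq> 0" "\<theta> s t \<noteq> 0" using Wc(3)[OF y(1)] Z1[of i0] e_pos by (auto simp: zero_power)
      thus ?thesis unfolding u_def c_def Z1 using b(1) b(2)[OF i] b(2)[OF i0(1)] by simp
    qed
    ultimately show ?thesis by (auto simp: I_def)
  qed
  have hK: "comm_ring_hom (\<lambda>a::'a. (\<lambda>y::'a vec. a))"
    by unfold_locales (auto simp: plus_fun_def times_fun_def zero_fun_def one_fun_def)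
  have gv: "geval (\<lambda>a y. a) X H y = mp_eval H (\<lambda>i. X i y)" for X :: "nat \<Rightarrow> 'a vec \<Rightarrow> 'a" and H y
    using mp_in_UNIV[of H]
    by (induction H rule: mp_induct) (simp_all add: geval_simps[OF hK] mp_eval_simps)
  have "\<exists>\<rho>. (\<forall>i\<in>{..n}. \<rho> i \<in> I) \<and> geval (\<lambda>a y. a) (\<lambda>i. c i + u i) F =
      geval (\<lambda>a y. a) c F + (\<Sum>i\<in>{..n}. u i * (geval (\<lambda>a y. a) c (pd i F) + \<rho> i))"
  proof (rule taylor_mod_ideal[OF hK _ form_mp_in[OF F(1)], where R = Reg])
    show "I \<subseteq> Reg" by (auto simp: I_def)
    show "0 \<in> I" using constR[of 0] by (auto simp: I_def zero_fun_def)
  qed (use constR addR multR cR uI in \<open>auto simp: I_def\<close>)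
  then obtain \<rho> where \<rho>: "\<And>i. i \<le> n \<Longrightarrow> \<rho> i \<in> I"
    and T: "geval (\<lambda>a y. a) (\<lambda>i. c i + u i) F =
      geval (\<lambda>a y. a) c F + (\<Sum>i\<in>{..n}. u i * (geval (\<lambda>a y. a) c (pd i F) + \<rho> i))" by auto
  have van: "mp_eval H (\<lambda>i. c i y) = 0" if "form n k H" "pullback \<phi> H = 0" "y \<in> W" for k H y
  proof -
    have "mp_eval H (\<lambda>i. c i y) = mp_eval H (\<lambda>i. (1 / ev (?Z i0) y) * P (ev Q y) (ev R y) i)"
      by (simp add: c_def retr_eval)
    also have "\<dots> = (1 / ev (?Z i0) y) ^ k * mp_eval H (P (ev Q y) (ev R y))" by (rule form_scale[OF that(1)])
    also have "mp_eval H (P (ev Q y) (ev R y)) = 0"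
      using pullback_eq_0_iff[OF that(1), of \<phi> e] deg_\<phi> that(2) by simp
    finally show ?thesis by simp
  qed
  have key: "ev F y / ev G y = (\<Sum>i<n + 1. u i y * (\<rho> i y * (y $ i0 ^ (g + d) / ev G y)))" if y: "y \<in> W" for y
  proof -
    have "(1 / y $ i0) ^ (g + d) * ev F y = mp_eval F (\<lambda>i. (1 / y $ i0) * y $ i)"
      by (rule form_scale[OF F(1), symmetric])
    also have "\<dots> = geval (\<lambda>a y. a) (\<lambda>i. c i + u i) F y" by (simp add: gv u_def)
    also have "\<dots> = (\<Sum>i\<le>n. u i y * \<rho> i y)"
      unfolding T plus_fun_apply gv van[OF F(1,2) y]
      using van[OF form_pd[OF F(1)] F(3) y] by (simp add: sum_apply gv)
    finally have "ev F y = y $ i0 ^ (g + d) * (\<Sum>i\<le>n. u i y * \<rho> i y)"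
      using Wc(2)[OF y] by (simp add: field_simps)
    thus ?thesis by (simp add: sum_distrib_left sum_distrib_right sum_divide_distrib ac_simps lessThan_Suc_atMost)
  qed
  have "(\<lambda>y\<in>W. ev F y / ev G y) \<in> ideal_sq n C d W"
    unfolding ideal_sq_def
  proof (intro CollectI conjI ballI)
    fix z assume z: "z \<in> W"
    let ?b = "\<lambda>i y. \<rho> i y * (y $ i0 ^ (g + d) / ev G y)"
    have "(\<lambda>y\<in>W. u i y) \<in> ideal_twist n C 0 W" "(\<lambda>y\<in>W. ?b i y) \<in> ideal_twist n C d W" if "i < n + 1" for i
    proof -
      have i: "i \<le> n" using that by simp
      show "(\<lambda>y\<in>W. u i y) \<in> ideal_twist n C 0 W"
        using uI[OF i] by (intro regf_ideal_twist W) (auto simp: I_def Reg_def)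
      have "regf n d W (\<lambda>y. y $ i0 ^ (g + d) / ev G y)"
        using form_power[OF form_Var[OF i0(1)], of "g + d"] G U(4) W(2)
        by (intro regfI[of n g d "Var i0 ^ (g + d)" G]) (auto simp: mp_eval_simps simp del: One_nat_def)
      hence "regf n (0 + d) W (?b i)" using \<rho>[OF i] by (intro regf_mult) (auto simp: I_def Reg_def)
      thus "(\<lambda>y\<in>W. ?b i y) \<in> ideal_twist n C d W"
        using \<rho>[OF i] by (intro regf_ideal_twist W) (auto simp: I_def)
    qed
    thus "\<exists>W' (k::nat) a b. zopen n W' \<and> z \<in> W' \<and> W' \<subseteq> W \<and>
      (\<forall>i<k. a i \<in> ideal_twist n C 0 W' \<and> b i \<in> ideal_twist n C d W') \<and>
      (\<forall>y\<in>W'. (\<lambda>y\<in>W. ev F y / ev G y) y = (\<Sum>i<k. a i y * b i y))"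
      using W(1) z key
      by (intro exI[of _ W] exI[of _ "n + 1"] exI[of _ "\<lambda>i. \<lambda>y\<in>W. u i y"] exI[of _ "\<lambda>i. \<lambda>y\<in>W. ?b i y"]) auto
  qed auto
  thus ?thesis using that W xW by blast
qed

end

section \<open>First-order jets of sections of the ideal sheaf\<close>

text \<open>
  The restriction of \<open>F\<close> to the line through \<open>z\<close> in direction \<open>i\<close> is a univariate polynomial with infinitely many
  zeros; its derivative at \<open>z\<close> is the partial derivative.
\<close>

lemma pd_vanishing:
  fixes F :: "(nat, 'a::alg_closed_field) mp"
  assumes F: "mp_in {..n} F" "\<And>z. z \<in> carrier_vec (n + 1) \<Longrightarrow> ev F z = 0"
    and z: "z \<in> carrier_vec (n + 1)" and i: "i \<le> n"
  shows "ev (pd i F) z = 0"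
proof -
  let ?X = "\<lambda>j. [:z $ j, if j = i then 1 else 0:]"
  have "poly (pullback ?X F) \<epsilon> = 0" for \<epsilon>
  proof -
    have "poly (pullback ?X F) \<epsilon> = ev F (vec (n + 1) (\<lambda>j. z $ j + (if j = i then \<epsilon> else 0)))"
      unfolding poly_geval mp_eval_geval by (intro geval_cong[OF F(1)]) auto
    thus ?thesis using F(2) by simp
  qed
  hence "pullback ?X F = 0" by (rule poly_all_0_imp_0)
  hence "0 = poly (\<Sum>j\<in>{..n}. pullback ?X (pd j F) * pderiv (?X j)) 0"
    using pderiv_geval[OF F(1), of ?X] by simp
  also have "\<dots> = (\<Sum>j\<in>{..n}. if j = i then ev (pd i F) z else 0)"
    unfolding poly_sum by (intro sum.cong refl) (auto simp: poly_geval pderiv_pCons)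
  also have "\<dots> = ev (pd i F) z" using i by simp
  finally show ?thesis by simp
qed

text \<open>
  The first-order jet at \<open>y\<close> of a function that vanishes at \<open>y\<close>. The function is represented by \<open>F / G\<close> on the
  neighbourhood where \<open>H\<close> does not vanish; since \<open>F\<close> vanishes at \<open>y\<close>, the gradient of \<open>F / G\<close> there is that of \<open>F\<close>
  divided by \<open>G\<close>.
\<close>

definition jet :: "nat \<Rightarrow> 'a::field vec \<Rightarrow> ('a vec \<Rightarrow> 'a) \<Rightarrow> (nat \<Rightarrow> 'a) \<Rightarrow> bool" where
  "jet n y f v \<longleftrightarrow> (\<exists>F G H. mp_in {..n} F \<and> mp_in {..n} G \<and> mp_in {..n} H \<and> ev H y \<noteq> 0 \<and> ev F y = 0 \<and>
     (\<forall>z\<in>carrier_vec (n + 1). ev H z \<noteq> 0 \<longrightarrow> ev G z \<noteq> 0 \<and> f z = ev F z / ev G z) \<and>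
     (\<forall>i\<le>n. ev (pd i F) y = v i * ev G y))"

text \<open>
  Cross-multiplying two representations, together with the polynomials that cut out their domains, gives a
  polynomial that vanishes everywhere, and so does its gradient.
\<close>

lemma jet_unique:
  fixes y :: "'a::alg_closed_field vec"
  assumes y: "y \<in> carrier_vec (n + 1)" and v: "jet n y f v" and w: "jet n y f w" and i: "i \<le> n"
  shows "v i = w i"
proof -
  obtain F G H where 1: "mp_in {..n} F" "mp_in {..n} G" "mp_in {..n} H" "ev H y \<noteq> 0" "ev F y = 0"
    "\<forall>z\<in>carrier_vec (n + 1). ev H z \<noteq> 0 \<longrightarrow> ev G z \<noteq> 0 \<and> f z = ev F z / ev G z"
    "\<forall>i\<le>n. ev (pd i F) y = v i * ev G y" using v unfolding jet_def by blast
  obtain F' G' H' where 2: "mp_in {..n} F'" "mp_in {..n} G'" "mp_in {..n} H'" "ev H' y \<noteq> 0" "ev F' y = 0"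
    "\<forall>z\<in>carrier_vec (n + 1). ev H' z \<noteq> 0 \<longrightarrow> ev G' z \<noteq> 0 \<and> f z = ev F' z / ev G' z"
    "\<forall>i\<le>n. ev (pd i F') y = w i * ev G' y" using w unfolding jet_def by blast
  let ?T = "(F * G' + Const (-1) * (F' * G)) * (H * H')"
  have "mp_in {..n} ?T" using 1 2 by (intro mp_in_mult mp_in_add mp_in_Const)
  moreover have "ev ?T z = 0" if z: "z \<in> carrier_vec (n + 1)" for z
  proof (cases "ev H z = 0 \<or> ev H' z = 0")
    case False
    hence "ev G z \<noteq> 0" "ev G' z \<noteq> 0" "ev F z / ev G z = ev F' z / ev G' z"
      using 1(6) 2(6) z by (auto dest: bspec)
    thus ?thesis by (simp add: mp_eval_simps field_simps)
  qed (auto simp: mp_eval_simps)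
  ultimately have "ev (pd i ?T) y = 0" using y i by (rule pd_vanishing)
  hence "(v i - w i) * (ev G y * ev G' y * (ev H y * ev H' y)) = 0"
    using 1(5,7) 2(5,7) i by (simp add: pd_mult pd_add mp_eval_simps algebra_simps)
  thus ?thesis using 1(4,6) 2(4,6) y by auto
qed

lemma jet_cong:
  assumes "jet n y f v" "zopen n W" "y \<in> W" "\<And>z. z \<in> W \<Longrightarrow> f z = f' z"
  shows "jet n y f' v"
proof -
  obtain F G H where 1: "mp_in {..n} F" "mp_in {..n} G" "mp_in {..n} H" "ev H y \<noteq> 0" "ev F y = 0"
    "\<forall>z\<in>carrier_vec (n + 1). ev H z \<noteq> 0 \<longrightarrow> ev G z \<noteq> 0 \<and> f z = ev F z / ev G z"
    "\<forall>i\<le>n. ev (pd i F) y = v i * ev G y" using assms(1) unfolding jet_def by blast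
  obtain k K where K: "form n k K" "ev K y \<noteq> 0" "\<And>z. z \<in> carrier_vec (n + 1) \<Longrightarrow> ev K z \<noteq> 0 \<Longrightarrow> z \<in> W"
    by (rule zopen_nbhd[OF assms(2,3)]) blast
  show ?thesis unfolding jet_def
    using 1 K(2,3) assms(4) form_mp_in[OF K(1)]
    by (intro exI[of _ F] exI[of _ G] exI[of _ "H * K"]) (auto simp: mp_eval_simps intro!: mp_in_mult)
qed

lemma jet_add:
  assumes "y \<in> carrier_vec (n + 1)" "jet n y f v" "jet n y f' v'"
  shows "jet n y (\<lambda>z. f z + f' z) (\<lambda>i. v i + v' i)"
proof -
  obtain F G H where 1: "mp_in {..n} F" "mp_in {..n} G" "mp_in {..n} H" "ev H y \<noteq> 0" "ev F y = 0"
    "\<forall>z\<in>carrier_vec (n + 1). ev H z \<noteq> 0 \<longrightarrow> ev G z \<noteq> 0 \<and> f z = ev F z / ev G z"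
    "\<forall>i\<le>n. ev (pd i F) y = v i * ev G y" using assms(2) unfolding jet_def by blast
  obtain F' G' H' where 2: "mp_in {..n} F'" "mp_in {..n} G'" "mp_in {..n} H'" "ev H' y \<noteq> 0" "ev F' y = 0"
    "\<forall>z\<in>carrier_vec (n + 1). ev H' z \<noteq> 0 \<longrightarrow> ev G' z \<noteq> 0 \<and> f' z = ev F' z / ev G' z"
    "\<forall>i\<le>n. ev (pd i F') y = v' i * ev G' y" using assms(3) unfolding jet_def by blast
  have "mp_in {..n} (F * G' + F' * G)" "mp_in {..n} (G * G')" "mp_in {..n} (H * H')"
    using 1 2 by (auto intro!: mp_in_mult mp_in_add)
  moreover have "\<forall>z\<in>carrier_vec (n + 1). ev (H * H') z \<noteq> 0 \<longrightarrow>
      ev (G * G') z \<noteq> 0 \<and> f z + f' z = ev (F * G' + F' * G) z / ev (G * G') z"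
    using 1(6) 2(6) by (auto simp: mp_eval_simps field_simps)
  moreover have "\<forall>i\<le>n. ev (pd i (F * G' + F' * G)) y = (v i + v' i) * ev (G * G') y"
    using 1(5,7) 2(5,7) by (simp add: pd_mult pd_add mp_eval_simps algebra_simps)
  ultimately show ?thesis unfolding jet_def using 1(4,5) 2(4,5)
    by (intro exI[of _ "F * G' + F' * G"] exI[of _ "G * G'"] exI[of _ "H * H'"]) (auto simp: mp_eval_simps)
qed

text \<open>Each term of the product rule contains one of the two vanishing values.\<close>

lemma jet_mult:
  assumes "y \<in> carrier_vec (n + 1)" "jet n y f v" "jet n y f' v'"
  shows "jet n y (\<lambda>z. f z * f' z) (\<lambda>i. 0)"
proof -
  obtain F G H where 1: "mp_in {..n} F" "mp_in {..n} G" "mp_in {..n} H" "ev H y \<noteq> 0" "ev F y = 0"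
    "\<forall>z\<in>carrier_vec (n + 1). ev H z \<noteq> 0 \<longrightarrow> ev G z \<noteq> 0 \<and> f z = ev F z / ev G z"
    using assms(2) unfolding jet_def by blast
  obtain F' G' H' where 2: "mp_in {..n} F'" "mp_in {..n} G'" "mp_in {..n} H'" "ev H' y \<noteq> 0" "ev F' y = 0"
    "\<forall>z\<in>carrier_vec (n + 1). ev H' z \<noteq> 0 \<longrightarrow> ev G' z \<noteq> 0 \<and> f' z = ev F' z / ev G' z"
    using assms(3) unfolding jet_def by blast
  have "mp_in {..n} (F * F')" "mp_in {..n} (G * G')" "mp_in {..n} (H * H')"
    using 1 2 by (auto intro!: mp_in_mult)
  thus ?thesis unfolding jet_def using 1(4,5,6) 2(4,5,6)
    by (intro exI[of _ "F * F'"] exI[of _ "G * G'"] exI[of _ "H * H'"]) (auto simp: mp_eval_simps pd_mult)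
qed

lemma jet_0: "jet n y (\<lambda>z. 0) (\<lambda>i. 0)"
  unfolding jet_def
  by (intro exI[of _ 0] exI[of _ 1] exI[of _ 1])
     (auto simp: mp_eval_simps single_one[symmetric] simp del: single_one intro: mp_in_Const, simp add: mp_in_def)

lemma local_representation:
  assumes "zopen n U" "s \<in> ideal_twist n C d U" "x \<in> U"
  obtains g k F G H where "form n (g + d) F" "form n g G" "form n k H" "ev H x \<noteq> 0"
    "\<And>z. z \<in> carrier_vec (n + 1) \<Longrightarrow> ev H z \<noteq> 0 \<Longrightarrow> z \<in> U \<and> ev G z \<noteq> 0 \<and> s z = ev F z / ev G z"
proof -
  obtain W F G g where W: "zopen n W" "x \<in> W" "W \<subseteq> U" "form n (g + d) F" "form n g G"
    "\<forall>y\<in>W. ev G y \<noteq> 0 \<and> s y = ev F y / ev G y"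
    using assms unfolding ideal_twist_def twist_def by blast
  obtain k H where "form n k H" "ev H x \<noteq> 0" "\<And>z. z \<in> carrier_vec (n + 1) \<Longrightarrow> ev H z \<noteq> 0 \<Longrightarrow> z \<in> W"
    by (rule zopen_nbhd[OF W(1,2)]) blast
  thus ?thesis using that[of g F G k H] W(3-6) by blast
qed

lemma jet_representation:
  assumes "form n l F" "form n g G" "form n k H" "ev H y \<noteq> 0" "y \<in> carrier_vec (n + 1)" "s y = 0"
    "\<And>z. z \<in> carrier_vec (n + 1) \<Longrightarrow> ev H z \<noteq> 0 \<Longrightarrow> z \<in> U \<and> ev G z \<noteq> 0 \<and> s z = ev F z / ev G z"
  shows "jet n y s (\<lambda>i. ev (pd i F) y / ev G y)"
proof -
  have "ev F y = 0" "ev G y \<noteq> 0" using assms(4-7) by (metis divide_eq_0_iff)+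
  thus ?thesis unfolding jet_def using assms by (intro exI[of _ F] exI[of _ G] exI[of _ H]) (auto simp: form_mp_in)
qed

lemma jet_ideal_twist:
  assumes "zopen n U" "s \<in> ideal_twist n C d U" "y \<in> U" "y \<in> C"
  shows "\<exists>v. jet n y s v"
proof -
  obtain g k F G H where *: "form n (g + d) F" "form n g G" "form n k H" "ev H y \<noteq> 0"
    "\<And>z. z \<in> carrier_vec (n + 1) \<Longrightarrow> ev H z \<noteq> 0 \<Longrightarrow> z \<in> U \<and> ev G z \<noteq> 0 \<and> s z = ev F z / ev G z"
    by (rule local_representation[OF assms(1-3)]) blast
  have "y \<in> carrier_vec (n + 1)" "s y = 0"
    using assms zopen_subset[OF assms(1)] by (auto simp: pcone_iff ideal_twist_def)
  from jet_representation[OF *(1-4) this *(5)] show ?thesis by blast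
qed

lemma jet_ideal_sq:
  assumes "s \<in> ideal_sq n C d U" "y \<in> U" "y \<in> C"
  shows "jet n y s (\<lambda>i. 0)"
proof -
  obtain W k a b where *: "zopen n W" "y \<in> W" "W \<subseteq> U"
    "\<forall>i<k. a i \<in> ideal_twist n C 0 W \<and> b i \<in> ideal_twist n C d W" "\<forall>y\<in>W. s y = (\<Sum>i<(k::nat). a i y * b i y)"
    using assms unfolding ideal_sq_def by blast
  have y: "y \<in> carrier_vec (n + 1)" using zopen_subset[OF *(1)] *(2) by (auto simp: pcone_iff)
  have "l \<le> k \<Longrightarrow> jet n y (\<lambda>z. \<Sum>i<l. a i z * b i z) (\<lambda>i. 0)" for l
  proof (induction l)
    case 0
    show ?case using jet_0 by simp
  next
    case (Suc l)
    hence "a l \<in> ideal_twist n C 0 W" "b l \<in> ideal_twist n C d W" using *(4) by auto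
    then obtain v w where "jet n y (a l) v" "jet n y (b l) w"
      using jet_ideal_twist[OF *(1) _ *(2) assms(3)] by blast
    from jet_add[OF y _ jet_mult[OF y this]] Suc show ?case by fastforce
  qed
  from jet_cong[OF this[OF order_refl] *(1,2)] *(5) show ?thesis by simp
qed

section \<open>Gluing binary forms\<close>

text \<open>
  A function that is locally a quotient of binary forms is globally a fraction on a dense open set.
  A fraction with denominator of least degree has no pole, because at a root of its denominator it
  agrees with a local quotient that is defined there, which allows to cancel a linear factor.
\<close>

lemma glue_binary_forms:
  fixes \<gamma> :: "'a::alg_closed_field \<Rightarrow> 'a \<Rightarrow> 'a"
  assumes loc: "\<And>s0 t0. (s0, t0) \<noteq> (0, 0) \<Longrightarrow> \<exists>k l N M h. degree N \<le> k + D \<and> degree M \<le> k \<and> degree h \<le> l \<and>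
     heval l h s0 t0 \<noteq> 0 \<and>
     (\<forall>s t. heval l h s t \<noteq> 0 \<longrightarrow> heval k M s t \<noteq> 0 \<and> \<gamma> s t = heval (k + D) N s t / heval k M s t)"
  obtains q where "degree q \<le> D" "\<And>s t. (s, t) \<noteq> (0, 0) \<Longrightarrow> \<gamma> s t = heval D q s t"
proof -
  define good where "good N M \<longleftrightarrow> M \<noteq> 0 \<and> (\<exists>h. h \<noteq> 0 \<and> (\<forall>t. poly h t \<noteq> 0 \<longrightarrow> \<gamma> 1 t * poly M t = poly N t))"
    for N M
  have cross: "N * M' = N' * M" if good: "good N M" "good N' M'" for N M N' M'
  proof -
    obtain h h' where h: "h \<noteq> 0" "\<forall>t. poly h t \<noteq> 0 \<longrightarrow> \<gamma> 1 t * poly M t = poly N t"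
      "h' \<noteq> 0" "\<forall>t. poly h' t \<noteq> 0 \<longrightarrow> \<gamma> 1 t * poly M' t = poly N' t" using good unfolding good_def by blast
    have "poly ((N * M' - N' * M) * (h * h')) t = 0" for t
    proof (cases "poly h t = 0 \<or> poly h' t = 0")
      case False
      hence "poly N t = \<gamma> 1 t * poly M t" "poly N' t = \<gamma> 1 t * poly M' t" using h by auto
      thus ?thesis by simp
    qed auto
    hence "(N * M' - N' * M) * (h * h') = 0" by (rule poly_all_0_imp_0)
    thus ?thesis using h by simp
  qed
  have loc_good: "\<exists>k l N M h. degree N \<le> k + D \<and> degree M \<le> k \<and> heval k M s0 t0 \<noteq> 0 \<and>
     \<gamma> s0 t0 = heval (k + D) N s0 t0 / heval k M s0 t0 \<and> good N M" if "(s0, t0) \<noteq> (0, 0)" for s0 t0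
  proof -
    note st = that
    obtain k l N M h where *: "degree N \<le> k + D" "degree M \<le> k" "degree h \<le> l" "heval l h s0 t0 \<noteq> 0"
      "\<And>s t. heval l h s t \<noteq> 0 \<Longrightarrow> heval k M s t \<noteq> 0 \<and> \<gamma> s t = heval (k + D) N s t / heval k M s t"
      using loc[OF st] by blast
    have "M \<noteq> 0" "h \<noteq> 0" using *(4) *(5)[OF *(4)] by auto
    moreover have "\<gamma> 1 t * poly M t = poly N t" if "poly h t \<noteq> 0" for t
      using *(5)[of 1 t] that *(1-3) by (simp add: heval_1_left)
    ultimately have "good N M" unfolding good_def by blast
    thus ?thesis using * by blast
  qed
  have "\<exists>M N. good N M" using loc_good[of 1 0] by auto
  then obtain M N where MN: "good N M" "\<And>M' N'. good N' M' \<Longrightarrow> degree M \<le> degree M'"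
    using ex_has_least_nat[of "\<lambda>M. \<exists>N. good N M" _ degree] by metis
  have "poly M t0 \<noteq> 0" for t0
  proof
    assume r: "poly M t0 = 0"
    obtain k N1 M1 where 1: "degree M1 \<le> k" "heval k M1 1 t0 \<noteq> 0" "good N1 M1" using loc_good[of 1 t0] by auto
    have M1: "poly M1 t0 \<noteq> 0" using 1 by (simp add: heval_1_left)
    have "N * M1 = N1 * M" by (rule cross[OF MN(1) 1(3)])
    hence "poly N t0 * poly M1 t0 = 0" using r by (metis mult_zero_right poly_mult)
    hence "poly N t0 = 0" using M1 by simp
    hence "[:-t0, 1:] dvd N" "[:-t0, 1:] dvd M" using r by (simp_all add: poly_eq_0_iff_dvd)
    then obtain N' M' where f: "N = [:-t0, 1:] * N'" "M = [:-t0, 1:] * M'" by (elim dvdE) blast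
    obtain h where h: "M \<noteq> 0" "h \<noteq> 0" "\<And>t. poly h t \<noteq> 0 \<Longrightarrow> \<gamma> 1 t * poly M t = poly N t"
      using MN(1) unfolding good_def by blast
    have "M' \<noteq> 0" using h(1) f by auto
    have "good N' M'" unfolding good_def
    proof (intro conjI exI[of _ "h * [:-t0, 1:]"] allI impI)
      have "[:-t0, 1:] \<noteq> 0" by simp
      thus "M' \<noteq> 0" "h * [:-t0, 1:] \<noteq> 0" using \<open>M' \<noteq> 0\<close> h(2) by (simp_all only: mult_eq_0_iff) simp_all
      fix t assume a: "poly (h * [:-t0, 1:]) t \<noteq> 0"
      hence "(t - t0) * (\<gamma> 1 t * poly M' t) = (t - t0) * poly N' t"
        using h(3)[of t] f by (simp add: algebra_simps)
      thus "\<gamma> 1 t * poly M' t = poly N' t" using a by auto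
    qed
    hence "degree M \<le> degree M'" by (rule MN(2))
    moreover have "degree M = Suc (degree M')"
      unfolding f(2) using \<open>M' \<noteq> 0\<close> by (subst degree_mult_eq) auto
    ultimately show False by simp
  qed
  hence "degree M = 0" using alg_closed_imp_poly_has_root[of M] by auto
  then obtain m where m: "M = [:m:]" by (rule degree_eq_zeroE)
  hence "m \<noteq> 0" using MN(1) by (auto simp: good_def)
  define q where "q = Polynomial.smult (1 / m) N"
  \<comment> \<open>The minimal denominator is constant, so every local quotient equals the polynomial \<open>q\<close>.\<close>
  have fac: "N1 = M1 * q" if "good N1 M1" for N1 M1
    using cross[OF MN(1) that] \<open>m \<noteq> 0\<close> by (simp add: m q_def mult.commute)
  have "degree q \<le> D"
  proof (cases "q = 0")
    case False
    obtain k N1 M1 where 1: "degree N1 \<le> k + D" "degree M1 \<le> k" "heval k M1 0 1 \<noteq> 0" "good N1 M1"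
      using loc_good[of 0 1] by auto
    have "coeff M1 k \<noteq> 0" using 1(3) by (simp add: heval_0_left)
    hence "degree M1 = k" "M1 \<noteq> 0" using 1(2) le_degree[of M1 k] by auto
    thus ?thesis using 1(1) False unfolding fac[OF 1(4)] by (simp add: degree_mult_eq)
  qed simp
  moreover have "\<gamma> s t = heval D q s t" if "(s, t) \<noteq> (0, 0)" for s t
  proof -
    note st = that
    obtain k N1 M1 where 1: "degree M1 \<le> k" "heval k M1 s t \<noteq> 0" "good N1 M1"
      "\<gamma> s t = heval (k + D) N1 s t / heval k M1 s t" using loc_good[OF st] by auto
    show ?thesis using 1(2) unfolding 1(4) fac[OF 1(3)] heval_mult[OF 1(1) \<open>degree q \<le> D\<close>] by simp
  qed
  ultimately show ?thesis by (rule that)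
qed

section \<open>From exactness on jets to surjectivity on the conormal sheaf\<close>

context parametrized_curve
begin

text \<open>
  Used to compare the global section with a local one near a point that is not on the curve.
\<close>

lemma ideal_sq_diff_off_curve:
  assumes W: "zopen n W" "W \<inter> Z = {}" and s: "(\<lambda>y\<in>W. s y) \<in> twist n d W" "(\<lambda>y\<in>W. s' y) \<in> twist n d W"
  shows "(\<lambda>y\<in>W. s y - s' y) \<in> ideal_sq n Z d W"
proof -
  have "(\<lambda>y\<in>W. (\<lambda>y\<in>W. s y) y + (\<lambda>y\<in>W. - (\<lambda>y\<in>W. s' y) y) y) \<in> ideal_sq n Z d W"
    using W s by (intro ideal_sq_add ideal_sq_uminus ideal_sq_off_curve)
  moreover have "(\<lambda>y\<in>W. (\<lambda>y\<in>W. s y) y + (\<lambda>y\<in>W. - (\<lambda>y\<in>W. s' y) y) y) = (\<lambda>y\<in>W. s y - s' y)"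
    by (auto simp: fun_eq_iff restrict_def)
  ultimately show ?thesis by (simp only:)
qed

lemma conormal_map_well_defined:
  "s \<in> H0_ideal n Z d \<Longrightarrow> conormal_map n Z d s \<in> H0_conormal n Z d"
  unfolding conormal_map_def H0_conormal_def H0_ideal_def using zopen_pcone[of n]
  by (auto intro!: exI[of _ "pcone n"] exI[of _ s])

text \<open>
  The gradients of local representatives of a section \<open>\<sigma>\<close> of the conormal sheaf glue to a vector \<open>q\<close> of binary
  forms satisfying the two linear relations. Exactness gives a form with gradient \<open>q\<close> that vanishes on the curve; its
  difference from any local representative is flat along the curve and hence in the square of the ideal.
\<close>

theorem conormal_map_surj_if_exact:
  assumes exact: "conormal_exact n e d \<phi>"
  shows "conormal_map_surj n C d"
proof -
  have "\<sigma> \<in> conormal_map n C d ` H0_ideal n C d" if \<sigma>: "\<sigma> \<in> H0_conormal n C d" for \<sigma>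
  proof -
    have "\<forall>x\<in>pcone n. \<exists>U s. zopen n U \<and> x \<in> U \<and> s \<in> ideal_twist n C d U \<and>
        (\<forall>y\<in>U. \<sigma> y = conormal_germ n C d y U s)" using \<sigma> unfolding H0_conormal_def by blast
    then obtain U s where Us: "\<And>x. x \<in> pcone n \<Longrightarrow> zopen n (U x)" "\<And>x. x \<in> pcone n \<Longrightarrow> x \<in> U x"
      "\<And>x. x \<in> pcone n \<Longrightarrow> s x \<in> ideal_twist n C d (U x)"
      "\<And>x y. x \<in> pcone n \<Longrightarrow> y \<in> U x \<Longrightarrow> \<sigma> y = conormal_germ n C d y (U x) (s x)" by metis
    \<comment> \<open>Near \<open>x\<close> the section \<open>\<sigma>\<close> is represented by \<open>F x / G x\<close>, on the open set where \<open>H x\<close> does not vanish.\<close>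
    define rep where "rep x = (\<lambda>(g, k, F, G, H). form n (g + d) F \<and> form n g G \<and> form n k H \<and> ev H x \<noteq> 0 \<and>
        (\<forall>z\<in>carrier_vec (n + 1). ev H z \<noteq> 0 \<longrightarrow> z \<in> U x \<and> ev G z \<noteq> 0 \<and> s x z = ev F z / ev G z))" for x
    have "\<forall>x\<in>pcone n. \<exists>r. rep x r"
    proof
      fix x :: "'a vec" assume x: "x \<in> pcone n"
      obtain g k F G H where "form n (g + d) F" "form n g G" "form n k H" "ev H x \<noteq> 0"
        "\<And>z. z \<in> carrier_vec (n + 1) \<Longrightarrow> ev H z \<noteq> 0 \<Longrightarrow> z \<in> U x \<and> ev G z \<noteq> 0 \<and> s x z = ev F z / ev G z"
        by (rule local_representation[OF Us(1)[OF x] Us(3)[OF x] Us(2)[OF x]]) blast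
      hence "rep x (g, k, F, G, H)" by (auto simp: rep_def)
      thus "\<exists>r. rep x r" by blast
    qed
    then obtain r where r: "\<forall>x\<in>pcone n. rep x (r x)" by (rule bchoice[THEN exE])
    define g where "g x = fst (r x)" for x
    define k where "k x = fst (snd (r x))" for x
    define F where "F x = fst (snd (snd (r x)))" for x
    define G where "G x = fst (snd (snd (snd (r x))))" for x
    define H where "H x = snd (snd (snd (snd (r x))))" for x
    have rep: "rep x (g x, k x, F x, G x, H x)" if "x \<in> pcone n" for x
      using r that by (simp add: g_def k_def F_def G_def H_def)
    have loc: "form n (g x + d) (F x)" "form n (g x) (G x)" "form n (k x) (H x)" "ev (H x) x \<noteq> 0"
      if "x \<in> pcone n" for x
      using rep[OF that] by (auto simp: rep_def)
    have loc5: "z \<in> U x \<and> ev (G x) z \<noteq> 0 \<and> s x z = ev (F x) z / ev (G x) z"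
      if "x \<in> pcone n" "z \<in> carrier_vec (n + 1)" "ev (H x) z \<noteq> 0" for x z
      using rep[OF that(1)] that(2,3) by (auto simp: rep_def)
    define cp where "cp s t = vec (n + 1) (P s t)" for s t
    have evcp: "ev K (cp s t) = mp_eval K (P s t)" if "form n l K" for K l s t
      unfolding mp_eval_geval cp_def by (intro geval_cong[OF form_mp_in[OF that]]) auto
    have cp_carrier: "cp s t \<in> carrier_vec (n + 1)" for s t by (simp add: cp_def)
    have cp: "cp s t \<in> pcone n" "cp s t \<in> C" if "(s, t) \<noteq> (0, 0)" for s t
    proof -
      note st = that
      obtain i where "i \<le> n" "P s t i \<noteq> 0" using pt_nonzero[OF st] .
      thus "cp s t \<in> pcone n" by (auto simp: pcone_iff cp_def)
      have "(1::'a) \<noteq> 0 \<and> (s, t) \<noteq> (0, 0) \<and> (\<forall>i\<le>n. cp s t $ i = 1 * P s t i)"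
        using st by (simp add: cp_def)
      thus "cp s t \<in> C" using cp_carrier unfolding curve_cone_def by blast
    qed
    have sC: "s x y = 0" if "x \<in> pcone n" "y \<in> C" "y \<in> carrier_vec (n + 1)" "ev (H x) y \<noteq> 0" for x y
      using Us(3)[OF that(1)] loc5[OF that(1,3,4)] that(2) by (auto simp: ideal_twist_def)
    have jets: "jet n y (s x) (\<lambda>i. ev (pd i (F x)) y / ev (G x) y)"
      if "x \<in> pcone n" "y \<in> C" "y \<in> carrier_vec (n + 1)" "ev (H x) y \<noteq> 0" for x y
      by (rule jet_representation[where U = "U x" and s = "s x", OF loc(1-3)[OF that(1)] that(4,3) sC[OF that]])
         (rule loc5[OF that(1)])
    \<comment> \<open>On the curve the gradient does not depend on the local section chosen.\<close>
    have compare: "ev (pd i (F x)) y / ev (G x) y = ev (pd i (F y)) y / ev (G y) y"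
      if "x \<in> pcone n" "y \<in> C" "y \<in> pcone n" "ev (H x) y \<noteq> 0" "i \<le> n" for x y i
    proof -
      have y: "y \<in> carrier_vec (n + 1)" "y \<in> U x" using that loc5[OF that(1) _ that(4)] by (auto simp: pcone_iff)
      have "conormal_germ n C d y (U x) (s x) = conormal_germ n C d y (U y) (s y)"
        using Us(4)[OF that(1) y(2)] Us(4)[OF that(3) Us(2)[OF that(3)]] by simp
      from germ_eqD[OF this Us(1-3)[OF that(3)]]
      obtain W where W: "zopen n W" "y \<in> W" "(\<lambda>z\<in>W. s x z - s y z) \<in> ideal_sq n C d W" by blast
      have "jet n y (\<lambda>z\<in>W. s x z - s y z) (\<lambda>i. 0)" by (rule jet_ideal_sq[OF W(3,2) that(2)])
      from jet_add[OF y(1) this jets[OF that(3,2) y(1) loc(4)[OF that(3)]]]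
      have "jet n y (\<lambda>z. (\<lambda>z\<in>W. s x z - s y z) z + s y z) (\<lambda>i. ev (pd i (F y)) y / ev (G y) y)" by simp
      from jet_cong[OF this W(1,2), of "s x"]
      have "jet n y (s x) (\<lambda>i. ev (pd i (F y)) y / ev (G y) y)" by simp
      from jet_unique[OF y(1) jets[OF that(1,2) y(1) that(4)] this that(5)] show ?thesis .
    qed
    \<comment> \<open>The gradient of \<open>\<sigma>\<close> along the curve, computed at each point with the representative chosen there.\<close>
    define \<gamma> where "\<gamma> i s t = ev (pd i (F (cp s t))) (cp s t) / ev (G (cp s t)) (cp s t)" for i s t
    have \<gamma>: "mp_eval (G x) (P a b) \<noteq> 0 \<and> \<gamma> i a b = mp_eval (pd i (F x)) (P a b) / mp_eval (G x) (P a b)"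
      if x: "x \<in> pcone n" and nz: "mp_eval (H x) (P a b) \<noteq> 0" and i: "i \<le> n" for x a b i
    proof -
      have H: "ev (H x) (cp a b) \<noteq> 0" using nz evcp[OF loc(3)[OF x]] by simp
      have "cp a b \<in> U x" using loc5[OF x cp_carrier H] by blast
      hence "cp a b \<in> pcone n" using zopen_subset[OF Us(1)[OF x]] by auto
      hence "(a, b) \<noteq> (0, 0)" using e_pos by (auto simp: pcone_iff cp_def heval_0_left zero_power)
      note c = cp[OF this]
      show ?thesis
        using compare[OF x c(2,1) H i] loc5[OF x cp_carrier H] evcp[OF loc(2)[OF x]]
          evcp[OF form_pd[OF loc(1)[OF x]]] by (simp add: \<gamma>_def)
    qed
    have deg1: "e * (g x + d - 1) = e * g x + e * (d - 1)" for x
      using d_pos by (simp add: add_mult_distrib2[symmetric])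
    have "\<forall>i. \<exists>q. i \<le> n \<longrightarrow> degree q \<le> e * (d - 1) \<and>
        (\<forall>a b. (a, b) \<noteq> (0, 0) \<longrightarrow> \<gamma> i a b = heval (e * (d - 1)) q a b)"
    proof (intro allI)
      fix i
      show "\<exists>q. i \<le> n \<longrightarrow> degree q \<le> e * (d - 1) \<and>
        (\<forall>a b. (a, b) \<noteq> (0, 0) \<longrightarrow> \<gamma> i a b = heval (e * (d - 1)) q a b)"
      proof (cases "i \<le> n")
        case True
        show ?thesis
        proof (rule glue_binary_forms[of "e * (d - 1)" "\<gamma> i"])
          fix s0 t0 :: 'a assume st: "(s0, t0) \<noteq> (0, 0)"
          define x where "x = cp s0 t0"
          have x: "x \<in> pcone n" using cp[OF st] by (simp add: x_def)
          have pf: "degree (pullback \<phi> K) \<le> e * l" "heval (e * l) (pullback \<phi> K) a b = mp_eval K (P a b)"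
            if "form n l K" for K l a b using pullback_form[OF that, of \<phi> e] deg_\<phi> by auto
          show "\<exists>k l N M h. degree N \<le> k + e * (d - 1) \<and> degree M \<le> k \<and> degree h \<le> l \<and> heval l h s0 t0 \<noteq> 0 \<and>
            (\<forall>s t. heval l h s t \<noteq> 0 \<longrightarrow> heval k M s t \<noteq> 0 \<and>
                \<gamma> i s t = heval (k + e * (d - 1)) N s t / heval k M s t)"
          proof (intro exI conjI allI impI)
            show "degree (pullback \<phi> (pd i (F x))) \<le> e * g x + e * (d - 1)"
              using pf(1)[OF form_pd[OF loc(1)[OF x]]] by (simp only: deg1)
            show "degree (pullback \<phi> (G x)) \<le> e * g x" by (rule pf(1)[OF loc(2)[OF x]])
            show "degree (pullback \<phi> (H x)) \<le> e * k x" by (rule pf(1)[OF loc(3)[OF x]])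
            show "heval (e * k x) (pullback \<phi> (H x)) s0 t0 \<noteq> 0"
              using loc(4)[OF x] evcp[OF loc(3)[OF x]] pf(2)[OF loc(3)[OF x]] by (simp add: x_def)
            fix a b assume h: "heval (e * k x) (pullback \<phi> (H x)) a b \<noteq> 0"
            hence h': "mp_eval (H x) (P a b) \<noteq> 0" by (simp only: pf(2)[OF loc(3)[OF x]] not_False_eq_True)
            have N: "heval (e * g x + e * (d - 1)) (pullback \<phi> (pd i (F x))) a b = mp_eval (pd i (F x)) (P a b)"
              using pf(2)[OF form_pd[OF loc(1)[OF x]]] by (simp only: deg1)
            show "heval (e * g x) (pullback \<phi> (G x)) a b \<noteq> 0"
              unfolding pf(2)[OF loc(2)[OF x]] using \<gamma>[OF x h' True] by blast
            show "\<gamma> i a b = heval (e * g x + e * (d - 1)) (pullback \<phi> (pd i (F x))) a b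
                / heval (e * g x) (pullback \<phi> (G x)) a b"
              unfolding N pf(2)[OF loc(2)[OF x]] using \<gamma>[OF x h' True] by blast
          qed
        qed blast
      qed auto
    qed
    then obtain q where q: "\<And>i. i \<le> n \<Longrightarrow> degree (q i) \<le> e * (d - 1)"
      "\<And>i a b. i \<le> n \<Longrightarrow> (a, b) \<noteq> (0, 0) \<Longrightarrow> \<gamma> i a b = heval (e * (d - 1)) (q i) a b" by metis
    have q1: "poly (q i) t = \<gamma> i 1 t" if "i \<le> n" for i t
      using q(2)[OF that, of 1 t] heval_1_left[OF q(1)[OF that]] by simp
    have P1: "P 1 t i = poly (\<phi> i) t" if "i \<le> n" for i t using heval_1_left[OF deg_\<phi>[OF that]] .
    have vanC: "pullback \<phi> (F x) = 0 \<and> pullback \<phi> (H x) \<noteq> 0" if x: "x \<in> pcone n" "x \<in> C" for x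
    proof -
      obtain c a b where c: "c \<noteq> 0" "(a, b) \<noteq> (0, 0)" "\<And>i. i \<le> n \<Longrightarrow> x $ i = c * P a b i"
        using x(2) unfolding curve_cone_def by blast
      have xc: "x \<in> carrier_vec (n + 1)" using x(1) by (simp add: pcone_iff)
      have "mp_eval (H x) (P a b) \<noteq> 0" using loc(4)[OF x(1)] ev_curve_point[OF loc(3)[OF x(1)] xc c(3)] by auto
      hence H: "pullback \<phi> (H x) \<noteq> 0"
        using pullback_eq_0_iff[where \<phi> = \<phi> and e = e, OF loc(3)[OF x(1)] deg_\<phi>] by blast
      have "poly (pullback \<phi> (F x) * pullback \<phi> (H x)) t = 0" for t
      proof (cases "mp_eval (H x) (P 1 t) = 0")
        case False
        hence h: "ev (H x) (cp 1 t) \<noteq> 0" using evcp[OF loc(3)[OF x(1)]] by simp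
        have "s x (cp 1 t) = 0" using sC[OF x(1) cp(2) cp_carrier h] by simp
        hence "ev (F x) (cp 1 t) = 0" using loc5[OF x(1) cp_carrier h] by auto
        hence "mp_eval (F x) (P 1 t) = 0" using evcp[OF loc(1)[OF x(1)]] by simp
        moreover have "mp_eval (F x) (P 1 t) = poly (pullback \<phi> (F x)) t"
          unfolding poly_geval mp_eval_geval using P1 by (intro geval_cong[OF form_mp_in[OF loc(1)[OF x(1)]]]) auto
        ultimately show ?thesis by simp
      next
        case True
        moreover have "mp_eval (H x) (P 1 t) = poly (pullback \<phi> (H x)) t"
          unfolding poly_geval mp_eval_geval using P1 by (intro geval_cong[OF form_mp_in[OF loc(3)[OF x(1)]]]) auto
        ultimately show ?thesis by simp
      qed
      hence "pullback \<phi> (F x) * pullback \<phi> (H x) = 0" by (rule poly_all_0_imp_0)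
      thus ?thesis using H by simp
    qed
    have ev1: "mp_eval K (P 1 t) = poly (pullback \<phi> K) t" if "mp_in {..n} K" for K t
      unfolding poly_geval mp_eval_geval using P1 by (intro geval_cong[OF that]) auto
    \<comment> \<open>Euler's relation and the chain rule for \<open>F x\<close>, whose restriction to the curve vanishes.\<close>
    have rel: "(\<Sum>i\<le>n. poly (q i) t * P 1 t i) = 0 \<and> (\<Sum>i\<le>n. poly (q i) t * poly (pderiv (\<phi> i)) t) = 0" for t
    proof -
      define x where "x = cp 1 t"
      have x: "x \<in> pcone n" "x \<in> C" using cp[of 1 t] by (auto simp: x_def)
      have h: "mp_eval (H x) (P 1 t) \<noteq> 0" using loc(4)[OF x(1)] evcp[OF loc(3)[OF x(1)]] by (simp add: x_def)
      have qi: "poly (q i) t = mp_eval (pd i (F x)) (P 1 t) / mp_eval (G x) (P 1 t)" if "i \<le> n" for i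
        using \<gamma>[OF x(1) h that] q1[OF that] by simp
      have "(\<Sum>i\<le>n. poly (q i) t * P 1 t i) = (\<Sum>i\<le>n. P 1 t i * mp_eval (pd i (F x)) (P 1 t)) / mp_eval (G x) (P 1 t)"
        unfolding sum_divide_distrib by (intro sum.cong) (auto simp: qi)
      also have "\<dots> = 0"
        using geval_euler[OF comm_ring_hom_id loc(1)[OF x(1)], of "P 1 t"] vanC[OF x]
          ev1[OF form_mp_in[OF loc(1)[OF x(1)]]] by (simp add: mp_eval_geval[symmetric])
      finally have 1: "(\<Sum>i\<le>n. poly (q i) t * P 1 t i) = 0" .
      have "0 = poly (pderiv (pullback \<phi> (F x))) t" using vanC[OF x] by simp
      also have "\<dots> = (\<Sum>i\<le>n. mp_eval (pd i (F x)) (P 1 t) * poly (pderiv (\<phi> i)) t)"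
        unfolding pderiv_geval[OF form_mp_in[OF loc(1)[OF x(1)]] finite_atMost] poly_sum
        by (intro sum.cong refl) (simp add: ev1[OF form_mp_in[OF form_pd[OF loc(1)[OF x(1)]]]])
      finally have "(\<Sum>i\<le>n. mp_eval (pd i (F x)) (P 1 t) * poly (pderiv (\<phi> i)) t) = 0" by simp
      moreover have "(\<Sum>i\<le>n. poly (q i) t * poly (pderiv (\<phi> i)) t) =
          (\<Sum>i\<le>n. mp_eval (pd i (F x)) (P 1 t) * poly (pderiv (\<phi> i)) t) / mp_eval (G x) (P 1 t)"
        unfolding sum_divide_distrib by (intro sum.cong) (auto simp: qi)
      ultimately show ?thesis using 1 by simp
    qed
    have "(\<Sum>i\<le>n. q i * \<phi> i) = 0"
      using rel by (intro poly_all_0_imp_0) (simp add: poly_sum P1[symmetric])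
    moreover have "(\<Sum>i\<le>n. q i * pderiv (\<phi> i)) = 0"
      using rel by (intro poly_all_0_imp_0) (simp add: poly_sum)
    ultimately obtain F0 where F0: "form n d F0" "pullback \<phi> F0 = 0" "\<And>i. i \<le> n \<Longrightarrow> pullback \<phi> (pd i F0) = q i"
      using exact q(1) unfolding conormal_exact_def by blast
    define s0 where "s0 = (\<lambda>y\<in>pcone n. ev F0 y)"
    have F0C: "ev F0 y = 0" if "y \<in> C" for y
    proof -
      obtain c a b where c: "y \<in> carrier_vec (n + 1)" "\<And>i. i \<le> n \<Longrightarrow> y $ i = c * P a b i"
        using \<open>y \<in> C\<close> unfolding curve_cone_def by blast
      have "ev F0 y = c ^ d * mp_eval F0 (P a b)" by (rule ev_curve_point[OF F0(1) c])
      moreover have "mp_eval F0 (P a b) = 0"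
        using pullback_eq_0_iff[where \<phi> = \<phi> and e = e, OF F0(1) deg_\<phi>] F0(2) by blast
      ultimately show ?thesis by simp
    qed
    have regF0: "regf n d W (ev F0)" for W
      by (rule regfI[of n 0 d F0 1]) (auto simp: F0(1) form_1 mp_eval_simps)
    have s0: "s0 \<in> H0_ideal n C d"
      unfolding H0_ideal_def s0_def using F0C by (intro regf_ideal_twist regF0 zopen_pcone)
    have "conormal_map n C d s0 = \<sigma>"
    proof
      fix x
      show "conormal_map n C d s0 x = \<sigma> x"
      proof (cases "x \<in> pcone n")
        case False
        thus ?thesis using \<sigma> by (auto simp: conormal_map_def H0_conormal_def extensional_def)
      next
        case x: True
        have "\<exists>W. zopen n W \<and> x \<in> W \<and> W \<subseteq> pcone n \<inter> U x \<and> (\<lambda>y\<in>W. s0 y - s x y) \<in> ideal_sq n C d W"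
        proof (cases "x \<in> C")
          case xC: True
          \<comment> \<open>Up to the denominator \<open>G x\<close>, the difference of the global form and the local representative.\<close>
          define E where "E = F0 * G x - F x"
          have E: "form n (g x + d) E" unfolding E_def
            using form_mult[OF F0(1) loc(2)[OF x]] loc(1)[OF x] by (intro form_diff) (simp_all add: add.commute)
          have E0: "pullback \<phi> E = 0" using vanC[OF x xC] F0(2) by (simp add: E_def pullback_simps)
          have E1: "pullback \<phi> (pd i E) = 0" if i: "i \<le> n" for i
          proof -
            have *: "pullback \<phi> (pd i E) = q i * pullback \<phi> (G x) - pullback \<phi> (pd i (F x))"
              using F0(2,3) i by (simp add: E_def pd_diff pd_mult pullback_simps)
            have "poly (pullback \<phi> (pd i E) * pullback \<phi> (H x)) t = 0" for t
            proof (cases "mp_eval (H x) (P 1 t) = 0")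
              case True
              thus ?thesis using ev1[OF form_mp_in[OF loc(3)[OF x]]] by simp
            next
              case False
              from \<gamma>[OF x this i] show ?thesis
                using ev1[OF form_mp_in[OF loc(2)[OF x]]] ev1[OF form_mp_in[OF form_pd[OF loc(1)[OF x]]]] q1[OF i]
                by (simp add: * field_simps)
            qed
            hence "pullback \<phi> (pd i E) * pullback \<phi> (H x) = 0" by (rule poly_all_0_imp_0)
            thus ?thesis using vanC[OF x xC] by simp
          qed
          define V where "V = {z \<in> pcone n. ev (H x) z \<noteq> 0}"
          have V: "zopen n V" "x \<in> V" "\<And>y. y \<in> V \<Longrightarrow> ev (G x) y \<noteq> 0"
            "\<And>y. y \<in> V \<Longrightarrow> y \<in> pcone n \<and> y \<in> U x \<and> s x y = ev (F x) y / ev (G x) y"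
            using zopen_basic[OF loc(3)[OF x]] x loc(4)[OF x] loc5[OF x] by (auto simp: V_def pcone_iff)
          from flat_in_square[OF E E0 E1 loc(2)[OF x] V(1,2) xC V(3)]
          obtain W where W: "zopen n W" "x \<in> W" "W \<subseteq> V" "(\<lambda>y\<in>W. ev E y / ev (G x) y) \<in> ideal_sq n C d W" by blast
          have "(\<lambda>y\<in>W. ev E y / ev (G x) y) = (\<lambda>y\<in>W. s0 y - s x y)"
          proof (rule restrict_ext)
            fix y assume "y \<in> W"
            hence "y \<in> V" using W(3) by auto
            thus "ev E y / ev (G x) y = s0 y - s x y"
              using V(3,4)[of y] by (simp add: E_def s0_def mp_eval_simps field_simps)
          qed
          thus ?thesis using W V(4) by (intro exI[of _ W]) auto
        next
          case xC: False
          obtain l K where K: "form n l K" "ev K x \<noteq> 0" "\<And>a b. mp_eval K (P a b) = 0"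
            using separating_form[OF x xC] by metis
          let ?W = "U x \<inter> {z \<in> pcone n. ev K z \<noteq> 0}"
          have W: "zopen n ?W" by (intro zopen_Int Us(1) x zopen_basic[OF K(1)])
          have "ev K y = 0" if "y \<in> C" for y
          proof -
            obtain c a b where c: "y \<in> carrier_vec (n + 1)" "\<And>i. i \<le> n \<Longrightarrow> y $ i = c * P a b i"
              using \<open>y \<in> C\<close> unfolding curve_cone_def by blast
            thus ?thesis using ev_curve_point[OF K(1) c] K(3) by simp
          qed
          hence "?W \<inter> C = {}" by auto
          moreover have "(\<lambda>y\<in>?W. s0 y) \<in> twist n d ?W"
            using twist_restrict[OF _ W, of s0 d "pcone n"] s0 unfolding H0_ideal_def ideal_twist_def by auto
          moreover have "(\<lambda>y\<in>?W. s x y) \<in> twist n d ?W"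
            using twist_restrict[OF _ W, of "s x" d "U x"] Us(3)[OF x] unfolding ideal_twist_def by auto
          ultimately have "(\<lambda>y\<in>?W. s0 y - s x y) \<in> ideal_sq n C d ?W"
            by (intro ideal_sq_diff_off_curve[OF W])
          thus ?thesis using W x Us(2)[OF x] K(2) by (intro exI[of _ ?W]) auto
        qed
        then obtain W where "zopen n W" "x \<in> W" "W \<subseteq> pcone n \<inter> U x" "(\<lambda>y\<in>W. s0 y - s x y) \<in> ideal_sq n C d W"
          by blast
        from germ_eqI[OF this] have "conormal_germ n C d x (pcone n) s0 = \<sigma> x"
          using Us(4)[OF x Us(2)[OF x]] by simp
        thus ?thesis using x by (simp add: conormal_map_def)
      qed
    qed
    thus ?thesis using s0 by blast
  qed
  thus ?thesis unfolding conormal_map_surj_def using conormal_map_well_defined by blast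
qed

end

section \<open>Morphisms given by matrices\<close>

lemma pderiv_sum: "pderiv (\<Sum>i\<in>A. f i) = (\<Sum>i\<in>A. pderiv (f i))"
  by (induction A rule: infinite_finite_induct) (simp_all add: pderiv_add)

lemma const_poly_sum: "[:\<Sum>i\<in>A. f i:] = (\<Sum>i\<in>A. [:f i:])"
  using sum_comp_morphism[of "\<lambda>c. [:c:]" f A] by (simp add: o_def)

definition coord :: "nat \<Rightarrow> 'a::comm_ring_1 mat \<Rightarrow> nat \<Rightarrow> 'a poly" where
  "coord e A i = (\<Sum>j\<le>e. monom (A $$ (i, j)) j)"

lemma coeff_coord: "coeff (coord e A i) j = (if j \<le> e then A $$ (i, j) else 0)"
proof -
  have "coeff (coord e A i) j = (\<Sum>k\<le>e. if k = j then A $$ (i, k) else 0)"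
    by (simp add: coord_def coeff_sum)
  thus ?thesis by simp
qed

lemma degree_coord: "degree (coord e A i) \<le> e"
  by (rule degree_le) (auto simp: coeff_coord)

lemma mult_veronese:
  assumes "A \<in> carrier_mat (n + 1) (e + 1)" "i \<le> n"
  shows "(A *\<^sub>v veronese e s t) $ i = pt e (coord e A) s t i"
proof -
  have "(A *\<^sub>v veronese e s t) $ i = (\<Sum>j = 0..<e + 1. A $$ (i, j) * (s ^ (e - j) * t ^ j))"
    using assms by (auto simp: scalar_prod_def veronese_def intro!: sum.cong)
  thus ?thesis
    by (simp add: heval_def coeff_coord atLeast0LessThan lessThan_Suc_atMost mult.assoc)
qed

lemma P1_image_eq_curve_cone:
  assumes A: "A \<in> carrier_mat (n + 1) (e + 1)"
  shows "P1_image e A = curve_cone n e (coord e A)"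
proof -
  have *: "x = c \<cdot>\<^sub>v (A *\<^sub>v veronese e s t) \<longleftrightarrow>
      x \<in> carrier_vec (n + 1) \<and> (\<forall>i\<le>n. x $ i = c * pt e (coord e A) s t i)" for x c s t
  proof
    assume x: "x = c \<cdot>\<^sub>v (A *\<^sub>v veronese e s t)"
    show "x \<in> carrier_vec (n + 1) \<and> (\<forall>i\<le>n. x $ i = c * pt e (coord e A) s t i)"
    proof (intro conjI allI impI)
      show "x \<in> carrier_vec (n + 1)" unfolding x using A by (intro carrier_vecI) simp
      fix i assume "i \<le> n"
      thus "x $ i = c * pt e (coord e A) s t i" using mult_veronese[OF A, of i s t] A by (simp add: x)
    qed
  next
    assume x: "x \<in> carrier_vec (n + 1) \<and> (\<forall>i\<le>n. x $ i = c * pt e (coord e A) s t i)"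
    show "x = c \<cdot>\<^sub>v (A *\<^sub>v veronese e s t)"
    proof (rule eq_vecI)
      show "dim_vec x = dim_vec (c \<cdot>\<^sub>v (A *\<^sub>v veronese e s t))" using A x by simp
      fix i assume "i < dim_vec (c \<cdot>\<^sub>v (A *\<^sub>v veronese e s t))"
      hence "i \<le> n" using A by simp
      thus "x $ i = (c \<cdot>\<^sub>v (A *\<^sub>v veronese e s t)) $ i" using mult_veronese[OF A, of i s t] A x by simp
    qed
  qed
  show ?thesis unfolding P1_image_def curve_cone_def * by blast
qed

context parametrized_curve
begin

text \<open>
  Along a line in the parameter plane through \<open>(s, t)\<close> two forms with ratio of restrictions \<open>s : t\<close>
  separate the direction of the line from the radial one.
\<close>

lemma immersion:
  assumes sw: "s * w \<noteq> t * u"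
    and X: "\<And>i \<epsilon>. i \<le> n \<Longrightarrow> poly (X i) \<epsilon> = P (s + \<epsilon> * u) (t + \<epsilon> * w) i"
  shows "\<not> (\<forall>i\<le>n. poly (pderiv (X i)) 0 = c * P s t i)"
proof
  assume dep: "\<forall>i\<le>n. poly (pderiv (X i)) 0 = c * P s t i"
  have st: "(s, t) \<noteq> (0, 0)" using sw by auto
  obtain Q R \<theta> where Q: "form n d Q" "\<And>s t. mp_eval Q (P s t) = s * \<theta> s t"
    and R: "form n d R" "\<And>s t. mp_eval R (P s t) = t * \<theta> s t" and \<theta>: "\<theta> s t \<noteq> 0"
    using inverse_forms[OF st] by metis
  have pX: "poly (pullback X F) \<epsilon> = mp_eval F (P (s + \<epsilon> * u) (t + \<epsilon> * w))" if "form n k F" for k F \<epsilon>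
    unfolding poly_geval mp_eval_geval using X by (intro geval_cong[OF form_mp_in[OF that]]) auto
  have radial: "poly (pderiv (pullback X F)) 0 = c * (of_nat d * mp_eval F (P s t))" if F: "form n d F" for F
  proof -
    have "poly (pderiv (pullback X F)) 0 = (\<Sum>i\<le>n. poly (pullback X (pd i F)) 0 * poly (pderiv (X i)) 0)"
      by (simp add: pderiv_geval[OF form_mp_in[OF F] finite_atMost] poly_sum)
    also have "\<dots> = (\<Sum>i\<le>n. c * (P s t i * mp_eval (pd i F) (P s t)))"
      using dep pX[OF form_pd[OF F], of _ 0] by (intro sum.cong) auto
    also have "\<dots> = c * (of_nat d * mp_eval F (P s t))"
      using geval_euler[OF comm_ring_hom_id F, of "P s t"]
      by (simp add: mp_eval_geval[symmetric] sum_distrib_left[symmetric])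
    finally show ?thesis .
  qed
  have "poly ([:t, w:] * pullback X Q - [:s, u:] * pullback X R) \<epsilon> = 0" for \<epsilon>
    by (simp add: pX[OF Q(1)] pX[OF R(1)] Q(2) R(2) algebra_simps)
  hence "[:t, w:] * pullback X Q - [:s, u:] * pullback X R = 0" by (rule poly_all_0_imp_0)
  hence "0 = poly (pderiv ([:t, w:] * pullback X Q - [:s, u:] * pullback X R)) 0" by simp
  also have "\<dots> = (s * w - t * u) * \<theta> s t"
    unfolding pderiv_diff pderiv_mult poly_diff poly_add poly_mult radial[OF Q(1)] radial[OF R(1)]
    by (simp add: pX[OF Q(1)] pX[OF R(1)] Q(2) R(2) pderiv_pCons algebra_simps)
  finally show False using sw \<theta> by auto
qed

lemma injective:
  assumes "(s, t) \<noteq> (0, 0)" "(s', t') \<noteq> (0, 0)" "\<And>i. i \<le> n \<Longrightarrow> P s' t' i = c * P s t i"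
  shows "s * t' = t * s'"
proof -
  obtain Q R \<theta> where Q: "form n d Q" "\<And>s t. mp_eval Q (P s t) = s * \<theta> s t"
    and R: "form n d R" "\<And>s t. mp_eval R (P s t) = t * \<theta> s t" and \<theta>: "\<theta> s' t' \<noteq> 0"
    using inverse_forms[OF assms(2)] by metis
  have *: "mp_eval F (P s' t') = c ^ d * mp_eval F (P s t)" if "form n d F" for F
  proof -
    have "mp_eval F (P s' t') = mp_eval F (\<lambda>i. c * P s t i)"
      unfolding mp_eval_geval using assms(3) by (intro geval_cong[OF form_mp_in[OF that]]) auto
    thus ?thesis by (simp add: form_scale[OF that])
  qed
  have "s' * \<theta> s' t' = c ^ d * (s * \<theta> s t)" "t' * \<theta> s' t' = c ^ d * (t * \<theta> s t)"
    using *[OF Q(1)] *[OF R(1)] by (simp_all add: Q(2) R(2))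
  hence "(s * t' - t * s') * \<theta> s' t' = 0" by (simp add: algebra_simps)
  thus ?thesis using \<theta> by simp
qed

end

text \<open>
  The forms \<open>Q\<close>, \<open>R\<close> inverting the parametrization separate points, and their derivatives separate tangent vectors.
\<close>

lemma P1_embedding_if_restr_surj:
  fixes A :: "'a::alg_closed_field mat"
  assumes A: "A \<in> carrier_mat (n + 1) (e + 1)" and "e \<ge> 1" "d \<ge> 1" and r: "restr_surj n e d (coord e A)"
  shows "P1_embedding n e A"
proof -
  interpret parametrized_curve n e d "coord e A"
    using assms by unfold_locales (auto simp: degree_coord)
  note mv = mult_veronese[OF A]
  have "A *\<^sub>v veronese e s t \<noteq> 0\<^sub>v (n + 1)" if "(s, t) \<noteq> (0, 0)" for s t
  proof
    note st = that
    assume z: "A *\<^sub>v veronese e s t = 0\<^sub>v (n + 1)"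
    obtain i where "i \<le> n" "P s t i \<noteq> 0" by (rule pt_nonzero[OF st])
    thus False using mv[of i s t] z by simp
  qed
  moreover have "s * t' = t * s'"
    if "(s, t) \<noteq> (0, 0)" "(s', t') \<noteq> (0, 0)" "A *\<^sub>v veronese e s' t' = c \<cdot>\<^sub>v (A *\<^sub>v veronese e s t)" for s t s' t' c
  proof (rule injective[OF that(1,2)])
    fix i assume "i \<le> n"
    thus "P s' t' i = c * P s t i" using mv[of i s' t'] mv[of i s t] that(3) A by simp
  qed
  moreover have "A *\<^sub>v dveronese e s t u w \<noteq> c \<cdot>\<^sub>v (A *\<^sub>v veronese e s t)" if sw: "s * w \<noteq> t * u" for s t u w c
  proof
    assume eq: "A *\<^sub>v dveronese e s t u w = c \<cdot>\<^sub>v (A *\<^sub>v veronese e s t)"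
    define X where "X i = (\<Sum>j\<le>e. [:coeff (coord e A i) j:] * ([:s, u:] ^ (e - j) * [:t, w:] ^ j))" for i
    have "poly (X i) \<epsilon> = P (s + \<epsilon> * u) (t + \<epsilon> * w) i" for i \<epsilon>
      by (simp add: X_def heval_def poly_sum mult.assoc)
    moreover have "poly (pderiv (X i)) 0 = c * P s t i" if i: "i \<le> n" for i
    proof -
      have "poly (pderiv (X i)) 0 = (\<Sum>j\<le>e. A $$ (i, j) * (of_nat (e - j) * s ^ (e - j - 1) * t ^ j * u
          + of_nat j * s ^ (e - j) * t ^ (j - 1) * w))"
        unfolding X_def pderiv_sum poly_sum
        by (intro sum.cong refl)
           (simp add: pderiv_smult pderiv_mult pderiv_power pderiv_pCons coeff_coord algebra_simps)
      also have "\<dots> = (A *\<^sub>v dveronese e s t u w) $ i"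
        using A i by (simp add: scalar_prod_def dveronese_def atLeast0LessThan lessThan_Suc_atMost)
      finally show ?thesis using mv[OF i, of s t] i A by (simp add: eq)
    qed
    ultimately show False using immersion[OF sw, of X c] by blast
  qed
  ultimately show ?thesis using A unfolding P1_embedding_def P1_morphism_def by blast
qed

section \<open>Linear changes of coordinates\<close>

text \<open>
  The curve \<open>\<psi>\<close> is the image of \<open>\<phi>\<close> under the invertible matrix \<open>M\<close> with inverse \<open>N\<close>; forms are carried over by
  composing them with \<open>N\<close>, and gradients by the transposed matrices.
\<close>

locale coordinate_change =
  fixes n :: nat and M N :: "nat \<Rightarrow> nat \<Rightarrow> 'a::field" and \<phi> \<psi> :: "nat \<Rightarrow> 'a poly"
  assumes \<psi>: "\<And>i. i \<le> n \<Longrightarrow> \<psi> i = (\<Sum>j\<le>n. [:M i j:] * \<phi> j)"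
    and NM: "\<And>i k. i \<le> n \<Longrightarrow> k \<le> n \<Longrightarrow> (\<Sum>j\<le>n. N i j * M j k) = (if i = k then 1 else 0)"
    and MN: "\<And>i k. i \<le> n \<Longrightarrow> k \<le> n \<Longrightarrow> (\<Sum>j\<le>n. M i j * N j k) = (if i = k then 1 else 0)"
begin

definition subst :: "(nat, 'a) mp \<Rightarrow> (nat, 'a) mp" where
  "subst F = geval Const (\<lambda>j. \<Sum>i\<le>n. Const (N j i) * Var i) F"

lemma form_substitute: "form n k F \<Longrightarrow> form n k (subst F)"
proof -
  assume "form n k F"
  hence "form n (k * 1) (subst F)"
    unfolding subst_def by (rule form_subst) (intro form_sum form_smult form_Var, simp)
  thus ?thesis by simp
qed

lemma pullback_substitute:
  assumes "mp_in {..n} F"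
  shows "pullback \<psi> (subst F) = pullback \<phi> F"
proof -
  have "(\<Sum>i\<le>n. [:N j i:] * \<psi> i) = \<phi> j" if j: "j \<le> n" for j
  proof -
    have "(\<Sum>i\<le>n. [:N j i:] * \<psi> i) = (\<Sum>i\<le>n. \<Sum>k\<le>n. [:N j i * M i k:] * \<phi> k)"
      by (intro sum.cong refl) (simp only: \<psi> atMost_iff sum_distrib_left, simp add: mult.commute)
    also have "\<dots> = (\<Sum>k\<le>n. [:\<Sum>i\<le>n. N j i * M i k:] * \<phi> k)"
      by (subst sum.swap) (simp add: const_poly_sum sum_distrib_right)
    also have "\<dots> = (\<Sum>k\<le>n. if k = j then \<phi> k else 0)"
      using NM[OF j] by (intro sum.cong refl) simp
    finally show ?thesis using j by simp
  qed
  thus ?thesis unfolding subst_def geval_geval[OF comm_ring_hom_pCons]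
    by (intro geval_cong[OF assms]) (simp add: pullback_simps del: One_nat_def)
qed

lemma restr_surj_change: "restr_surj n e d \<phi> \<Longrightarrow> restr_surj n e d \<psi>"
  unfolding restr_surj_def using form_substitute pullback_substitute[OF form_mp_in] by metis

lemma conormal_exact_change:
  assumes ex: "conormal_exact n e d \<phi>" shows "conormal_exact n e d \<psi>"
  unfolding conormal_exact_def
proof (intro allI impI)
  fix g assume g: "\<forall>i\<le>n. degree (g i) \<le> e * (d - 1)" "(\<Sum>i\<le>n. g i * \<psi> i) = 0"
    "(\<Sum>i\<le>n. g i * pderiv (\<psi> i)) = 0"
  define g' where "g' j = (\<Sum>i\<le>n. [:M i j:] * g i)" for j
  have move: "(\<Sum>j\<le>n. g' j * x j) = (\<Sum>i\<le>n. g i * (\<Sum>j\<le>n. [:M i j:] * x j))" for x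
    unfolding g'_def sum_distrib_left sum_distrib_right
    by (subst sum.swap) (simp add: ac_simps)
  have "\<forall>j\<le>n. degree (g' j) \<le> e * (d - 1)"
    unfolding g'_def using g(1) by (intro allI impI degree_sum_le) (auto intro: order_trans[OF degree_smult_le])
  moreover have "(\<Sum>j\<le>n. g' j * \<phi> j) = 0" using g(2) by (simp add: move \<psi> del: mult_pCons_left)
  moreover have "(\<Sum>j\<le>n. g' j * pderiv (\<phi> j)) = 0"
  proof -
    have "pderiv (\<psi> i) = (\<Sum>j\<le>n. [:M i j:] * pderiv (\<phi> j))" if "i \<le> n" for i
      by (simp add: \<psi>[OF that] pderiv_sum pderiv_smult)
    thus ?thesis using g(3) by (simp add: move del: mult_pCons_left)
  qed
  ultimately obtain F where F: "form n d F" "pullback \<phi> F = 0" "\<And>j. j \<le> n \<Longrightarrow> pullback \<phi> (pd j F) = g' j"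
    using ex unfolding conormal_exact_def by blast
  have "pullback \<psi> (pd i (subst F)) = g i" if i: "i \<le> n" for i
  proof -
    have "pd i (\<Sum>k\<le>n. Const (N j k) * Var k) = Const (N j i)" for j
    proof -
      have "pd i (\<Sum>k\<le>n. Const (N j k) * Var k) = (\<Sum>k\<le>n. if k = i then Const (N j k) else 0)"
        unfolding pd_sum by (intro sum.cong refl) (simp only: pd_Const_mult pd_Var, simp)
      thus ?thesis using i by simp
    qed
    hence "pd i (subst F) = (\<Sum>j\<le>n. subst (pd j F) * Const (N j i))"
      by (simp only: subst_def pd_subst[OF form_mp_in[OF F(1)] finite_atMost])
    hence "pullback \<psi> (pd i (subst F)) = (\<Sum>j\<le>n. pullback \<phi> (pd j F) * [:N j i:])"
      by (simp only: pullback_simps pullback_substitute[OF form_mp_in[OF form_pd[OF F(1)]]])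
    also have "\<dots> = (\<Sum>j\<le>n. g' j * [:N j i:])" using F(3) by (intro sum.cong) auto
    also have "\<dots> = (\<Sum>k\<le>n. g k * [:\<Sum>j\<le>n. M k j * N j i:])"
      unfolding move by (intro sum.cong refl) (simp add: const_poly_sum mult.commute)
    also have "\<dots> = (\<Sum>k\<le>n. if k = i then g k else 0)"
      using MN[OF _ i] by (intro sum.cong refl) simp
    finally show ?thesis using i by simp
  qed
  moreover have "pullback \<psi> (subst F) = 0" using pullback_substitute[OF form_mp_in[OF F(1)]] F(2) by simp
  ultimately show "\<exists>F. form n d F \<and> pullback \<psi> F = 0 \<and> (\<forall>i\<le>n. pullback \<psi> (pd i F) = g i)"
    using form_substitute[OF F(1)] by blast
qed

end

section \<open>Monomial curves\<close>

text \<open>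
  The coordinates of index larger than \<open>m\<close> vanish on the curve, which covers rational normal curves that span a proper
  subspace.
\<close>

locale monomial_curve =
  fixes n m e d :: nat and a :: "nat \<Rightarrow> nat" and \<phi> :: "nat \<Rightarrow> 'a::field poly"
  assumes m: "m \<le> n" and a: "\<And>i. i \<le> m \<Longrightarrow> a i \<le> e" and d: "d \<ge> 2"
    and \<phi>: "\<And>i. i \<le> m \<Longrightarrow> \<phi> i = monom 1 (a i)" "\<And>i. m < i \<Longrightarrow> i \<le> n \<Longrightarrow> \<phi> i = 0"
begin

definition monomials :: "nat \<Rightarrow> bool" where
  "monomials k \<longleftrightarrow> (\<forall>w\<le>e * k. \<exists>F. form n k F \<and> pullback \<phi> F = monom 1 w)"

lemma monomials_step:
  assumes k: "monomials k" "k \<ge> 1" and i: "i \<le> m" "a i = 0" and j: "j \<le> m" "a j = e"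
  shows "monomials (Suc k)"
  unfolding monomials_def
proof (intro allI impI)
  fix w assume w: "w \<le> e * Suc k"
  show "\<exists>F. form n (Suc k) F \<and> pullback \<phi> F = monom 1 w"
  proof (cases "w \<le> e * k")
    case True
    then obtain F where F: "form n k F" "pullback \<phi> F = monom 1 w" using k(1) by (auto simp: monomials_def)
    have "form n (1 + k) (Var i * F)" using i m by (intro form_mult form_Var F) auto
    moreover have "pullback \<phi> (Var i * F) = monom 1 w"
      using \<phi>(1)[OF i(1)] i F by (simp add: pullback_simps del: One_nat_def)
    ultimately show ?thesis by auto
  next
    case False
    have "e \<le> e * k" using k(2) by (cases k) auto
    moreover have "w \<le> e + e * k" using w by simp
    ultimately have "e \<le> w" "w - e \<le> e * k" using False by linarith+
    then obtain F where F: "form n k F" "pullback \<phi> F = monom 1 (w - e)"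
      using k(1) by (auto simp: monomials_def)
    have "form n (1 + k) (Var j * F)" using j m by (intro form_mult form_Var F) auto
    moreover have "pullback \<phi> (Var j * F) = monom 1 w"
      using \<phi>(1)[OF j(1)] j F \<open>e \<le> w\<close> by (simp add: pullback_simps mult_monom del: One_nat_def)
    ultimately show ?thesis by auto
  qed
qed

lemma restr_surj_if_monomials:
  assumes "monomials k" shows "restr_surj n e k \<phi>"
  unfolding restr_surj_def
proof (intro allI impI)
  fix f :: "'a poly" assume f: "degree f \<le> e * k"
  have "\<forall>w. \<exists>F. w \<le> e * k \<longrightarrow> form n k F \<and> pullback \<phi> F = monom 1 w"
    using assms by (auto simp: monomials_def)
  then obtain F where F: "\<And>w. w \<le> e * k \<Longrightarrow> form n k (F w) \<and> pullback \<phi> (F w) = monom 1 w" by metis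
  let ?G = "\<Sum>w\<le>e * k. Const (coeff f w) * F w"
  have "form n k ?G" using F by (intro form_sum form_smult) auto
  moreover have "pullback \<phi> ?G = f"
  proof -
    have "pullback \<phi> ?G = (\<Sum>w\<le>e * k. monom (coeff f w) w)"
      unfolding pullback_simps using F by (intro sum.cong) (auto simp: smult_monom)
    also have "\<dots> = f" using f by (rule poly_as_sum_of_monoms')
    finally show ?thesis .
  qed
  ultimately show "\<exists>F. form n k F \<and> pullback \<phi> F = f" by blast
qed

text \<open>
  The image of the map that is to be shown surjective onto the vectors satisfying the two relations.
\<close>

definition gradients :: "(nat \<Rightarrow> 'a poly) set" where
  "gradients = {g. \<exists>F. form n d F \<and> pullback \<phi> F = 0 \<and> (\<forall>i\<le>n. pullback \<phi> (pd i F) = g i)}"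

lemma gradients_add: "g \<in> gradients \<Longrightarrow> g' \<in> gradients \<Longrightarrow> (\<lambda>i. g i + g' i) \<in> gradients"
  unfolding gradients_def
proof (clarify)
  fix F F' assume "form n d F" "pullback \<phi> F = 0" "\<forall>i\<le>n. pullback \<phi> (pd i F) = g i"
    "form n d F'" "pullback \<phi> F' = 0" "\<forall>i\<le>n. pullback \<phi> (pd i F') = g' i"
  thus "\<exists>F. form n d F \<and> pullback \<phi> F = 0 \<and> (\<forall>i\<le>n. pullback \<phi> (pd i F) = g i + g' i)"
    by (intro exI[of _ "F + F'"]) (simp add: form_add pd_add pullback_simps)
qed

lemma gradients_smult: "g \<in> gradients \<Longrightarrow> (\<lambda>i. Polynomial.smult c (g i)) \<in> gradients"
  unfolding gradients_def
proof (clarify)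
  fix F assume "form n d F" "pullback \<phi> F = 0" "\<forall>i\<le>n. pullback \<phi> (pd i F) = g i"
  thus "\<exists>F. form n d F \<and> pullback \<phi> F = 0 \<and> (\<forall>i\<le>n. pullback \<phi> (pd i F) = Polynomial.smult c (g i))"
    by (intro exI[of _ "Const c * F"]) (simp add: form_smult pd_Const_mult pullback_simps)
qed

lemma gradients_0: "(\<lambda>i. 0) \<in> gradients"
  unfolding gradients_def by (intro CollectI exI[of _ 0]) (simp add: form_0 pullback_simps)

lemma gradients_sum: "(\<And>w. w \<in> A \<Longrightarrow> g w \<in> gradients) \<Longrightarrow> (\<lambda>i. \<Sum>w\<in>A. g w i) \<in> gradients"
  by (induction A rule: infinite_finite_induct) (simp_all add: gradients_0 gradients_add)

lemma gradients_cong: "g \<in> gradients \<Longrightarrow> (\<And>i. i \<le> n \<Longrightarrow> g i = g' i) \<Longrightarrow> g' \<in> gradients"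
  unfolding gradients_def by auto

text \<open>
  Everything is graded by weight, where \<open>t^k\<close> in position \<open>i\<close> has weight \<open>k + a i\<close>. A vector of weight \<open>w\<close>
  is given by its coefficients \<open>\<beta>\<close>.
\<close>

definition wvec :: "nat \<Rightarrow> (nat \<Rightarrow> 'a) \<Rightarrow> nat \<Rightarrow> 'a poly" where
  "wvec w \<beta> i = (if i \<le> m \<and> a i \<le> w then monom (\<beta> i) (w - a i) else 0)"

definition realized :: "nat \<Rightarrow> (nat \<Rightarrow> 'a) set" where
  "realized w = {\<beta>. wvec w \<beta> \<in> gradients}"

lemma realized_add: "\<beta> \<in> realized w \<Longrightarrow> \<beta>' \<in> realized w \<Longrightarrow> (\<lambda>l. \<beta> l + \<beta>' l) \<in> realized w"
  unfolding realized_def mem_Collect_eq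
  by (rule gradients_cong[OF gradients_add[of "wvec w \<beta>" "wvec w \<beta>'"]]) (auto simp: wvec_def add_monom)

lemma realized_smult: "\<beta> \<in> realized w \<Longrightarrow> (\<lambda>l. c * \<beta> l) \<in> realized w"
  unfolding realized_def mem_Collect_eq
  by (rule gradients_cong[OF gradients_smult[of "wvec w \<beta>" c]]) (auto simp: wvec_def smult_monom)

lemma realized_cong: "\<beta> \<in> realized w \<Longrightarrow> (\<And>l. l \<le> m \<Longrightarrow> \<beta> l = \<beta>' l) \<Longrightarrow> \<beta>' \<in> realized w"
  unfolding realized_def by (auto elim!: gradients_cong simp: wvec_def)

lemma realized_0: "(\<lambda>l. 0) \<in> realized w"
  unfolding realized_def using gradients_0 by (auto elim!: gradients_cong simp: wvec_def)

lemma realized_sum: "(\<And>i. i \<in> A \<Longrightarrow> \<beta> i \<in> realized w) \<Longrightarrow> (\<lambda>l. \<Sum>i\<in>A. \<beta> i l) \<in> realized w"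
  by (induction A rule: infinite_finite_induct) (simp_all add: realized_0 realized_add)

abbreviation dl :: "nat \<Rightarrow> nat \<Rightarrow> 'a" where "dl i l \<equiv> if l = i then 1 else 0"

text \<open>
  This is the gradient of a monomial times the quadric \<open>x p * x q - x r * x s\<close>. The quadric vanishes on the curve, so
  only its own derivatives contribute. The bounds on \<open>w\<close> say that the weight left for the monomial is possible.
\<close>

lemma quadric_realized:
  assumes mono: "monomials (d - 2)" and pqrs: "p \<le> m" "q \<le> m" "r \<le> m" "s \<le> m" "a p + a q = a r + a s"
    and w: "a p + a q \<le> w" "w \<le> e * (d - 2) + a p + a q"
  shows "(\<lambda>l. dl p l + dl q l - dl r l - dl s l) \<in> realized w"
proof -
  define v where "v = w - (a p + a q)"
  have v: "v \<le> e * (d - 2)" using w by (simp add: v_def)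
  obtain M where M: "form n (d - 2) M" "pullback \<phi> M = monom 1 v" using mono v by (auto simp: monomials_def)
  let ?Q = "Var p * Var q - Var r * Var s"
  let ?F = "M * ?Q"
  have "form n (d - 2 + (1 + 1)) ?F" using pqrs m by (intro form_mult form_diff form_Var M) auto
  moreover have "d - 2 + (1 + 1) = d" using d by simp
  ultimately have F: "form n d ?F" by (simp only:)
  have Q0: "pullback \<phi> ?Q = 0"
    using \<phi>(1) pqrs by (simp add: pullback_simps mult_monom del: One_nat_def)
  have "pullback \<phi> (pd i ?F) = wvec w (\<lambda>l. dl p l + dl q l - dl r l - dl s l) i" if i: "i \<le> n" for i
  proof -
    have "pullback \<phi> (pd i ?F) = monom 1 v * pullback \<phi> (pd i ?Q)"
      using Q0 by (simp only: pd_mult pullback_simps M(2)) simp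
    also have "pullback \<phi> (pd i ?Q) = monom (dl p i) (a q) + monom (dl q i) (a p)
        - monom (dl r i) (a s) - monom (dl s i) (a r)"
      using \<phi>(1) pqrs by (simp add: pd_diff pd_mult pd_Var pullback_simps del: One_nat_def)
    also have "monom 1 v * \<dots> = monom (dl p i) (v + a q) + monom (dl q i) (v + a p)
        - monom (dl r i) (v + a s) - monom (dl s i) (v + a r)"
      by (simp only: algebra_simps mult_monom mult_1)
    also have "\<dots> = monom (dl p i) (w - a i) + monom (dl q i) (w - a i)
        - monom (dl r i) (w - a i) - monom (dl s i) (w - a i)"
    proof -
      have 1: "v + a q = w - a p" "v + a p = w - a q" "v + a s = w - a r" "v + a r = w - a s"
        using pqrs w by (auto simp: v_def)
      have 2: "monom (dl l i) (w - a l) = monom (dl l i) (w - a i)" for l by simp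
      show ?thesis by (simp only: 1 2)
    qed
    also have "\<dots> = wvec w (\<lambda>l. dl p l + dl q l - dl r l - dl s l) i"
      using pqrs w i by (auto simp: wvec_def add_monom diff_monom)
    finally show ?thesis .
  qed
  moreover have "pullback \<phi> ?F = 0" using Q0 by (simp only: geval_mult[OF comm_ring_hom_pCons]) simp
  ultimately show ?thesis using F unfolding realized_def gradients_def by blast
qed

text \<open>
  \<open>\<epsilon> j j' i\<close> is the relation expressing position \<open>i\<close> by two positions \<open>j\<close>, \<open>j'\<close> with consecutive exponents,
  the hub; these relations span all relations.
\<close>

definition \<epsilon> :: "nat \<Rightarrow> nat \<Rightarrow> nat \<Rightarrow> nat \<Rightarrow> 'a" where
  "\<epsilon> j j' i l = dl i l - dl j l - (of_nat (a i) - of_nat (a j)) * (dl j' l - dl j l)"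

text \<open>
  Subtracting the combination of the \<open>\<epsilon> j j' i\<close> with coefficients \<open>\<beta> i\<close> from \<open>\<beta>\<close> leaves a vector supported on \<open>j\<close> and
  \<open>j'\<close>, a combination with coefficients \<open>\<Sum> \<beta> i\<close> and \<open>\<Sum> (a i - a j) * \<beta> i\<close>, which are both zero.
\<close>

lemma relations_spanned:
  assumes j: "\<And>i. i \<in> S \<Longrightarrow> \<epsilon> j j' i \<in> realized w" and S: "finite S"
    and \<beta>: "\<And>l. l \<notin> S \<Longrightarrow> \<beta> l = 0" "(\<Sum>i\<in>S. \<beta> i) = 0" "(\<Sum>i\<in>S. of_nat (a i) * \<beta> i) = 0"
  shows "\<beta> \<in> realized w"
proof -
  have "(\<lambda>l. \<Sum>i\<in>S. \<beta> i * \<epsilon> j j' i l) \<in> realized w" using j by (intro realized_sum realized_smult)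
  moreover have "(\<Sum>i\<in>S. \<beta> i * \<epsilon> j j' i l) = \<beta> l" for l
  proof -
    have "(\<Sum>i\<in>S. \<beta> i * \<epsilon> j j' i l) = (\<Sum>i\<in>S. \<beta> i * dl i l) - (\<Sum>i\<in>S. \<beta> i) * dl j l
        - ((\<Sum>i\<in>S. of_nat (a i) * \<beta> i) - of_nat (a j) * (\<Sum>i\<in>S. \<beta> i)) * (dl j' l - dl j l)"
      unfolding sum_distrib_left sum_distrib_right sum_subtractf[symmetric]
      by (intro sum.cong refl) (simp only: \<epsilon>_def algebra_simps)
    also have "\<dots> = (\<Sum>i\<in>S. if l = i then \<beta> i else 0)"
      using \<beta>(2,3) by (simp only: mult_zero_left mult_zero_right diff_zero) (intro sum.cong refl, simp)
    also have "\<dots> = \<beta> l" using S \<beta>(1)[of l] by simp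
    finally show ?thesis .
  qed
  ultimately show ?thesis by simp
qed

text \<open>
  The part of weight \<open>w\<close> of \<open>conormal_exact\<close>; \<open>S\<close> consists of the positions in which a monomial of weight \<open>w\<close> has
  degree between \<open>0\<close> and \<open>e (d - 1)\<close>.
\<close>

definition weight_exact :: bool where
  "weight_exact \<longleftrightarrow> (\<forall>w \<beta> S. S = {i. i \<le> m \<and> a i \<le> w \<and> w \<le> e * (d - 1) + a i} \<longrightarrow>
     (\<forall>l. l \<notin> S \<longrightarrow> \<beta> l = 0) \<longrightarrow> (\<Sum>i\<in>S. \<beta> i) = 0 \<longrightarrow> (\<Sum>i\<in>S. of_nat (a i) * \<beta> i) = 0 \<longrightarrow> \<beta> \<in> realized w)"

text \<open>
  The components of index at most \<open>m\<close> are sorted by weight. The component of an index \<open>i > m\<close> is the gradient of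
  \<open>x i\<close> times a form of degree \<open>d - 1\<close>, since \<open>x i\<close> vanishes on the curve.
\<close>

lemma conormal_exact_if_weight_exact:
  assumes W: "weight_exact" and R: "m < n \<Longrightarrow> restr_surj n e (d - 1) \<phi>"
  shows "conormal_exact n e d \<phi>"
  unfolding conormal_exact_def
proof (intro allI impI)
  fix g assume g: "\<forall>i\<le>n. degree (g i) \<le> e * (d - 1)" "(\<Sum>i\<le>n. g i * \<phi> i) = 0"
    "(\<Sum>i\<le>n. g i * pderiv (\<phi> i)) = 0"
  define S where "S w = {i. i \<le> m \<and> a i \<le> w \<and> w \<le> e * (d - 1) + a i}" for w
  define \<beta> where "\<beta> w i = (if i \<in> S w then coeff (g i) (w - a i) else 0)" for w i
  have split: "(\<Sum>i\<le>n. g i * f i) = (\<Sum>i\<le>m. g i * f i)" if "\<And>i. m < i \<Longrightarrow> i \<le> n \<Longrightarrow> f i = 0" for f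
    using m that by (intro sum.mono_neutral_right) auto
  have coef: "coeff (\<Sum>i\<le>m. g i * monom (b i) (a i)) w = (\<Sum>i\<in>S w. b i * \<beta> w i)" for b w
  proof -
    have "coeff (\<Sum>i\<le>m. g i * monom (b i) (a i)) w = (\<Sum>i\<le>m. if i \<in> S w then b i * \<beta> w i else 0)"
      unfolding coeff_sum
    proof (intro sum.cong refl)
      fix i assume i: "i \<in> {..m}"
      hence "degree (g i) \<le> e * (d - 1)" using g(1) m by simp
      hence "coeff (g i) (w - a i) = 0" if "w > e * (d - 1) + a i" using that by (intro coeff_eq_0) linarith
      thus "coeff (g i * monom (b i) (a i)) w = (if i \<in> S w then b i * \<beta> w i else 0)"
        using i by (auto simp: mult.commute[of "g i"] coeff_monom_mult S_def \<beta>_def not_le)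
    qed
    also have "\<dots> = (\<Sum>i\<in>{..m} \<inter> S w. b i * \<beta> w i)" by (subst sum.inter_restrict) auto
    also have "{..m} \<inter> S w = S w" by (auto simp: S_def)
    finally show ?thesis .
  qed
  have "(\<Sum>i\<le>m. g i * monom 1 (a i)) = 0"
  proof -
    have "(\<Sum>i\<le>m. g i * monom 1 (a i)) = (\<Sum>i\<le>m. g i * \<phi> i)" by (intro sum.cong) (auto simp: \<phi>(1))
    thus ?thesis using g(2) split[of \<phi>] \<phi>(2) by simp
  qed
  hence 1: "(\<Sum>i\<in>S w. \<beta> w i) = 0" for w using coef[of "\<lambda>_. 1" w] by simp
  have "(\<Sum>i\<le>m. g i * monom (of_nat (a i)) (a i)) = pCons 0 (\<Sum>i\<le>m. g i * pderiv (\<phi> i))"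
  proof -
    have 3: "pCons 0 (pderiv (monom (1::'a) k)) = monom (of_nat k) k" for k
    proof (cases k)
      case (Suc j)
      have "pderiv (monom (1::'a) (Suc j)) = monom (of_nat (Suc j)) j" by (simp add: pderiv_monom)
      thus ?thesis by (simp only: Suc monom_Suc)
    qed simp
    have "pCons 0 (\<Sum>i\<le>m. g i * pderiv (\<phi> i)) = (\<Sum>i\<le>m. g i * pCons 0 (pderiv (\<phi> i)))"
      using sum_distrib_left[of "[:0, 1:]" "\<lambda>i. g i * pderiv (\<phi> i)" "{..m}"] by simp
    also have "\<dots> = (\<Sum>i\<le>m. g i * monom (of_nat (a i)) (a i))"
      by (intro sum.cong refl) (simp only: \<phi>(1) atMost_iff 3)
    finally show ?thesis by simp
  qed
  also have "\<dots> = 0" using g(3) split[of "\<lambda>i. pderiv (\<phi> i)"] \<phi>(2) by simp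
  finally have 2: "(\<Sum>i\<in>S w. of_nat (a i) * \<beta> w i) = 0" for w using coef[of "\<lambda>i. of_nat (a i)" w] by simp
  have "\<beta> w \<in> realized w" for w
    using W[unfolded weight_exact_def, rule_format, OF S_def[of w], of "\<beta> w"] 1[of w] 2[of w]
    by (simp add: \<beta>_def)
  hence "(\<lambda>i. \<Sum>w\<le>e * d. wvec w (\<beta> w) i) \<in> gradients" by (intro gradients_sum) (simp add: realized_def)
  moreover have "(\<lambda>l. \<Sum>i\<in>{m<..n}. if l = i then g i else 0) \<in> gradients"
  proof (rule gradients_sum)
    fix i assume i: "i \<in> {m<..n}"
    then obtain G where G: "form n (d - 1) G" "pullback \<phi> G = g i"
      using R g(1) unfolding restr_surj_def by auto
    have "form n (1 + (d - 1)) (Var i * G)" using i by (intro form_mult form_Var G) auto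
    hence "form n d (Var i * G)" using d by simp
    moreover have "pullback \<phi> (Var i * G) = 0" using \<phi>(2) i by (simp add: pullback_simps del: One_nat_def)
    moreover have "pullback \<phi> (pd l (Var i * G)) = (if l = i then g i else 0)" for l
      using \<phi>(2) i G(2) by (simp add: pd_mult pd_Var pullback_simps del: One_nat_def)
    ultimately show "(\<lambda>l. if l = i then g i else 0) \<in> gradients" unfolding gradients_def by blast
  qed
  ultimately have "(\<lambda>i. (\<Sum>w\<le>e * d. wvec w (\<beta> w) i) + (\<Sum>k\<in>{m<..n}. if i = k then g k else 0)) \<in> gradients"
    by (rule gradients_add)
  moreover have "(\<Sum>w\<le>e * d. wvec w (\<beta> w) i) + (\<Sum>k\<in>{m<..n}. if i = k then g k else 0) = g i" if i: "i \<le> n" for i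
  proof (cases "i \<le> m")
    case True
    have "coeff (\<Sum>w\<le>e * d. wvec w (\<beta> w) i) k = coeff (g i) k" for k
    proof -
      have "coeff (\<Sum>w\<le>e * d. wvec w (\<beta> w) i) k =
          (\<Sum>w\<le>e * d. if w = k + a i then (if k \<le> e * (d - 1) then coeff (g i) k else 0) else 0)"
        unfolding coeff_sum using True
        by (intro sum.cong refl) (auto simp: wvec_def \<beta>_def S_def)
      also have "\<dots> = coeff (g i) k"
      proof (cases "k \<le> e * (d - 1)")
        case True
        have "e * d = e * (d - 1) + e" using d by (cases d) auto
        hence "k + a i \<le> e * d" using True a[OF \<open>i \<le> m\<close>] by linarith
        thus ?thesis using True by simp
      next
        case False
        hence "coeff (g i) k = 0" using g(1) i by (intro coeff_eq_0) (meson le_less_trans not_le)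
        thus ?thesis using False by simp
      qed
      finally show ?thesis .
    qed
    hence "(\<Sum>w\<le>e * d. wvec w (\<beta> w) i) = g i" by (intro poly_eqI)
    thus ?thesis using True by simp
  next
    case False
    thus ?thesis using i by (simp add: wvec_def)
  qed
  ultimately have "g \<in> gradients" by (rule gradients_cong)
  thus "\<exists>F. form n d F \<and> pullback \<phi> F = 0 \<and> (\<forall>i\<le>n. pullback \<phi> (pd i F) = g i)" by (simp add: gradients_def)
qed

end

context monomial_curve
begin

lemma \<epsilon>_hub: "\<epsilon> j j' j l = 0" "a j' = a j + 1 \<Longrightarrow> \<epsilon> j j' j' l = 0"
  by (auto simp: \<epsilon>_def)

lemma \<epsilon>_step_up:
  assumes "\<epsilon> j j' i \<in> realized w" "(\<lambda>l. \<epsilon> j j' i' l - \<epsilon> j j' i l) \<in> realized w"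
  shows "\<epsilon> j j' i' \<in> realized w"
  using realized_add[OF assms] by simp

text \<open>Between neighbouring positions with consecutive exponents the relation \<open>\<epsilon>\<close> changes by one quadric.\<close>

lemma \<epsilon>_neighbours:
  assumes mono: "monomials (d - 2)" and i: "i \<le> m" "i' \<le> m" "j \<le> m" "j' \<le> m"
    and a: "a i' = a i + 1" "a j' = a j + 1"
    and w: "a i + a j' \<le> w" "w \<le> e * (d - 2) + a i + a j'"
  shows "(\<lambda>l. \<epsilon> j j' i' l - \<epsilon> j j' i l) \<in> realized w" "(\<lambda>l. \<epsilon> j j' i l - \<epsilon> j j' i' l) \<in> realized w"
proof -
  have "(\<lambda>l. dl i' l + dl j l - dl i l - dl j' l) \<in> realized w" using i a w by (intro quadric_realized mono) auto
  moreover have *: "dl i' l + dl j l - dl i l - dl j' l = \<epsilon> j j' i' l - \<epsilon> j j' i l" for l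
    by (simp only: \<epsilon>_def a of_nat_add of_nat_1 algebra_simps mult_1)
  ultimately show 1: "(\<lambda>l. \<epsilon> j j' i' l - \<epsilon> j j' i l) \<in> realized w" by (simp only: *)
  show "(\<lambda>l. \<epsilon> j j' i l - \<epsilon> j j' i' l) \<in> realized w" using realized_smult[OF 1, of "- 1"] by simp
qed

end

section \<open>Rational normal curves\<close>

locale rational_normal = monomial_curve n e e d "\<lambda>i. i" \<phi> for n e d and \<phi> :: "nat \<Rightarrow> 'a::field poly" +
  assumes e_pos: "e \<ge> 1" and d3: "d \<ge> 3"
begin

lemma monomials: "k \<ge> 1 \<Longrightarrow> monomials k"
proof (induction k rule: nat_induct_at_least)
  case base
  show ?case unfolding monomials_def
  proof (intro allI impI)
    fix w assume "w \<le> e * 1"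
    thus "\<exists>F. form n 1 F \<and> pullback \<phi> F = monom 1 w"
      using m form_Var[of w n] \<phi>(1)[of w] by (intro exI[of _ "Var w"]) (simp add: pullback_simps)
  qed
next
  case (Suc k)
  thus ?case using monomials_step[of k 0 e] by simp
qed

text \<open>
  The hub is at one of the ends unless the cofactor has degree one, when for the middle weights
  all quadrics joining position \<open>w - e\<close> and its successor to other neighbours have admissible weight.
\<close>

lemma \<epsilon>_realized:
  assumes w: "w \<le> e * d"
  shows "\<exists>j. j + 1 \<le> e \<and> (\<forall>i. i \<le> e \<longrightarrow> i \<le> w \<longrightarrow> w \<le> e * (d - 1) + i \<longrightarrow> \<epsilon> j (j + 1) i \<in> realized w)"
proof -
  have mono: "monomials (d - 2)" using d3 by (intro monomials) auto
  have D: "e * (d - 1) = e * (d - 2) + e" using d3 by (cases d; cases "d - 1") auto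
  have e0: "\<epsilon> j (j + 1) j \<in> realized w" for j by (rule realized_cong[OF realized_0]) (simp add: \<epsilon>_hub)
  have e1: "\<epsilon> j (j + 1) (j + 1) \<in> realized w" for j
    by (rule realized_cong[OF realized_0]) (simp add: \<epsilon>_hub(2)[of "j + 1" j] del: One_nat_def add_Suc_right add_0_right)
  have up: "\<epsilon> j (j + 1) (j + k) \<in> realized w" if "j + 1 \<le> e" "j + k \<le> e"
    "\<And>i. j \<le> i \<Longrightarrow> i < j + k \<Longrightarrow> i + (j + 1) \<le> w \<and> w \<le> e * (d - 2) + i + (j + 1)" for j k
    using that(2,3)
  proof (induction k)
    case 0
    show ?case using e0 by simp
  next
    case (Suc k)
    have "\<epsilon> j (j + 1) (j + k) \<in> realized w" using Suc by simp
    moreover have "(\<lambda>l. \<epsilon> j (j + 1) (j + Suc k) l - \<epsilon> j (j + 1) (j + k) l) \<in> realized w"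
      using that(1) Suc.prems(1) Suc.prems(2)[of "j + k"] by (intro \<epsilon>_neighbours(1) mono) auto
    ultimately show ?case by (rule \<epsilon>_step_up)
  qed
  have down: "\<epsilon> j (j + 1) (j - k) \<in> realized w" if "j + 1 \<le> e" "k \<le> j"
    "\<And>i. j - k \<le> i \<Longrightarrow> i < j \<Longrightarrow> i + (j + 1) \<le> w \<and> w \<le> e * (d - 2) + i + (j + 1)" for j k
    using that(2,3)
  proof (induction k)
    case 0
    show ?case using e0 by simp
  next
    case (Suc k)
    have "\<epsilon> j (j + 1) (j - k) \<in> realized w" using Suc by simp
    moreover have "(\<lambda>l. \<epsilon> j (j + 1) (j - Suc k) l - \<epsilon> j (j + 1) (j - k) l) \<in> realized w"
      using that(1) Suc.prems(1) Suc.prems(2)[of "j - Suc k"] by (intro \<epsilon>_neighbours(2) mono) auto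
    ultimately show ?case by (rule \<epsilon>_step_up)
  qed
  consider "w \<le> e * (d - 2)" | "2 * e \<le> w" "e * (d - 2) < w" | "w < 2 * e" "e * (d - 2) < w" by linarith
  thus ?thesis
  proof cases
    case 1
    have "\<epsilon> 0 (0 + 1) i \<in> realized w" if "i \<le> e" "i \<le> w" for i
      using up[of 0 i] that 1 e_pos by auto
    thus ?thesis using e_pos by (intro exI[of _ 0]) auto
  next
    case 2
    have "\<epsilon> (e - 1) (e - 1 + 1) i \<in> realized w" if i: "i \<le> e" "w \<le> e * (d - 1) + i" for i
    proof (cases "i = e")
      case True
      thus ?thesis using e1[of "e - 1"] e_pos by simp
    next
      case False
      hence "e - 1 - (e - 1 - i) = i" using i by simp
      thus ?thesis using down[of "e - 1" "e - 1 - i"] e_pos 2 i D by auto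
    qed
    thus ?thesis using e_pos by (intro exI[of _ "e - 1"]) auto
  next
    case 3
    have "d - 2 < 2"
    proof (rule ccontr)
      assume "\<not> d - 2 < 2"
      hence "e * 2 \<le> e * (d - 2)" by (intro mult_le_mono) auto
      thus False using 3 by linarith
    qed
    hence d: "d - 2 = 1" using d3 by simp
    have *: "\<epsilon> (w - e) (w - e + 1) i \<in> realized w" if i: "i \<le> e" for i
    proof (cases "w - e \<le> i")
      case True
      hence "w - e + (i - (w - e)) = i" by simp
      thus ?thesis using up[of "w - e" "i - (w - e)"] 3 i by (auto simp: d)
    next
      case False
      hence "w - e - (w - e - i) = i" by simp
      thus ?thesis using down[of "w - e" "w - e - i"] 3 i by (auto simp: d)
    qed
    have "w - e + 1 \<le> e" using 3 by (simp add: d)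
    thus ?thesis using * by blast
  qed
qed

lemma weight_exact: weight_exact
  unfolding weight_exact_def
proof (intro allI impI)
  fix w \<beta> S
  assume S: "S = {i. i \<le> e \<and> i \<le> w \<and> w \<le> e * (d - 1) + i}"
    and \<beta>: "\<forall>l. l \<notin> S \<longrightarrow> \<beta> l = 0" "(\<Sum>i\<in>S. \<beta> i) = (0::'a)" "(\<Sum>i\<in>S. of_nat i * \<beta> i) = 0"
  show "\<beta> \<in> realized w"
  proof (cases "w \<le> e * d")
    case True
    obtain j where "\<forall>i. i \<le> e \<longrightarrow> i \<le> w \<longrightarrow> w \<le> e * (d - 1) + i \<longrightarrow> \<epsilon> j (j + 1) i \<in> realized w"
      using \<epsilon>_realized[OF True] by blast
    hence "\<epsilon> j (j + 1) i \<in> realized w" if "i \<in> S" for i using that by (simp add: S)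
    moreover have "finite S" by (simp add: S)
    ultimately show ?thesis using \<beta> by (intro relations_spanned[of S j "j + 1" w \<beta>]) blast+
  next
    case False
    have "e * d = e * (d - 1) + e" using d3 by (cases d) auto
    hence "S = {}" using False unfolding S by auto
    hence "\<beta> l = 0" for l using \<beta>(1) by simp
    thus ?thesis by (intro realized_cong[OF realized_0]) simp
  qed
qed

lemma exact: "restr_surj n e d \<phi>" "conormal_exact n e d \<phi>"
  using restr_surj_if_monomials[OF monomials, of d] d3
    conormal_exact_if_weight_exact[OF weight_exact restr_surj_if_monomials[OF monomials, of "d - 1"]] by auto

end

section \<open>The projected rational normal curve\<close>

text \<open>
  Projecting the rational normal curve of degree \<open>n + 1\<close> from the coordinate point of index \<open>3\<close> gives the
  monomial curve whose exponents are \<open>0, 1, 2, 4, \<dots>, n + 1\<close>.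
\<close>

definition gap_exp :: "nat \<Rightarrow> nat" where
  "gap_exp i = (if i < 3 then i else i + 1)"

locale projected_rational_normal = monomial_curve n n "n + 1" d gap_exp \<phi>
  for n d and \<phi> :: "nat \<Rightarrow> 'a::field poly" +
  assumes n5: "n \<ge> 5" and d4: "d \<ge> 4"
begin

lemma pullback_Var: "i \<le> n \<Longrightarrow> pullback \<phi> (Var i) = monom 1 (gap_exp i)"
  using \<phi>(1) by (simp add: pullback_simps)

lemma monomials: "k \<ge> 2 \<Longrightarrow> monomials k"
proof (induction k rule: nat_induct_at_least)
  case base
  have two: "\<exists>F. form n 2 F \<and> pullback \<phi> F = monom 1 w"
    if "i \<le> n" "j \<le> n" "gap_exp i + gap_exp j = w" for i j w
  proof -
    have "form n (1 + 1) (Var i * Var j)" using that by (intro form_mult form_Var)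
    thus ?thesis using that pullback_Var
      by (intro exI[of _ "Var i * Var j"]) (auto simp: geval_mult[OF comm_ring_hom_pCons] mult_monom numeral_2_eq_2)
  qed
  have "\<exists>i j. i \<le> n \<and> j \<le> n \<and> gap_exp i + gap_exp j = w" if "w \<le> 2 * (n + 1)" for w
  proof -
    consider "w < 3" | "w = 3" | "3 < w" "w \<le> n + 1" | "w = n + 4" | "n + 1 < w" "w < n + 4" | "n + 4 < w" by linarith
    thus ?thesis
    proof cases
      case 1 thus ?thesis using n5 by (intro exI[of _ w] exI[of _ 0]) (auto simp: gap_exp_def)
    next
      case 2 thus ?thesis using n5 by (intro exI[of _ 1] exI[of _ 2]) (auto simp: gap_exp_def)
    next
      case 3 thus ?thesis using n5 by (intro exI[of _ "w - 1"] exI[of _ 0]) (auto simp: gap_exp_def)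
    next
      case 4 thus ?thesis using n5 by (intro exI[of _ "n - 1"] exI[of _ 3]) (auto simp: gap_exp_def)
    next
      case 5 thus ?thesis using n5 by (intro exI[of _ n] exI[of _ "w - (n + 1)"]) (auto simp: gap_exp_def)
    next
      case 6 thus ?thesis using n5 that by (intro exI[of _ n] exI[of _ "w - (n + 1) - 1"]) (auto simp: gap_exp_def)
    qed
  qed
  thus ?case unfolding monomials_def using two by (auto simp: mult.commute) blast
next
  case (Suc k)
  thus ?case using monomials_step[of k 0 n] n5 by (simp add: gap_exp_def)
qed

lemma gap_exp_Suc: "i \<noteq> 2 \<Longrightarrow> gap_exp (Suc i) = gap_exp i + 1"
  by (auto simp: gap_exp_def)

lemma gap_exp_values: "gap_exp 0 = 0" "gap_exp 1 = 1" "gap_exp 2 = 2" "gap_exp 3 = 4"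
  "gap_exp n = n + 1" "gap_exp (n - 1) = n" "gap_exp (n - 2) = n - 1"
  using n5 by (auto simp: gap_exp_def)

lemma gap_exp_mono: "gap_exp i \<le> gap_exp (Suc i)"
  by (simp add: gap_exp_def)

text \<open>
  A quadric has weight at most \<open>2 (n + 1)\<close>, and its cofactor, a monomial of degree \<open>d - 2 \<ge> 2\<close>, can have any weight up
  to \<open>K = (n + 1) (d - 2) \<ge> 2 (n + 1)\<close>. If \<open>w \<le> K\<close>, the weight of the quadric must only be at most \<open>w\<close>, and the hub
  is at the exponents \<open>0\<close> and \<open>1\<close>; otherwise it must only be at least \<open>w - K\<close>, and the hub is at the exponents \<open>n\<close> and
  \<open>n + 1\<close>.
\<close>

lemma weight_exact: weight_exact
  unfolding weight_exact_def
proof (intro allI impI)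
  fix w \<beta> S
  assume S: "S = {i. i \<le> n \<and> gap_exp i \<le> w \<and> w \<le> (n + 1) * (d - 1) + gap_exp i}"
    and \<beta>: "\<forall>l. l \<notin> S \<longrightarrow> \<beta> l = 0" "(\<Sum>i\<in>S. \<beta> i) = (0::'a)" "(\<Sum>i\<in>S. of_nat (gap_exp i) * \<beta> i) = 0"
  have mono: "monomials (d - 2)" using d4 by (intro monomials) auto
  define K where "K = (n + 1) * (d - 2)"
  have D: "(n + 1) * (d - 1) = K + n + 1" using d4 unfolding K_def by (cases d; cases "d - 1") auto
  have "(n + 1) * 2 \<le> K" unfolding K_def using d4 by (intro mult_le_mono) auto
  hence big: "2 * n + 2 \<le> K" by simp
  note quad = quadric_realized[OF mono, folded K_def]
  note neighbours = \<epsilon>_neighbours[OF mono, folded K_def]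
  have e0: "\<epsilon> j j' j \<in> realized w" for j j' by (rule realized_cong[OF realized_0]) (simp add: \<epsilon>_hub)
  have e1: "\<epsilon> j j' j' \<in> realized w" if "gap_exp j' = gap_exp j + 1" for j j'
    by (rule realized_cong[OF realized_0]) (simp add: \<epsilon>_hub(2)[OF that])
  show "\<beta> \<in> realized w"
  proof (cases "w \<le> K")
    case True
    have "i \<le> n \<Longrightarrow> gap_exp i \<le> w \<Longrightarrow> \<epsilon> 0 1 i \<in> realized w" for i
    proof (induction i)
      case 0
      show ?case by (rule e0)
    next
      case (Suc i)
      have i: "i \<le> n" "Suc i \<le> n" "gap_exp i \<le> w" using Suc.prems gap_exp_mono[of i] by auto
      have "(\<lambda>l. \<epsilon> 0 1 (Suc i) l - \<epsilon> 0 1 i l) \<in> realized w"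
      proof (cases "i = 2")
        case False
        show ?thesis
          by (rule neighbours(1)) (use i Suc.prems(2) gap_exp_Suc[OF False] gap_exp_values True n5 in linarith)+
      next
        case 2: True
        \<comment> \<open>The gap between the exponents 2 and 4 is bridged by two quadrics.\<close>
        have w4: "4 \<le> w" using Suc.prems(2) gap_exp_values by (simp add: 2)
        have "(\<lambda>l. dl 3 l + dl 0 l - dl 2 l - dl 2 l) \<in> realized w"
          by (rule quad) (use w4 gap_exp_values True n5 in linarith)+
        moreover have "(\<lambda>l. dl 2 l + dl 0 l - dl 1 l - dl 1 l) \<in> realized w"
          by (rule quad) (use w4 gap_exp_values True n5 in linarith)+
        ultimately have "(\<lambda>l. (dl 3 l + dl 0 l - dl 2 l - dl 2 l) + (dl 2 l + dl 0 l - dl 1 l - dl 1 l)) \<in> realized w"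
          by (rule realized_add)
        moreover have "(dl 3 l + dl 0 l - dl 2 l - dl 2 l) + (dl 2 l + dl 0 l - dl 1 l - dl 1 l)
            = \<epsilon> 0 1 (Suc i) l - \<epsilon> 0 1 i l" for l
          unfolding \<epsilon>_def 2 Suc_numeral gap_exp_values
          by (simp only: semiring_norm numeral_3_eq_3[symmetric] gap_exp_values of_nat_numeral of_nat_0 algebra_simps) simp
        ultimately show ?thesis by simp
      qed
      from \<epsilon>_step_up[OF Suc.IH[OF i(1,3)] this] show ?case .
    qed
    hence "\<epsilon> 0 1 i \<in> realized w" if "i \<in> S" for i using that by (simp add: S)
    moreover have "finite S" by (simp add: S)
    ultimately show ?thesis using \<beta> by (intro relations_spanned[of S 0 1 w \<beta>]) blast+
  next
    case False
    have *: "i \<le> n \<Longrightarrow> w \<le> K + n + 1 + gap_exp (n - i) \<Longrightarrow> \<epsilon> (n - 1) n (n - i) \<in> realized w" for i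
    proof (induction i)
      case 0
      show ?case unfolding diff_zero by (rule e1) (simp only: gap_exp_values)
    next
      case (Suc i)
      define k where "k = n - Suc i"
      have k: "n - i = Suc k" "k \<le> n" "Suc k \<le> n" using Suc.prems(1) by (auto simp: k_def)
      have w: "w \<le> K + n + 1 + gap_exp k" using Suc.prems(2) by (simp add: k_def)
      have IH: "\<epsilon> (n - 1) n (Suc k) \<in> realized w" using Suc.IH w gap_exp_mono[of k] Suc.prems(1) unfolding k by simp
      have "(\<lambda>l. \<epsilon> (n - 1) n k l - \<epsilon> (n - 1) n (Suc k) l) \<in> realized w"
      proof (cases "k = 2")
        case 2: False
        have "gap_exp k \<le> n + 1" using k by (simp add: gap_exp_def)
        thus ?thesis
          by (intro neighbours(2)) (use w k gap_exp_Suc[OF 2] gap_exp_values False big n5 in linarith)+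
      next
        case 2: True
        have "(\<lambda>l. dl 2 l + dl n l - dl 3 l - dl (n - 2) l) \<in> realized w"
          by (rule quad) (use w[unfolded 2] gap_exp_values False big n5 in linarith)+
        moreover have "(\<lambda>l. dl (n - 2) l + dl n l - dl (n - 1) l - dl (n - 1) l) \<in> realized w"
          by (rule quad) (use w[unfolded 2] gap_exp_values False big n5 in linarith)+
        ultimately have "(\<lambda>l. (dl 2 l + dl n l - dl 3 l - dl (n - 2) l) +
            (dl (n - 2) l + dl n l - dl (n - 1) l - dl (n - 1) l)) \<in> realized w" by (rule realized_add)
        moreover have "(dl 2 l + dl n l - dl 3 l - dl (n - 2) l) +
            (dl (n - 2) l + dl n l - dl (n - 1) l - dl (n - 1) l) = \<epsilon> (n - 1) n k l - \<epsilon> (n - 1) n (Suc k) l" for l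
        proof -
          have "Suc k = 3" by (simp add: 2)
          thus ?thesis unfolding \<epsilon>_def 2 by (simp only: gap_exp_values of_nat_numeral algebra_simps) simp
        qed
        ultimately show ?thesis by simp
      qed
      from \<epsilon>_step_up[OF IH this] show ?case by (simp add: k_def)
    qed
    have "\<epsilon> (n - 1) n i \<in> realized w" if "i \<in> S" for i
      using *[of "n - i"] that by (simp add: S D[simplified])
    moreover have "finite S" by (simp add: S)
    ultimately show ?thesis using \<beta> by (intro relations_spanned[of S "n - 1" n w \<beta>]) blast+
  qed
qed

lemma exact: "restr_surj n (n + 1) d \<phi>" "conormal_exact n (n + 1) d \<phi>"
  using restr_surj_if_monomials[OF monomials, of d] conormal_exact_if_weight_exact[OF weight_exact] d4 by auto

end

section \<open>Exactness is an open condition\<close>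

interpretation fun_vs: vector_space "\<lambda>c (f :: 'i \<Rightarrow> 'a::field) i. c * f i"
  by unfold_locales (auto simp: fun_eq_iff algebra_simps)

lemma fun_linearI:
  assumes "\<And>f g. L (\<lambda>i. f i + g i) = (\<lambda>b. L f b + L g b)" "\<And>c f. L (\<lambda>i. c * f i) = (\<lambda>b. c * L f b)"
  shows "Vector_Spaces.linear (\<lambda>c (f :: 'i \<Rightarrow> 'a::field) i. c * f i) (\<lambda>c (f :: 'b \<Rightarrow> 'a) i. c * f i) L"
  by unfold_locales (use assms in \<open>auto simp: plus_fun_def algebra_simps\<close>)

interpretation fun_vs_pair: vector_space_pair "\<lambda>c (f :: 'i \<Rightarrow> 'a::field) i. c * f i" "\<lambda>c (f :: 'b \<Rightarrow> 'a::field) i. c * f i"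
  by unfold_locales

text \<open>
  A basis of \<open>W\<close> is mapped to an independent subset of \<open>W\<close> of the same cardinality, which must span.
\<close>

lemma finite_dim_inj_imp_surj:
  fixes T :: "('i \<Rightarrow> 'a::field) \<Rightarrow> 'i \<Rightarrow> 'a"
  assumes lin: "Vector_Spaces.linear (\<lambda>c (f :: 'i \<Rightarrow> 'a::field) i. c * f i) (\<lambda>c f i. c * f i) T"
    and W: "fun_vs.subspace W" and S: "finite S" "W \<subseteq> fun_vs.span S"
    and TW: "T ` W \<subseteq> W" and inj: "inj_on T W"
  shows "W \<subseteq> T ` W"
proof
  fix y assume y: "y \<in> W"
  obtain B where B: "B \<subseteq> W" "fun_vs.independent B" "W \<subseteq> fun_vs.span B"
    using fun_vs.maximal_independent_subset[of W] by metis
  have spB: "fun_vs.span B = W" using B W fun_vs.span_minimal by blast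
  have finB: "finite B" using fun_vs.independent_span_bound[OF S(1) B(2)] B(1) S(2) by blast
  have ind: "fun_vs.independent (T ` B)"
    using fun_vs_pair.linear_independent_injective_image[OF lin B(2)] inj by (simp add: spB)
  have card: "card (T ` B) = card B" using inj_on_subset[OF inj B(1)] by (rule card_image)
  have TB: "T ` B \<subseteq> fun_vs.span B" using TW B(1) spB by blast
  have "y \<in> fun_vs.span (T ` B)"
  proof (rule ccontr)
    assume n: "y \<notin> fun_vs.span (T ` B)"
    hence "fun_vs.independent (insert y (T ` B))" using ind by (intro fun_vs.independent_insertI)
    moreover have "insert y (T ` B) \<subseteq> fun_vs.span B" using TB y spB by blast
    ultimately have "card (insert y (T ` B)) \<le> card B"
      using fun_vs.independent_span_bound[OF finB] by blast
    moreover have "y \<notin> T ` B" using n fun_vs.span_base by blast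
    ultimately show False using card finB by simp
  qed
  thus "y \<in> T ` W" using fun_vs_pair.linear_span_image[OF lin, of B] spB by simp
qed

text \<open>
  The family of complexes \<open>forms \<rightarrow> 'i \<Rightarrow> 'a \<rightarrow> 'b \<Rightarrow> 'a\<close> with maps \<open>J A\<close>, \<open>E A\<close> is exact in the middle at \<open>A0\<close>.
  Choosing a generalized inverse \<open>r\<close> of \<open>E A0\<close> one gets a square matrix \<open>T A = J A + r (E A)\<close> which is the
  identity at \<open>A0\<close>. Wherever its determinant does not vanish, \<open>T A\<close> restricts to an injective, hence
  surjective, endomorphism of the kernel of \<open>E A\<close>, and on this kernel it takes values in the image of \<open>J A\<close>.
\<close>

lemma exactness_is_open:
  fixes J :: "'p \<Rightarrow> 'f \<Rightarrow> 'i \<Rightarrow> 'a::field" and E :: "'p \<Rightarrow> 'b \<Rightarrow> 'i \<Rightarrow> 'a"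
  assumes fin: "finite I" "finite B"
    and pf: "\<And>c. (\<lambda>A. c) \<in> PF" "\<And>f g. f \<in> PF \<Longrightarrow> g \<in> PF \<Longrightarrow> (\<lambda>A. f A + g A) \<in> PF"
      "\<And>f g. f \<in> PF \<Longrightarrow> g \<in> PF \<Longrightarrow> (\<lambda>A. f A * g A) \<in> PF"
    and Jpf: "\<And>F i. F \<in> X \<Longrightarrow> i \<in> I \<Longrightarrow> (\<lambda>A. J A F i) \<in> PF"
    and Epf: "\<And>b i. b \<in> B \<Longrightarrow> i \<in> I \<Longrightarrow> (\<lambda>A. E A b i) \<in> PF"
    and EJ: "\<And>A F b. F \<in> X \<Longrightarrow> b \<in> B \<Longrightarrow> (\<Sum>i\<in>I. E A b i * J A F i) = 0"
    and comb: "\<And>c Fs. (\<And>k. k \<in> I \<Longrightarrow> Fs k \<in> X) \<Longrightarrow>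
       \<exists>G\<in>X. \<forall>A. \<forall>i\<in>I. J A G i = (\<Sum>k\<in>I. c k * J A (Fs k) i)"
    and ex0: "\<And>y. (\<And>b. b \<in> B \<Longrightarrow> (\<Sum>i\<in>I. E A0 b i * y i) = 0) \<Longrightarrow> \<exists>F\<in>X. \<forall>i\<in>I. J A0 F i = y i"
  obtains \<Delta> where "\<Delta> \<in> PF" "\<Delta> A0 \<noteq> 0"
    "\<And>A y. \<Delta> A \<noteq> 0 \<Longrightarrow> (\<And>b. b \<in> B \<Longrightarrow> (\<Sum>i\<in>I. E A b i * y i) = 0) \<Longrightarrow> \<exists>F\<in>X. \<forall>i\<in>I. J A F i = y i"
proof -
  define L where "L A v = (\<lambda>b. if b \<in> B then \<Sum>i\<in>I. E A b i * v i else 0)" for A and v :: "'i \<Rightarrow> 'a"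
  have linL: "Vector_Spaces.linear (\<lambda>c f i. c * f i) (\<lambda>c f i. c * f i) (L A)" for A
    by (rule fun_linearI) (auto simp: L_def fun_eq_iff algebra_simps sum.distrib sum_distrib_left)
  obtain R where R: "Vector_Spaces.linear (\<lambda>c f i. c * f i) (\<lambda>c f i. c * f i) R" "\<And>v. L A0 (R (L A0 v)) = L A0 v"
    using fun_vs_pair.linear_exists_right_inverse_on[OF linL[of A0] fun_vs.subspace_UNIV] by auto
  \<comment> \<open>The columns of a generalized inverse of \<open>E A0\<close>.\<close>
  define r where "r b = R (\<lambda>b'. if b' = b then 1 else 0)" for b
  have R_expand: "R u i = (\<Sum>b\<in>B. u b * r b i)" if "\<And>b. b \<notin> B \<Longrightarrow> u b = 0" for u i
  proof -
    have "u = (\<Sum>b\<in>B. (\<lambda>b'. u b * (if b' = b then 1 else 0)))"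
    proof
      fix b'
      have "(\<Sum>b\<in>B. (\<lambda>b'. u b * (if b' = b then 1 else 0))) b' = (\<Sum>b\<in>B. if b' = b then u b else 0)"
        unfolding sum_apply by (intro sum.cong) auto
      thus "u b' = (\<Sum>b\<in>B. (\<lambda>b'. u b * (if b' = b then 1 else 0))) b'" using that fin by simp
    qed
    hence "R u = R (\<Sum>b\<in>B. (\<lambda>b'. u b * (if b' = b then 1 else 0)))" by simp
    also have "\<dots> = (\<Sum>b\<in>B. R (\<lambda>b'. u b * (if b' = b then 1 else 0)))"
      by (rule fun_vs_pair.linear_sum[OF R(1)])
    also have "\<dots> = (\<Sum>b\<in>B. (\<lambda>i. u b * r b i))"
      unfolding r_def by (intro sum.cong refl fun_vs_pair.linear_scale[OF R(1)])
    finally show ?thesis by (simp add: sum_apply)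
  qed
  let ?e = "\<lambda>k i. if i = k then (1::'a) else 0"
  have "\<forall>k\<in>I. \<exists>F. F \<in> X \<and> (\<forall>i\<in>I. J A0 F i = ?e k i - R (L A0 (?e k)) i)"
  proof
    fix k assume "k \<in> I"
    have "\<exists>F\<in>X. \<forall>i\<in>I. J A0 F i = ?e k i - R (L A0 (?e k)) i"
    proof (rule ex0)
      fix b assume b: "b \<in> B"
      have "L A0 (R (L A0 (?e k))) b = L A0 (?e k) b" using R(2) by simp
      thus "(\<Sum>i\<in>I. E A0 b i * (?e k i - R (L A0 (?e k)) i)) = 0"
        using b by (simp add: L_def right_diff_distrib sum_subtractf)
    qed
    thus "\<exists>F. F \<in> X \<and> (\<forall>i\<in>I. J A0 F i = ?e k i - R (L A0 (?e k)) i)" by blast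
  qed
  then obtain Fs where Fs: "\<And>k. k \<in> I \<Longrightarrow> Fs k \<in> X"
    "\<And>k i. k \<in> I \<Longrightarrow> i \<in> I \<Longrightarrow> J A0 (Fs k) i = ?e k i - R (L A0 (?e k)) i"
    using bchoice[of I "\<lambda>k F. F \<in> X \<and> (\<forall>i\<in>I. J A0 F i = ?e k i - R (L A0 (?e k)) i)"] by blast
  define T where "T A i k = J A (Fs k) i + (\<Sum>b\<in>B. E A b k * r b i)" for A i k
  have Lk: "L A (?e k) b = E A b k" if "k \<in> I" "b \<in> B" for A k b
  proof -
    have "(\<Sum>i\<in>I. E A b i * ?e k i) = (\<Sum>i\<in>I. if i = k then E A b i else 0)" by (intro sum.cong) auto
    thus ?thesis using that fin by (simp add: L_def)
  qed
  have T0: "T A0 i k = ?e k i" if "i \<in> I" "k \<in> I" for i k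
  proof -
    have "R (L A0 (?e k)) i = (\<Sum>b\<in>B. L A0 (?e k) b * r b i)" by (rule R_expand) (simp add: L_def)
    also have "\<dots> = (\<Sum>b\<in>B. E A0 b k * r b i)" using Lk[OF that(2)] by (intro sum.cong) auto
    finally show ?thesis using Fs(2)[OF that(2,1)] by (simp add: T_def)
  qed
  have pf_sum: "(\<lambda>A. \<Sum>x\<in>Y. f x A) \<in> PF" if "\<And>x. x \<in> Y \<Longrightarrow> f x \<in> PF" for Y :: "'x set" and f
    using that by (induction Y rule: infinite_finite_induct) (auto intro: pf)
  have pf_prod: "(\<lambda>A. \<Prod>x\<in>Y. f x A) \<in> PF" if "\<And>x. x \<in> Y \<Longrightarrow> f x \<in> PF" for Y :: "'x set" and f
    using that by (induction Y rule: infinite_finite_induct) (auto intro: pf)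
  have Tpf: "(\<lambda>A. T A i k) \<in> PF" if "i \<in> I" "k \<in> I" for i k
    unfolding T_def using that Fs(1) by (intro pf pf_sum Jpf Epf)
  define N where "N = card I"
  obtain h where h: "bij_betw h {..<N} I" using ex_bij_betw_nat_finite[OF fin(1)] by (auto simp: N_def atLeast0LessThan)
  have hI: "h i \<in> I" if "i < N" for i using h that by (auto simp: bij_betw_def)
  define M where "M A = mat N N (\<lambda>(i, j). T A (h i) (h j))" for A
  define \<Delta> where "\<Delta> A = det (M A)" for A
  have "\<Delta> = (\<lambda>A. \<Sum>p | p permutes {0..<N}. of_int (sign p) * (\<Prod>i = 0..<N. T A (h i) (h (p i))))"
  proof
    fix A
    have "(\<Prod>i = 0..<N. M A $$ (i, p i)) = (\<Prod>i = 0..<N. T A (h i) (h (p i)))" if "p permutes {0..<N}" for p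
    proof (rule prod.cong)
      fix i assume "i \<in> {0..<N}"
      moreover from this have "p i \<in> {0..<N}" using permutes_in_image[OF that] by blast
      ultimately show "M A $$ (i, p i) = T A (h i) (h (p i))" by (simp add: M_def)
    qed simp
    thus "\<Delta> A = (\<Sum>p | p permutes {0..<N}. of_int (sign p) * (\<Prod>i = 0..<N. T A (h i) (h (p i))))"
      unfolding \<Delta>_def det_def by (simp add: M_def)
  qed
  also have "\<dots> \<in> PF"
  proof (intro pf_sum pf(3) pf(1) pf_prod Tpf hI)
    fix p i assume "p \<in> {p. p permutes {0..<N}}" "i \<in> {0..<N}"
    thus "i < N" "p i < N" using permutes_in_image[of p "{0..<N}" i] by auto
  qed
  finally have \<Delta>pf: "\<Delta> \<in> PF" .
  have "M A0 = 1\<^sub>m N"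
  proof (rule eq_matI)
    fix i j assume "i < dim_row (1\<^sub>m N :: 'a mat)" "j < dim_col (1\<^sub>m N :: 'a mat)"
    hence ij: "i < N" "j < N" by auto
    hence "h i = h j \<longleftrightarrow> i = j" using h by (auto simp: bij_betw_def inj_on_def)
    thus "M A0 $$ (i, j) = 1\<^sub>m N $$ (i, j)" using ij by (simp add: M_def T0[OF hI hI])
  qed (auto simp: M_def)
  hence \<Delta>0: "\<Delta> A0 \<noteq> 0" by (simp add: \<Delta>_def)
  have "\<exists>F\<in>X. \<forall>i\<in>I. J A F i = y i"
    if \<Delta>A: "\<Delta> A \<noteq> 0" and y: "\<And>b. b \<in> B \<Longrightarrow> (\<Sum>i\<in>I. E A b i * y i) = 0" for A y
  proof -
    define W where "W = {v. (\<forall>i. i \<notin> I \<longrightarrow> v i = 0) \<and> (\<forall>b\<in>B. (\<Sum>i\<in>I. E A b i * v i) = 0)}"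
    define \<T> where "\<T> v = (\<lambda>i. if i \<in> I then \<Sum>k\<in>I. v k * T A i k else 0)" for v :: "'i \<Rightarrow> 'a"
    have lin: "Vector_Spaces.linear (\<lambda>c f i. c * f i) (\<lambda>c f i. c * f i) \<T>"
      by (rule fun_linearI) (auto simp: \<T>_def fun_eq_iff algebra_simps sum.distrib sum_distrib_left)
    have TJ: "\<T> v i = (\<Sum>k\<in>I. v k * J A (Fs k) i)" if "v \<in> W" "i \<in> I" for v i
    proof -
      have "(\<Sum>k\<in>I. \<Sum>b\<in>B. v k * (E A b k * r b i)) = (\<Sum>b\<in>B. (\<Sum>k\<in>I. E A b k * v k) * r b i)"
        unfolding sum_distrib_right by (subst sum.swap) (intro sum.cong refl, simp add: ac_simps)
      also have "\<dots> = 0" using that(1) by (simp add: W_def)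
      finally show ?thesis using that(2)
        by (simp add: \<T>_def T_def distrib_left sum.distrib sum_distrib_left)
    qed
    have sub: "fun_vs.subspace W"
      by (rule fun_vs.subspaceI) (auto simp: W_def zero_fun_def plus_fun_def algebra_simps sum.distrib
          sum_distrib_left[symmetric] mult.left_commute)
    have "W \<subseteq> fun_vs.span ((\<lambda>k. ?e k) ` I)"
    proof
      fix v assume v: "v \<in> W"
      have "v = (\<Sum>k\<in>I. (\<lambda>i. v k * ?e k i))"
      proof
        fix i
        have "(\<Sum>k\<in>I. (\<lambda>i. v k * ?e k i)) i = (\<Sum>k\<in>I. if i = k then v k else 0)"
          unfolding sum_apply by (intro sum.cong) auto
        thus "v i = (\<Sum>k\<in>I. (\<lambda>i. v k * ?e k i)) i" using v fin by (simp add: W_def)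
      qed
      also have "\<dots> \<in> fun_vs.span ((\<lambda>k. ?e k) ` I)"
        by (intro fun_vs.span_sum fun_vs.span_scale fun_vs.span_base) auto
      finally show "v \<in> fun_vs.span ((\<lambda>k. ?e k) ` I)" .
    qed
    moreover have "\<T> ` W \<subseteq> W"
    proof clarify
      fix v assume v: "v \<in> W"
      obtain G where G: "G \<in> X" "\<And>A i. i \<in> I \<Longrightarrow> J A G i = (\<Sum>k\<in>I. v k * J A (Fs k) i)"
        using comb[of Fs v] Fs(1) by blast
      have "(\<Sum>i\<in>I. E A b i * \<T> v i) = 0" if "b \<in> B" for b
        using EJ[OF G(1) that, of A] by (simp add: TJ[OF v] G(2) cong: sum.cong)
      thus "\<T> v \<in> W" by (simp add: W_def \<T>_def)
    qed
    moreover have "inj_on \<T> W"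
    proof (rule inj_onI)
      fix v w assume vw: "v \<in> W" "w \<in> W" "\<T> v = \<T> w"
      define x where "x = vec N (\<lambda>j. v (h j) - w (h j))"
      have "M A *\<^sub>v x = 0\<^sub>v N"
      proof (rule eq_vecI)
        fix i assume "i < dim_vec (0\<^sub>v N :: 'a vec)"
        hence i: "i < N" by simp
        have "(M A *\<^sub>v x) $ i = (\<Sum>j = 0..<N. T A (h i) (h j) * (v (h j) - w (h j)))"
          using i by (simp add: M_def x_def scalar_prod_def)
        also have "\<dots> = (\<Sum>k\<in>I. T A (h i) k * (v k - w k))"
          using sum.reindex_bij_betw[OF h, of "\<lambda>k. T A (h i) k * (v k - w k)"] by (simp add: atLeast0LessThan)
        also have "\<dots> = \<T> v (h i) - \<T> w (h i)"
          using hI[OF i] by (simp add: \<T>_def right_diff_distrib left_diff_distrib sum_subtractf mult.commute)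
        finally show "(M A *\<^sub>v x) $ i = 0\<^sub>v N $ i" using vw(3) i by simp
      qed (simp add: M_def)
      moreover have "M A \<in> carrier_mat N N" "x \<in> carrier_vec N" by (auto simp: M_def x_def)
      ultimately have "x = 0\<^sub>v N" using det_0_iff_vec_prod_zero_field[of "M A" N] \<Delta>A unfolding \<Delta>_def by blast
      hence x0: "v (h j) = w (h j)" if "j < N" for j using that by (auto simp: x_def vec_eq_iff)
      show "v = w"
      proof
        fix i
        show "v i = w i"
        proof (cases "i \<in> I")
          case True
          then obtain j where "j < N" "i = h j" using h by (auto simp: bij_betw_def)
          thus ?thesis using x0 by simp
        qed (use vw in \<open>auto simp: W_def\<close>)
      qed
    qed
    ultimately have surj: "W \<subseteq> \<T> ` W"
      using fin by (intro finite_dim_inj_imp_surj[OF lin sub, of "(\<lambda>k. ?e k) ` I"]) auto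
    have "(\<lambda>i. if i \<in> I then y i else 0) \<in> W" using y by (simp add: W_def cong: sum.cong)
    hence "(\<lambda>i. if i \<in> I then y i else 0) \<in> \<T> ` W" using surj by (rule rev_subsetD)
    then obtain v where v: "v \<in> W" "\<T> v = (\<lambda>i. if i \<in> I then y i else 0)" by (elim imageE) simp
    obtain G where "G \<in> X" "\<And>A i. i \<in> I \<Longrightarrow> J A G i = (\<Sum>k\<in>I. v k * J A (Fs k) i)"
      using comb[of Fs v] Fs(1) by blast
    moreover have "y i = (\<Sum>k\<in>I. v k * J A (Fs k) i)" if "i \<in> I" for i
      using TJ[OF v(1) that] that by (simp add: v(2))
    ultimately show ?thesis by auto
  qed
  thus ?thesis by (rule that[OF \<Delta>pf \<Delta>0])
qed

section \<open>Polynomial functions of a coefficient matrix\<close>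

definition polyfun :: "nat \<Rightarrow> nat \<Rightarrow> ('a::comm_ring_1 mat \<Rightarrow> 'a) set" where
  "polyfun n e = {f. \<exists>P. mp_in ({..n} \<times> {..e}) P \<and> (\<forall>A. mp_eval P (\<lambda>ij. A $$ ij) = f A)}"

lemma polyfun_const: "(\<lambda>A. c) \<in> polyfun n e"
  unfolding polyfun_def by (auto intro!: exI[of _ "Const c"] simp: mp_in_Const mp_eval_simps)

lemma polyfun_entry: "i \<le> n \<Longrightarrow> j \<le> e \<Longrightarrow> (\<lambda>A. A $$ (i, j)) \<in> polyfun n e"
  unfolding polyfun_def
  by (intro CollectI exI[of _ "Var (i, j)"]) (simp add: mp_in_Var mp_eval_simps del: One_nat_def)

lemma polyfun_add: "f \<in> polyfun n e \<Longrightarrow> g \<in> polyfun n e \<Longrightarrow> (\<lambda>A. f A + g A) \<in> polyfun n e"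
  unfolding polyfun_def
proof clarify
  fix P Q :: "(nat \<times> nat, 'a) mp" assume "mp_in ({..n} \<times> {..e}) P" "\<forall>A. mp_eval P (($$) A) = f A"
    "mp_in ({..n} \<times> {..e}) Q" "\<forall>A. mp_eval Q (($$) A) = g A"
  thus "\<exists>P. mp_in ({..n} \<times> {..e}) P \<and> (\<forall>A. mp_eval P (($$) A) = f A + g A)"
    by (intro exI[of _ "P + Q"]) (simp add: mp_in_add mp_eval_simps)
qed

lemma polyfun_mult: "f \<in> polyfun n e \<Longrightarrow> g \<in> polyfun n e \<Longrightarrow> (\<lambda>A. f A * g A) \<in> polyfun n e"
  unfolding polyfun_def
proof clarify
  fix P Q :: "(nat \<times> nat, 'a) mp" assume "mp_in ({..n} \<times> {..e}) P" "\<forall>A. mp_eval P (($$) A) = f A"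
    "mp_in ({..n} \<times> {..e}) Q" "\<forall>A. mp_eval Q (($$) A) = g A"
  thus "\<exists>P. mp_in ({..n} \<times> {..e}) P \<and> (\<forall>A. mp_eval P (($$) A) = f A * g A)"
    by (intro exI[of _ "P * Q"]) (simp add: mp_in_mult mp_eval_simps)
qed

lemma polyfun_sum: "(\<And>x. x \<in> Y \<Longrightarrow> f x \<in> polyfun n e) \<Longrightarrow> (\<lambda>A. \<Sum>x\<in>Y. f x A) \<in> polyfun n e"
  by (induction Y rule: infinite_finite_induct) (auto intro: polyfun_const polyfun_add)

lemma polyfun_coeff_mult:
  assumes "\<And>k. (\<lambda>A. coeff (p A) k) \<in> polyfun n e" "\<And>k. (\<lambda>A. coeff (q A) k) \<in> polyfun n e"
  shows "(\<lambda>A. coeff (p A * q A) k) \<in> polyfun n e"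
  unfolding coeff_mult by (intro polyfun_sum polyfun_mult assms)

lemma polyfun_coord: "i \<le> n \<Longrightarrow> (\<lambda>A. coeff (coord e A i) k) \<in> polyfun n e"
  by (cases "k \<le> e") (simp_all add: coeff_coord polyfun_entry polyfun_const)

lemma polyfun_pullback:
  assumes "mp_in {..n} F" shows "(\<lambda>A. coeff (pullback (coord e A) F) k) \<in> polyfun n e"
  using assms
proof (induction F arbitrary: k rule: mp_induct)
  case (Const c)
  show ?case by (simp add: pullback_simps polyfun_const)
next
  case (Var i)
  thus ?case by (simp add: pullback_simps polyfun_coord del: One_nat_def)
next
  case (add F G)
  thus ?case by (simp add: pullback_simps polyfun_add)
next
  case (mult F G)
  thus ?case unfolding pullback_simps by (intro polyfun_coeff_mult)
qed

section \<open>Exactness for general curves\<close>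

lemma poly_eqI_bounded:
  assumes "degree p \<le> N" "degree q \<le> N" "\<And>k. k \<le> N \<Longrightarrow> coeff p k = coeff q k"
  shows "p = q"
proof (rule poly_eqI)
  fix k
  show "coeff p k = coeff q k" using assms by (cases "k \<le> N") (auto simp: coeff_eq_0)
qed

lemma degree_pderiv_le: "degree (pderiv p) \<le> degree p"
  by (rule degree_le) (simp add: coeff_pderiv coeff_eq_0)

text \<open>
  Exactness of the complex of forms, binary forms of degree \<open>e d\<close> and zero.
\<close>

lemma restr_surj_open:
  fixes A0 :: "'a::alg_closed_field mat"
  assumes "restr_surj n e d (coord e A0)"
  obtains \<Delta> where "\<Delta> \<in> polyfun n e" "\<Delta> A0 \<noteq> 0" "\<And>A. \<Delta> A \<noteq> 0 \<Longrightarrow> restr_surj n e d (coord e A)"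
proof -
  have comb: "\<exists>G\<in>{F. form n d F}. \<forall>A. \<forall>i\<in>{..e * d}. coeff (pullback (coord e A) G) i =
      (\<Sum>k\<in>{..e * d}. c k * coeff (pullback (coord e A) (Fs k)) i)"
    if "\<And>k. k \<in> {..e * d} \<Longrightarrow> Fs k \<in> {F. form n d F}" for c :: "nat \<Rightarrow> 'a" and Fs
    using that by (intro bexI[of _ "\<Sum>k\<le>e * d. Const (c k) * Fs k"])
      (auto simp: pullback_simps coeff_sum intro!: form_sum form_smult)
  have ex0: "\<exists>F\<in>{F. form n d F}. \<forall>i\<in>{..e * d}. coeff (pullback (coord e A0) F) i = y i" for y
  proof -
    let ?f = "\<Sum>j\<le>e * d. monom (y j) j"
    have "degree ?f \<le> e * d" by (intro degree_sum_le) (auto intro: order_trans[OF degree_monom_le])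
    then obtain F where "form n d F" "pullback (coord e A0) F = ?f" using assms unfolding restr_surj_def by blast
    thus ?thesis by (intro bexI[of _ F]) (auto simp: coeff_sum)
  qed
  obtain \<Delta> where \<Delta>: "\<Delta> \<in> polyfun n e" "\<Delta> A0 \<noteq> 0"
    "\<And>A y. \<Delta> A \<noteq> 0 \<Longrightarrow> \<exists>F\<in>{F. form n d F}. \<forall>i\<in>{..e * d}. coeff (pullback (coord e A) F) i = y i"
    by (rule exactness_is_open[of "{..e * d}" "{} :: nat set" "polyfun n e" "{F. form n d F}"
          "\<lambda>A F i. coeff (pullback (coord e A) F) i" "\<lambda>A b i. 0" A0])
       (use comb ex0 in \<open>auto intro: polyfun_const polyfun_add polyfun_mult polyfun_pullback form_mp_in\<close>)
  have "restr_surj n e d (coord e A)" if "\<Delta> A \<noteq> 0" for A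
    unfolding restr_surj_def
  proof (intro allI impI)
    fix f :: "'a poly" assume f: "degree f \<le> e * d"
    note \<Delta>A = that
    obtain F where F: "form n d F" "\<forall>i\<in>{..e * d}. coeff (pullback (coord e A) F) i = coeff f i"
      using \<Delta>(3)[OF \<Delta>A, of "coeff f"] by blast
    have "degree (pullback (coord e A) F) \<le> e * d" by (rule pullback_form(1)[OF F(1)]) (rule degree_coord)
    hence "pullback (coord e A) F = f" using F(2) f by (intro poly_eqI_bounded[of _ "e * d"]) auto
    thus "\<exists>F. form n d F \<and> pullback (coord e A) F = f" using F(1) by blast
  qed
  thus ?thesis using that \<Delta>(1,2) by blast
qed

text \<open>
  The space of forms vanishing on the curve varies with the curve, the space of all forms does not. Therefore exactness for the conormal sections is combined with surjectivity of
  restriction into exactness of a complex with varying maps between fixed spaces: a pair \<open>(f, g)\<close> comes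
  from a form iff \<open>d f = \<Sum> g i * \<phi> i\<close> (Euler) and \<open>f' = \<Sum> g i * \<phi> i'\<close> (chain rule).
\<close>

lemma conormal_exact_open:
  fixes A0 :: "'a::alg_closed_field mat"
  assumes restr: "restr_surj n e d (coord e A0)" and exact: "conormal_exact n e d (coord e A0)" and d: "d \<ge> 1"
  obtains \<Delta> where "\<Delta> \<in> polyfun n e" "\<Delta> A0 \<noteq> 0" "\<And>A. \<Delta> A \<noteq> 0 \<Longrightarrow> conormal_exact n e d (coord e A)"
proof -
  define D where "D = e * (d - 1)"
  define I where "I = {..e * d} <+> ({..n} \<times> {..D})"
  define K where "K = {..e * d} <+> {..e * d}"
  define J where "J A F x = (case x of Inl k \<Rightarrow> coeff (pullback (coord e A) F) k
      | Inr (i, k) \<Rightarrow> coeff (pullback (coord e A) (pd i F)) k)"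
    for A :: "'a mat" and F and x :: "nat + nat \<times> nat"
  define E where "E A b x = (case b of
        Inl k \<Rightarrow> (case x of Inl j \<Rightarrow> coeff (monom (of_nat d) j) k | Inr (i, j) \<Rightarrow> - coeff (monom 1 j * coord e A i) k)
      | Inr k \<Rightarrow> (case x of Inl j \<Rightarrow> coeff (pderiv (monom 1 j)) k | Inr (i, j) \<Rightarrow> - coeff (monom 1 j * pderiv (coord e A i)) k))"
    for A :: "'a mat" and b :: "nat + nat" and x :: "nat + nat \<times> nat"
  define f where "f y = (\<Sum>j\<le>e * d. monom (y (Inl j)) j)" for y :: "nat + nat \<times> nat \<Rightarrow> 'a"
  define g where "g y i = (\<Sum>j\<le>D. monom (y (Inr (i, j))) j)" for y :: "nat + nat \<times> nat \<Rightarrow> 'a" and i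
  have split: "(\<Sum>x\<in>I. h x) = (\<Sum>j\<le>e * d. h (Inl j)) + (\<Sum>i\<le>n. \<Sum>j\<le>D. h (Inr (i, j)))"
    for h :: "nat + nat \<times> nat \<Rightarrow> 'a"
    unfolding I_def by (subst sum.Plus) (simp_all add: sum.cartesian_product)
  have mon: "monom c j = Polynomial.smult c (monom 1 j)" for c :: 'a and j by (simp add: smult_monom)
  have euler: "(\<Sum>x\<in>I. E A (Inl k) x * y x) = coeff (of_nat d * f y - (\<Sum>i\<le>n. g y i * coord e A i)) k" for A k y
  proof -
    have "coeff (of_nat d * f y) k = (\<Sum>j\<le>e * d. coeff (monom (of_nat d) j) k * y (Inl j))"
      unfolding f_def sum_distrib_left coeff_sum by (intro sum.cong refl) (simp add: of_nat_poly)
    moreover have "coeff (\<Sum>i\<le>n. g y i * coord e A i) k =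
        (\<Sum>i\<le>n. \<Sum>j\<le>D. coeff (monom 1 j * coord e A i) k * y (Inr (i, j)))"
      unfolding g_def sum_distrib_right coeff_sum
      by (intro sum.cong refl) (subst mon, simp add: mult.commute)
    ultimately show ?thesis unfolding split by (simp add: E_def sum_negf)
  qed
  have chain: "(\<Sum>x\<in>I. E A (Inr k) x * y x) = coeff (pderiv (f y) - (\<Sum>i\<le>n. g y i * pderiv (coord e A i))) k" for A k y
  proof -
    have "coeff (pderiv (f y)) k = (\<Sum>j\<le>e * d. coeff (pderiv (monom 1 j)) k * y (Inl j))"
      unfolding f_def pderiv_sum coeff_sum
      by (intro sum.cong refl) (subst mon, simp add: pderiv_smult mult.commute)
    moreover have "coeff (\<Sum>i\<le>n. g y i * pderiv (coord e A i)) k =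
        (\<Sum>i\<le>n. \<Sum>j\<le>D. coeff (monom 1 j * pderiv (coord e A i)) k * y (Inr (i, j)))"
      unfolding g_def sum_distrib_right coeff_sum
      by (intro sum.cong refl) (subst mon, simp add: mult.commute)
    ultimately show ?thesis unfolding split by (simp add: E_def sum_negf)
  qed
  have deg: "degree (pullback (coord e A) F) \<le> e * d" "degree (pullback (coord e A) (pd i F)) \<le> D"
    if "form n d F" for A :: "'a mat" and F i
    using pullback_form(1)[OF that, of "coord e A" e] pullback_form(1)[OF form_pd[OF that], of "coord e A" e i]
      degree_coord unfolding D_def by auto
  have fJ: "f (J A F) = pullback (coord e A) F" if "form n d F" for A F
    using poly_as_sum_of_monoms'[OF deg(1)[OF that]] by (simp add: f_def J_def)
  have gJ: "g (J A F) i = pullback (coord e A) (pd i F)" if "form n d F" for A F i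
    using poly_as_sum_of_monoms'[OF deg(2)[OF that]] by (simp add: g_def J_def)
  have jets: "of_nat d * pullback (coord e A) F = (\<Sum>i\<le>n. pullback (coord e A) (pd i F) * coord e A i)"
    "pderiv (pullback (coord e A) F) = (\<Sum>i\<le>n. pullback (coord e A) (pd i F) * pderiv (coord e A i))"
    if "form n d F" for A :: "'a mat" and F
    using geval_euler[OF comm_ring_hom_pCons that, of "coord e A"]
      pderiv_geval[OF form_mp_in[OF that] finite_atMost, of "coord e A"] by (simp_all add: mult.commute)
  have EJ: "(\<Sum>x\<in>I. E A b x * J A F x) = 0" if "F \<in> {F. form n d F}" for A F b
    using that jets[of F A] by (cases b) (simp_all add: euler chain fJ gJ)
  have comb: "\<exists>G\<in>{F. form n d F}. \<forall>A. \<forall>x\<in>I. J A G x = (\<Sum>k\<in>I. c k * J A (Fs k) x)"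
    if "\<And>k. k \<in> I \<Longrightarrow> Fs k \<in> {F. form n d F}" for c :: "nat + nat \<times> nat \<Rightarrow> 'a" and Fs
    using that by (intro bexI[of _ "\<Sum>k\<in>I. Const (c k) * Fs k"])
      (auto simp: J_def pullback_simps coeff_sum pd_sum pd_Const_mult split: sum.split intro!: form_sum form_smult)
  have ex0: "\<exists>F\<in>{F. form n d F}. \<forall>x\<in>I. J A0 F x = y x"
    if y: "\<And>b. b \<in> K \<Longrightarrow> (\<Sum>x\<in>I. E A0 b x * y x) = 0" for y
  proof -
    let ?\<phi> = "coord e A0"
    have degf: "degree (f y) \<le> e * d" unfolding f_def
      by (intro degree_sum_le) (auto intro: order_trans[OF degree_monom_le])
    have degg: "degree (g y i) \<le> D" for i unfolding g_def
      by (intro degree_sum_le) (auto intro: order_trans[OF degree_monom_le])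
    have De: "D + e = e * d" using d by (cases d) (auto simp: D_def)
    have prod: "degree (g y i * q) \<le> e * d" if "degree q \<le> e" for i q
      using degree_mult_le[of "g y i" q] degg[of i] that De by linarith
    have "degree (of_nat d * f y) \<le> e * d" using degf by (simp add: of_nat_poly order_trans[OF degree_smult_le])
    hence "degree (of_nat d * f y - (\<Sum>i\<le>n. g y i * ?\<phi> i)) \<le> e * d"
      by (intro degree_diff_le degree_sum_le prod degree_coord) auto
    hence 1: "of_nat d * f y - (\<Sum>i\<le>n. g y i * ?\<phi> i) = 0"
      using y[of "Inl _"] unfolding euler K_def by (intro poly_eqI_bounded[of _ "e * d"]) auto
    have "degree (pderiv (f y) - (\<Sum>i\<le>n. g y i * pderiv (?\<phi> i))) \<le> e * d"
      using degf degree_coord[of e A0]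
      by (intro degree_diff_le degree_sum_le prod order_trans[OF degree_pderiv_le]) auto
    hence 2: "pderiv (f y) - (\<Sum>i\<le>n. g y i * pderiv (?\<phi> i)) = 0"
      using y[of "Inr _"] unfolding chain K_def by (intro poly_eqI_bounded[of _ "e * d"]) auto
    \<comment> \<open>Subtracting the jet of a form restricting to \<open>f y\<close> leaves a section of the conormal bundle.\<close>
    obtain F1 where F1: "form n d F1" "pullback ?\<phi> F1 = f y" using restr degf unfolding restr_surj_def by blast
    define g' where "g' i = g y i - pullback ?\<phi> (pd i F1)" for i
    have "\<forall>i\<le>n. degree (g' i) \<le> e * (d - 1)"
      unfolding g'_def D_def[symmetric] using degg deg(2)[OF F1(1)] by (intro allI impI degree_diff_le) auto
    moreover have "(\<Sum>i\<le>n. g' i * ?\<phi> i) = 0"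
      using 1 jets(1)[OF F1(1), of A0] by (simp add: g'_def F1(2) left_diff_distrib sum_subtractf)
    moreover have "(\<Sum>i\<le>n. g' i * pderiv (?\<phi> i)) = 0"
      using 2 jets(2)[OF F1(1), of A0] by (simp add: g'_def F1(2) left_diff_distrib sum_subtractf)
    ultimately obtain F2 where F2: "form n d F2" "pullback ?\<phi> F2 = 0" "\<And>i. i \<le> n \<Longrightarrow> pullback ?\<phi> (pd i F2) = g' i"
      using exact unfolding conormal_exact_def by blast
    have "J A0 (F1 + F2) x = y x" if "x \<in> I" for x
      using that F1(2) F2(2,3)
      by (auto simp: I_def J_def pullback_simps pd_add g'_def f_def g_def coeff_sum)
    thus ?thesis using form_add[OF F1(1) F2(1)] by blast
  qed
  have pJ: "(\<lambda>A. J A F x) \<in> polyfun n e" if "F \<in> {F. form n d F}" for F x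
  proof (cases x)
    case (Inl k)
    thus ?thesis using that by (auto simp: J_def intro!: polyfun_pullback form_mp_in)
  next
    case (Inr ik)
    thus ?thesis using that form_mp_in[of n d F]
      by (cases ik) (auto simp: J_def intro!: polyfun_pullback mp_in_pd)
  qed
  have neg: "(\<lambda>A. - h A) \<in> polyfun n e" if "h \<in> polyfun n e" for h :: "'a mat \<Rightarrow> 'a"
    using polyfun_mult[OF polyfun_const[of "-1"] that] by simp
  have pE: "(\<lambda>A. E A b x) \<in> polyfun n e" if "x \<in> I" for b x
  proof -
    have p: "(\<lambda>A. coeff (monom 1 j * coord e A i) k) \<in> polyfun n e"
      "(\<lambda>A. coeff (monom 1 j * pderiv (coord e A i)) k) \<in> polyfun n e" if "i \<le> n" for i j k
      using that
      by (auto intro!: polyfun_coeff_mult polyfun_const polyfun_coord polyfun_mult simp: coeff_pderiv)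
    show ?thesis
    proof (cases x)
      case (Inl j)
      thus ?thesis by (cases b) (simp_all add: E_def polyfun_const)
    next
      case (Inr ij)
      obtain i j where ij: "ij = (i, j)" by (cases ij)
      hence "i \<le> n" using that Inr by (auto simp: I_def)
      thus ?thesis using Inr ij p[of i j] by (cases b) (auto simp: E_def intro!: neg)
    qed
  qed
  obtain \<Delta> where \<Delta>: "\<Delta> \<in> polyfun n e" "\<Delta> A0 \<noteq> 0"
    "\<And>A y. \<Delta> A \<noteq> 0 \<Longrightarrow> (\<And>b. b \<in> K \<Longrightarrow> (\<Sum>x\<in>I. E A b x * y x) = 0) \<Longrightarrow>
        \<exists>F\<in>{F. form n d F}. \<forall>x\<in>I. J A F x = y x"
  proof (rule exactness_is_open[of I K "polyfun n e" "{F. form n d F}" J E A0])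
    show "finite I" "finite K" by (simp_all add: I_def K_def)
    show "\<And>F x. F \<in> {F. form n d F} \<Longrightarrow> x \<in> I \<Longrightarrow> (\<lambda>A. J A F x) \<in> polyfun n e" by (rule pJ)
    show "\<And>b x. b \<in> K \<Longrightarrow> x \<in> I \<Longrightarrow> (\<lambda>A. E A b x) \<in> polyfun n e" by (rule pE)
    show "\<And>A F b. F \<in> {F. form n d F} \<Longrightarrow> b \<in> K \<Longrightarrow> (\<Sum>x\<in>I. E A b x * J A F x) = 0" by (rule EJ)
  qed (fact polyfun_const polyfun_add polyfun_mult comb ex0 | assumption | rule polyfun_const polyfun_add polyfun_mult comb ex0 | blast)+
  have "conormal_exact n e d (coord e A)" if "\<Delta> A \<noteq> 0" for A
    unfolding conormal_exact_def
  proof (intro allI impI)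
    note \<Delta>A = that
    fix h assume h: "\<forall>i\<le>n. degree (h i) \<le> e * (d - 1)" "(\<Sum>i\<le>n. h i * coord e A i) = 0"
      "(\<Sum>i\<le>n. h i * pderiv (coord e A i)) = 0"
    define y where "y x = (case x of Inl k \<Rightarrow> 0 | Inr (i, k) \<Rightarrow> coeff (h i) k)" for x :: "nat + nat \<times> nat"
    have "f y = 0" by (simp add: f_def y_def)
    moreover have "g y i = h i" if "i \<le> n" for i
      using poly_as_sum_of_monoms'[of "h i" D] h(1) that by (simp add: g_def y_def D_def)
    ultimately have "(\<Sum>x\<in>I. E A b x * y x) = 0" for b
      using h(2,3) by (cases b) (simp_all add: euler chain)
    then obtain F where F: "form n d F" "\<forall>x\<in>I. J A F x = y x" using \<Delta>(3)[OF \<Delta>A, of y] by blast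
    have "pullback (coord e A) F = 0"
    proof (rule poly_eqI)
      fix k
      show "coeff (pullback (coord e A) F) k = coeff 0 k"
        using F(2)[rule_format, of "Inl k"] deg(1)[OF F(1), of A]
        by (cases "k \<le> e * d") (auto simp: I_def J_def y_def coeff_eq_0)
    qed
    moreover have "pullback (coord e A) (pd i F) = h i" if i: "i \<le> n" for i
    proof (rule poly_eqI)
      fix k
      show "coeff (pullback (coord e A) (pd i F)) k = coeff (h i) k"
      proof (cases "k \<le> D")
        case True
        thus ?thesis using F(2)[rule_format, of "Inr (i, k)"] i by (auto simp: I_def J_def y_def)
      next
        case False
        moreover have "degree (h i) \<le> D" using h(1) i by (simp add: D_def)
        ultimately show ?thesis using deg(2)[OF F(1), of A i] by (simp add: coeff_eq_0)
      qed
    qed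
    ultimately show "\<exists>F. form n d F \<and> pullback (coord e A) F = 0 \<and> (\<forall>i\<le>n. pullback (coord e A) (pd i F) = h i)"
      using F(1) by blast
  qed
  thus ?thesis using that \<Delta>(1,2) by blast
qed

lemma conormal_map_surj_if_matrix_exact:
  fixes A :: "'a::alg_closed_field mat"
  assumes A: "A \<in> carrier_mat (n + 1) (e + 1)" and "e \<ge> 1" "d \<ge> 1"
    and "restr_surj n e d (coord e A)" "conormal_exact n e d (coord e A)"
  shows "conormal_map_surj n (P1_image e A) d"
proof -
  interpret parametrized_curve n e d "coord e A"
    using assms by unfold_locales (auto simp: degree_coord)
  show ?thesis unfolding P1_image_eq_curve_cone[OF A] by (rule conormal_map_surj_if_exact) fact
qed

text \<open>
  The projected rational normal curve shows that the open set on which both exactness properties hold is not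
  empty.
\<close>

theorem general_curve_surj:
  assumes n: "n \<ge> 5" and d: "d \<ge> 4"
  shows "general_P1_morphism n (n + 1) (\<lambda>A :: 'a::alg_closed_field mat.
    smooth_rational_curve n (n + 1) (P1_image (n + 1) A) \<and> conormal_map_surj n (P1_image (n + 1) A) d)"
proof -
  define A0 :: "'a mat" where "A0 = mat (n + 1) (n + 1 + 1) (\<lambda>(i, j). if j = gap_exp i then 1 else 0)"
  have A0: "A0 \<in> carrier_mat (n + 1) (n + 1 + 1)" by (simp add: A0_def)
  have c0: "coord (n + 1) A0 i = monom 1 (gap_exp i)" if "i \<le> n" for i
    using that by (intro poly_eqI) (auto simp: coeff_coord A0_def gap_exp_def)
  interpret projected_rational_normal n d "coord (n + 1) A0"
    using n d c0 by unfold_locales (auto simp: gap_exp_def)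
  obtain \<Delta>1 where \<Delta>1: "\<Delta>1 \<in> polyfun n (n + 1)" "\<Delta>1 A0 \<noteq> 0"
    "\<And>A. \<Delta>1 A \<noteq> 0 \<Longrightarrow> restr_surj n (n + 1) d (coord (n + 1) A)" by (rule restr_surj_open[OF exact(1)]) blast
  have d1: "d \<ge> 1" using d by simp
  obtain \<Delta>2 where \<Delta>2: "\<Delta>2 \<in> polyfun n (n + 1)" "\<Delta>2 A0 \<noteq> 0"
    "\<And>A. \<Delta>2 A \<noteq> 0 \<Longrightarrow> conormal_exact n (n + 1) d (coord (n + 1) A)"
    by (rule conormal_exact_open[OF exact d1]) blast
  obtain Q where Q: "mp_in ({..n} \<times> {..n + 1}) Q" "\<And>A. mp_eval Q (\<lambda>ij. A $$ ij) = \<Delta>1 A * \<Delta>2 A"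
    using polyfun_mult[OF \<Delta>1(1) \<Delta>2(1)] unfolding polyfun_def by blast
  define U where "U = {A. P1_morphism n (n + 1) A \<and> (\<exists>P\<in>{Q}. mp_eval P (\<lambda>ij. A $$ ij) \<noteq> 0)}"
  have "P1_embedding n (n + 1) A0"
    using A0 d1 exact(1) by (intro P1_embedding_if_restr_surj[where d = d]) auto
  hence "A0 \<in> U" using \<Delta>1(2) \<Delta>2(2) by (simp add: U_def Q(2) P1_embedding_def)
  moreover have "smooth_rational_curve n (n + 1) (P1_image (n + 1) A) \<and> conormal_map_surj n (P1_image (n + 1) A) d"
    if "A \<in> U" for A
  proof -
    have A: "A \<in> carrier_mat (n + 1) (n + 1 + 1)" "\<Delta>1 A \<noteq> 0" "\<Delta>2 A \<noteq> 0"
      using that by (auto simp: U_def Q(2) P1_morphism_def)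
    have "P1_embedding n (n + 1) A"
      using A(1) d1 \<Delta>1(3)[OF A(2)] by (intro P1_embedding_if_restr_surj[where d = d]) auto
    moreover have "conormal_map_surj n (P1_image (n + 1) A) d"
      using A(1) d1 \<Delta>1(3)[OF A(2)] \<Delta>2(3)[OF A(3)] by (intro conormal_map_surj_if_matrix_exact) auto
    ultimately show ?thesis unfolding smooth_rational_curve_def by blast
  qed
  ultimately show ?thesis unfolding general_P1_morphism_def using Q(1)
    by (intro exI[of _ "{Q}"] exI[of _ U]) (auto simp: U_def)
qed

theorem rational_normal_curve_surj:
  fixes C :: "'a::alg_closed_field vec set"
  assumes C: "rational_normal_curve n e C" and d: "d \<ge> 3"
  shows "conormal_map_surj n C d"
proof -
  define A0 :: "'a mat" where "A0 = mat (n + 1) (e + 1) (\<lambda>(i, j). if i = j then 1 else 0)"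
  obtain M where e: "1 \<le> e" "e \<le> n" and M: "M \<in> carrier_mat (n + 1) (n + 1)" "invertible_mat M"
    and CM: "C = (\<lambda>x. M *\<^sub>v x) ` P1_image e A0"
    using C unfolding rational_normal_curve_def A0_def by blast
  have A0: "A0 \<in> carrier_mat (n + 1) (e + 1)" by (simp add: A0_def)
  obtain N where N: "inverts_mat M N" "inverts_mat N M" using M(2) unfolding invertible_mat_def by blast
  have MN: "M * N = 1\<^sub>m (n + 1)" "N * M = 1\<^sub>m (dim_row N)" using N M(1) by (auto simp: inverts_mat_def)
  have Nc: "N \<in> carrier_mat (n + 1) (n + 1)"
    using arg_cong[OF MN(1), of dim_col] arg_cong[OF MN(2), of dim_col] M(1) by auto
  have c0: "coord e A0 i = (if i \<le> e then monom 1 i else 0)" if "i \<le> n" for i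
    using that e(2) by (intro poly_eqI) (auto simp: coeff_coord A0_def)
  interpret rational_normal n e d "coord e A0"
    using e d c0 by unfold_locales auto
  have MA: "M * A0 \<in> carrier_mat (n + 1) (e + 1)" using M A0 by simp
  have entry: "(X * Y) $$ (i, k) = (\<Sum>j\<le>n. X $$ (i, j) * Y $$ (j, k))"
    if "X \<in> carrier_mat (n + 1) (n + 1)" "Y \<in> carrier_mat (n + 1) c" "i \<le> n" "k < c" for X Y :: "'a mat" and c i k
    using that by (simp add: scalar_prod_def atLeast0LessThan lessThan_Suc_atMost)
  interpret ch: coordinate_change n "\<lambda>i j. M $$ (i, j)" "\<lambda>i j. N $$ (i, j)" "coord e A0" "coord e (M * A0)"
  proof
    fix i assume i: "i \<le> n"
    show "coord e (M * A0) i = (\<Sum>j\<le>n. [:M $$ (i, j):] * coord e A0 j)"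
    proof (rule poly_eqI)
      fix k
      show "coeff (coord e (M * A0) i) k = coeff (\<Sum>j\<le>n. [:M $$ (i, j):] * coord e A0 j) k"
        using entry[OF M(1) A0 i, of k] by (simp add: coeff_sum coeff_coord)
    qed
  next
    fix i k assume "i \<le> n" "k \<le> n"
    thus "(\<Sum>j\<le>n. N $$ (i, j) * M $$ (j, k)) = (if i = k then 1 else 0)"
      using entry[OF Nc M(1), of i k] MN(2) Nc by simp
  next
    fix i k assume "i \<le> n" "k \<le> n"
    thus "(\<Sum>j\<le>n. M $$ (i, j) * N $$ (j, k)) = (if i = k then 1 else 0)"
      using entry[OF M(1) Nc, of i k] MN(1) by simp
  qed
  have "C = P1_image e (M * A0)"
  proof -
    have "M *\<^sub>v (c \<cdot>\<^sub>v (A0 *\<^sub>v veronese e s t)) = c \<cdot>\<^sub>v ((M * A0) *\<^sub>v veronese e s t)" for c s t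
    proof -
      have v: "veronese e s t \<in> carrier_vec (e + 1)" by (simp add: veronese_def)
      have "A0 *\<^sub>v veronese e s t \<in> carrier_vec (n + 1)" using A0 by (intro carrier_vecI) simp
      thus ?thesis using assoc_mult_mat_vec[OF M(1) A0 v] mult_mat_vec[OF M(1)] by simp
    qed
    thus ?thesis unfolding CM P1_image_def by (auto simp: image_iff) (metis+)
  qed
  moreover have "conormal_map_surj n (P1_image e (M * A0)) d"
    using MA e d ch.restr_surj_change[OF exact(1)] ch.conormal_exact_change[OF exact(2)]
    by (intro conormal_map_surj_if_matrix_exact) auto
  ultimately show ?thesis by simp
qed

theorem theorem3p1:
  fixes n d :: nat
  assumes "n \<ge> 3"
  shows "(\<forall>e (C :: 'a::alg_closed_field vec set).
            smooth_rational_curve n e C \<longrightarrow> rational_normal_curve n e C \<longrightarrow> e \<le> n \<longrightarrow> d \<ge> 3 \<longrightarrow>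
            conormal_map_surj n C d)
       \<and> (d \<ge> 5 \<longrightarrow> n \<ge> 5 \<longrightarrow>
            general_P1_morphism n (n + 1) (\<lambda>A :: 'a mat.
              smooth_rational_curve n (n + 1) (P1_image (n + 1) A) \<and>
              conormal_map_surj n (P1_image (n + 1) A) d))"
  using rational_normal_curve_surj general_curve_surj[of n d] by auto

end
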